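(* Let $K$ be a field, $\overline{K}$ an algebraic closure of $K$, $v$ a valuation on $\overline{K}$, and $\Gamma=v\overline{K}$ its value group. Let $\theta\in\overline{K}$ have degree $n\ge 1$ over $K$, and let $[A_0,A_1,\dots,A_{r-1},A_r=\{\theta\}]$ be any Okutsu sequence of $\theta$, with degrees $m_\ell=\deg_K A_\ell$ for $0\le \ell\le r$. Then its length $r$ is equal to $\operatorname{depth}(\theta)$. Moreover, for every Mac Lane--Vaquié (MLV) chain $$v\to\mu_0\to\mu_1\to\cdots\to\mu_{r-1}\to\mu_r=v_\theta$$ of the valuation $v_\theta$ on $K[x]$, and every $0\le \ell<r$, the augmentation $\mu_\ell\to\mu_{\ell+1}$ is ordinary if and only if the set $D_{m_\ell}=\{v(\theta-b)\mid b\in\overline{K},\ \deg_K b=m_\ell\}$ contains a maximal element.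
   Context: **Valuations on $K[x]$.** Valuations are written additively, with arbitrary ordered abelian value groups. Put $\Gamma_\infty=\Gamma\cup\{\infty\}$. For $\theta\in\overline{K}$, define $v_\theta\colon K[x]\to\Gamma_\infty$ by $v_\theta(f)=v(f(\theta))$. Let $\mathcal{T}(\Gamma)$ be the set of all valuations $\mu\colon K[x]\to\Gamma_\infty$ with $\mu_{|K}=v_{|K}$ (the value $\infty$ on nonzero polynomials is allowed; $\operatorname{supp}(\mu)=\mu^{-1}(\infty)$ is a prime ideal). **Key polynomials.** For $\mu\in\mathcal{T}(\Gamma)$ let $\Gamma_\mu$ be its value group and $\mathcal{G}_\mu=\bigoplus_{\epsilon\in\Gamma_\mu}\mathcal{P}_\epsilon/\mathcal{P}_\epsilon^+$ its graded algebra, where $\mathcal{P}_\epsilon=\{f\in K[x]\mid\mu(f)\ge\epsilon\}$ and $\mathcal{P}^+_\epsilon=\{f\in K[x]\mid\mu(f)>\epsilon\}$. For $f\notin\operatorname{supp}(\mu)$, $\operatorname{in}_\mu f$ is the image of $f$ in $\mathcal{P}_{\mu(f)}/\mathcal{P}^+_{\mu(f)}$. A monic $\phi\in K[x]$ is a key polynomial for $\mu$ if $(\operatorname{in}_\mu\phi)\mathcal{G}_\mu$ is a homogeneous prime ideal containing no $\operatorname{in}_\mu f$ with $\deg f<\deg\phi$. The set of key polynomials is $\operatorname{KP}(\mu)$; the degree of $\mu$ is the minimal degree of its key polynomials. **Ordinary augmentation.** For $\phi\in\operatorname{KP}(\mu)$ and $\gamma\in\Gamma_\infty$, $\gamma>\mu(\phi)$,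 the valuation $[\mu;\phi,\gamma]$ is defined on $\phi$-expansions by $\sum_n a_n\phi^n\mapsto\min_n\{\mu(a_n)+n\gamma\}$ ($\deg a_n<\deg\phi$). **Limit augmentation.** Let $\mathcal{A}=(\rho_i)_{i\in I}$ be a family in $\mathcal{T}(\Gamma)$ indexed by a totally ordered set $I$ with a least element $0$ and no maximal element, such that $\rho_0=\mu$ and, for all $i<j$, $\rho_j=[\rho_i;\chi_j,\beta_j]$ is an ordinary augmentation with $\beta_j\in\Gamma$, where all $\chi_j$ have the same degree. A polynomial $f$ is $\mathcal{A}$-stable if $\rho_i(f)$ is eventually constant; the eventual value is denoted $\rho_{\mathcal{A}}(f)$. A limit key polynomial for $\mathcal{A}$ is a monic $\mathcal{A}$-unstable polynomial $\phi$ of minimal degree among the unstable ones. For $\gamma\in\Gamma_\infty$ with $\gamma>\rho_i(\phi)$ for all $i$, the limit augmentation $[\mathcal{A};\phi,\gamma]$ of $\mu$ is $\sum_n a_n\phi^n\mapsto\min_n\{\rho_{\mathcal{A}}(a_n)+n\gamma\}$ ($\deg a_n<\deg\phi$). **MLV chains and depth.** An MLV chain of $v_\theta$ of length $r$ is a chain $$v\xrightarrow{\phi_0,\gamma_0}\mu_0\xrightarrow{\phi_1,\gamma_1}\mu_1\to\cdots\xrightarrow{\phi_r,\gamma_r}\mu_r=v_\theta$$ in which: $\phi_0$ is monic of degree one and $\mu_0(\sum_n a_n\phi_0^n)=\min_n\{v(a_n)+n\gamma_0\}$ for $a_n\in K$; each $\mu_{n-1}\to\mu_n$ ($1\le n\le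 r$) is either an ordinary augmentation $\mu_n=[\mu_{n-1};\phi_n,\gamma_n]$ with $\phi_n\in \operatorname{KP}(\mu_{n-1})$, or a limit augmentation $\mu_n=[\mathcal{A}_n;\phi_n,\gamma_n]$, where $\mathcal{A}_n=(\rho_i)_{i\in I}$ is a family in $\mathcal{T}(\Gamma)$ indexed by a totally ordered set $I$ with a least element $0$ and no maximal element, with first valuation $\rho_0=\mu_{n-1}$ and such that, for all $i<j$, $\rho_j=[\rho_i;\chi_j,\beta_j]$ is an ordinary augmentation with $\beta_j\in\Gamma$ and all $\chi_j$ of the same degree, $\phi_n$ is a limit key polynomial for $\mathcal{A}_n$, and $\gamma_n>\rho_i(\phi_n)$ for all $i\in I$; $\gamma_0,\dots,\gamma_{r-1}\in\Gamma$, $\gamma_r=\infty$, and $\phi_r$ is the minimal polynomial of $\theta$ over $K$; $1=\deg\phi_0<\cdots<\deg\phi_r$; and if $\mu_{n-1}\to\mu_n$ is a limit augmentation, then $v_\theta(\phi_{n-1})=\gamma_{n-1}$ and all valuations in $\mathcal{A}_n$ have degree equal to $\deg\phi_{n-1}$. It is a known theorem (Mac Lane, Vaquié, Nart) that $v_\theta$ admits MLV chains and all of them have the same length; this common length is $\operatorname{depth}(\theta)=\operatorname{depth}(v_\theta)$. **Okutsu sequences.** For $1\le m\le n$ put $D_m=\{v(\theta-b)\mid b\in\overline{K},\ \deg_K b=m\}\subseteq\Gamma_\infty$. A subset $A\subseteq\overline{K}$ has a common degree, denoted $\deg_K A$, if all its elements have the same degree over $K$. An Okutsu sequence of $\theta$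 is a finite sequence $[A_0,A_1,\dots,A_{r-1},A_r=\{\theta\}]$ of common degree subsets of $\overline{K}$, with $m_\ell=\deg_K A_\ell$ satisfying $1=m_0<m_1<\cdots<m_r=n$, such that for all $0\le\ell<r$: - (OS0) for all $b\in\overline{K}$ with $\deg_K b<m_{\ell+1}$, we have $v(\theta-b)\le v(\theta-a)$ for some $a\in A_\ell$; - (OS1) $\#A_\ell=1$ whenever $\max(D_{m_\ell})$ exists; - (OS2) if $\max(D_{m_\ell})$ does not exist, then $A_\ell$ is well-ordered with respect to the ordering $a<a'\Longleftrightarrow v(\theta-a)<v(\theta-a')$; - (OS3) for all $a\in A_\ell$, $b\in A_{\ell+1}$, we have $v(\theta-a)<v(\theta-b)$. The length of this sequence is $r$. *)

theory Defs
  imports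
    "HOL-Algebra.Ideal"
    "HOL-Algebra.Product_Groups"
    "HOL-Computational_Algebra.Polynomial"
begin

section \<open>Ordered groups with a point at infinity\<close>

datatype 'g with_infty = Fin 'g | Infty

instantiation with_infty :: (linorder) linorder
begin

definition less_eq_with_infty :: "'a with_infty \<Rightarrow> 'a with_infty \<Rightarrow> bool" where
  "x \<le> y \<longleftrightarrow> (case y of Infty \<Rightarrow> True
                    | Fin b \<Rightarrow> (case x of Infty \<Rightarrow> False | Fin a \<Rightarrow> a \<le> b))"

definition less_with_infty :: "'a with_infty \<Rightarrow> 'a with_infty \<Rightarrow> bool" where
  "x < y \<longleftrightarrow> x \<le> y \<and> \<not> y \<le> x" for x y :: "'a with_infty"

instance
  by standard (auto simp: less_eq_with_infty_def less_with_infty_def split: with_infty.splits)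

end

instantiation with_infty :: (comm_monoid_add) comm_monoid_add
begin

definition zero_with_infty :: "'a with_infty" where
  "0 = Fin 0"

definition plus_with_infty :: "'a with_infty \<Rightarrow> 'a with_infty \<Rightarrow> 'a with_infty" where
  "x + y = (case x of Infty \<Rightarrow> Infty
              | Fin a \<Rightarrow> (case y of Infty \<Rightarrow> Infty | Fin b \<Rightarrow> Fin (a + b)))"

instance
  by standard (auto simp: zero_with_infty_def plus_with_infty_def add_ac split: with_infty.splits)

end

text \<open>The multiple \<open>n \<gamma>\<close>, with the convention \<open>0 \<cdot> \<infinity> = 0\<close>.\<close>

definition nmul :: "nat \<Rightarrow> 'g::comm_monoid_add with_infty \<Rightarrow> 'g with_infty" where
  "nmul n \<gamma> = (\<Sum>i<n. \<gamma>)"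


section \<open>Valuations\<close>

text \<open>
  The value \<open>\<infinity>\<close> is allowed on nonzero elements; on a field, the conditions force
  \<open>w x = \<infinity>\<close> only for \<open>x = 0\<close>.
\<close>

definition valuation :: "('r::comm_ring_1 \<Rightarrow> 'g::linordered_ab_group_add with_infty) \<Rightarrow> bool" where
  "valuation w \<longleftrightarrow> w 0 = Infty \<and> w 1 = 0 \<and>
     (\<forall>x y. w (x * y) = w x + w y) \<and> (\<forall>x y. min (w x) (w y) \<le> w (x + y))"

text \<open>
  The group generated by the finite values. A valuation on \<open>K[x]\<close> with trivial support need
  not attain all elements of its value group on polynomials.
\<close>

definition value_group :: "('r \<Rightarrow> 'g::linordered_ab_group_add with_infty) \<Rightarrow> 'g set" where
  "value_group w = {\<alpha> - \<beta> | \<alpha> \<beta>. Fin \<alpha> \<in> range w \<and> Fin \<beta> \<in> range w}"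


section \<open>The algebraic closure\<close>

definition algebraic_closure :: "('k::field \<Rightarrow> 'l::alg_closed_field) \<Rightarrow> bool" where
  "algebraic_closure \<iota> \<longleftrightarrow>
     \<iota> 1 = 1 \<and> (\<forall>x y. \<iota> (x + y) = \<iota> x + \<iota> y) \<and> (\<forall>x y. \<iota> (x * y) = \<iota> x * \<iota> y) \<and>
     (\<forall>a. \<exists>p. p \<noteq> 0 \<and> poly (map_poly \<iota> p) a = 0)"

definition min_poly :: "('k::field \<Rightarrow> 'l::field) \<Rightarrow> 'l \<Rightarrow> 'k poly" where
  "min_poly \<iota> a = (THE p. lead_coeff p = 1 \<and> poly (map_poly \<iota> p) a = 0 \<and>
     (\<forall>q. q \<noteq> 0 \<and> poly (map_poly \<iota> q) a = 0 \<longrightarrow> degree p \<le> degree q))"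

definition deg_over :: "('k::field \<Rightarrow> 'l::field) \<Rightarrow> 'l \<Rightarrow> nat" where
  "deg_over \<iota> a = degree (min_poly \<iota> a)"

definition val_at :: "('k::field \<Rightarrow> 'l::field) \<Rightarrow> ('l \<Rightarrow> 'g with_infty) \<Rightarrow> 'l \<Rightarrow> 'k poly \<Rightarrow> 'g with_infty" where
  "val_at \<iota> v \<theta> f = v (poly (map_poly \<iota> f) \<theta>)"

text \<open>The set \<open>\<T>(\<Gamma>)\<close>, where \<open>\<Gamma>\<close> is the whole type \<open>'g\<close>.\<close>

definition extensions ::
  "('k::field \<Rightarrow> 'l::field) \<Rightarrow> ('l \<Rightarrow> 'g::linordered_ab_group_add with_infty) \<Rightarrow> ('k poly \<Rightarrow> 'g with_infty) set" where
  "extensions \<iota> v = {\<mu>. valuation \<mu> \<and> (\<forall>c. \<mu> [:c:] = v (\<iota> c))}"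


section \<open>The graded algebra and key polynomials\<close>

definition filt :: "('k::field poly \<Rightarrow> 'g::linorder with_infty) \<Rightarrow> 'g \<Rightarrow> 'k poly monoid" where
  "filt \<mu> \<epsilon> = \<lparr>carrier = {f. Fin \<epsilon> \<le> \<mu> f}, monoid.mult = (+), one = 0\<rparr>"

definition filt_plus :: "('k::field poly \<Rightarrow> 'g::linorder with_infty) \<Rightarrow> 'g \<Rightarrow> 'k poly set" where
  "filt_plus \<mu> \<epsilon> = {f. Fin \<epsilon> < \<mu> f}"

definition graded_piece :: "('k::field poly \<Rightarrow> 'g::linorder with_infty) \<Rightarrow> 'g \<Rightarrow> 'k poly set monoid" where
  "graded_piece \<mu> \<epsilon> = filt \<mu> \<epsilon> Mod filt_plus \<mu> \<epsilon>"

text \<open>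
  The product of a class of degree \<open>\<alpha>\<close> and a class of degree \<open>\<beta>\<close> is a class of degree
  \<open>\<epsilon> = \<alpha> + \<beta>\<close>; it does not depend on the representatives, all of which are multiplied.
\<close>

definition class_mult ::
  "('k::field poly \<Rightarrow> 'g::linorder with_infty) \<Rightarrow> 'g \<Rightarrow> 'k poly set \<Rightarrow> 'k poly set \<Rightarrow> 'k poly set" where
  "class_mult \<mu> \<epsilon> X Y = (\<Union>f\<in>X. \<Union>g\<in>Y. filt_plus \<mu> \<epsilon> #>\<^bsub>filt \<mu> \<epsilon>\<^esub> (f * g))"

definition initial_form ::
  "('k::field poly \<Rightarrow> 'g::linordered_ab_group_add with_infty) \<Rightarrow> 'k poly \<Rightarrow> 'g \<Rightarrow> 'k poly set" where
  "initial_form \<mu> f = (\<lambda>\<epsilon>\<in>value_group \<mu>.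
     if \<mu> f = Fin \<epsilon> then filt_plus \<mu> \<epsilon> #>\<^bsub>filt \<mu> \<epsilon>\<^esub> f else filt_plus \<mu> \<epsilon>)"

text \<open>
  The additive group is the direct sum of the pieces, so an element is a family of classes
  indexed by the value group, almost all of them zero, where zero in degree \<open>\<epsilon>\<close> is the class
  \<^term>\<open>filt_plus \<mu> \<epsilon>\<close>. The component of degree \<open>\<epsilon>\<close> of a product is the sum of the products of
  the components of degrees \<open>\<alpha>\<close> and \<open>\<epsilon> - \<alpha>\<close>; the group \<^term>\<open>graded_piece \<mu> \<epsilon>\<close> being
  written multiplicatively, \<^const>\<open>finprod\<close> is this sum.
\<close>

definition graded_algebra ::
  "('k::field poly \<Rightarrow> 'g::linordered_ab_group_add with_infty) \<Rightarrow> ('g \<Rightarrow> 'k poly set) ring" where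
  "graded_algebra \<mu> =
     (let S = sum_group (value_group \<mu>) (graded_piece \<mu>)
      in \<lparr>carrier = carrier S,
          monoid.mult = (\<lambda>x y. \<lambda>\<epsilon>\<in>value_group \<mu>.
             finprod (graded_piece \<mu> \<epsilon>)
               (\<lambda>\<alpha>. class_mult \<mu> \<epsilon> (x \<alpha>) (y (\<epsilon> - \<alpha>)))
               {\<alpha> \<in> value_group \<mu>. x \<alpha> \<noteq> filt_plus \<mu> \<alpha>}),
          one = initial_form \<mu> 1,
          zero = \<one>\<^bsub>S\<^esub>,
          add = (\<otimes>\<^bsub>S\<^esub>)\<rparr>)"

definition homogeneous ::
  "('k::field poly \<Rightarrow> 'g::linordered_ab_group_add with_infty) \<Rightarrow> ('g \<Rightarrow> 'k poly set) set \<Rightarrow> bool" where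
  "homogeneous \<mu> I \<longleftrightarrow> (\<forall>x\<in>I. \<forall>\<epsilon>\<in>value_group \<mu>.
     (\<lambda>\<alpha>\<in>value_group \<mu>. if \<alpha> = \<epsilon> then x \<alpha> else filt_plus \<mu> \<alpha>) \<in> I)"

text \<open>
  The initial form is only meaningful off the support \<open>\<mu>\<inverse>(\<infinity>)\<close>, hence the restrictions
  \<open>\<mu> \<phi> \<noteq> \<infinity>\<close> and \<open>\<mu> f \<noteq> \<infinity>\<close>.
\<close>

definition key_polynomials ::
  "('k::field poly \<Rightarrow> 'g::linordered_ab_group_add with_infty) \<Rightarrow> 'k poly set" where
  "key_polynomials \<mu> = {\<phi>. lead_coeff \<phi> = 1 \<and> \<mu> \<phi> \<noteq> Infty \<and>
     (let I = PIdl\<^bsub>graded_algebra \<mu>\<^esub> (initial_form \<mu> \<phi>)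
      in homogeneous \<mu> I \<and> primeideal I (graded_algebra \<mu>) \<and>
         (\<forall>f. \<mu> f \<noteq> Infty \<and> degree f < degree \<phi> \<longrightarrow> initial_form \<mu> f \<notin> I))}"

definition val_degree ::
  "('k::field poly \<Rightarrow> 'g::linordered_ab_group_add with_infty) \<Rightarrow> nat" where
  "val_degree \<mu> = (LEAST d. d \<in> degree ` key_polynomials \<mu>)"


section \<open>Augmentations\<close>

text \<open>
  For monic \<open>\<phi>\<close> of positive degree, \<open>f = (\<Sum>n\<le>degree f. a\<^sub>n * \<phi> ^ n)\<close> with
  \<open>a\<^sub>n = f div \<phi> ^ n mod \<phi>\<close> is the \<open>\<phi>\<close>-expansion of \<open>f\<close>; see \<open>expansion_val_eq\<close> below.
\<close>

definition expansion_val ::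
  "('k::field poly \<Rightarrow> 'g::linordered_ab_group_add with_infty) \<Rightarrow> 'k poly \<Rightarrow> 'g with_infty
     \<Rightarrow> 'k poly \<Rightarrow> 'g with_infty" where
  "expansion_val w \<phi> \<gamma> f = Min ((\<lambda>n. w (f div \<phi> ^ n mod \<phi>) + nmul n \<gamma>) ` {..degree f})"

lemma expansion_digits:
  fixes \<phi> :: "'k::field poly"
  assumes "degree \<phi> > 0" and "\<forall>n\<le>N. degree (a n) < degree \<phi>"
  shows "(\<Sum>n\<le>N. a n * \<phi> ^ n) div \<phi> ^ k mod \<phi> = (if k \<le> N then a k else 0)"
  using assms(2)
proof (induction k arbitrary: N a)
  case 0
  have eq: "(\<Sum>n\<le>N. a n * \<phi> ^ n) = a 0 + \<phi> * (\<Sum>n\<in>{1..N}. a n * \<phi> ^ (n - 1))"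
  proof -
    have "{..N} = insert 0 {1..N}" by auto
    then have "(\<Sum>n\<le>N. a n * \<phi> ^ n) = a 0 + (\<Sum>n\<in>{1..N}. a n * \<phi> ^ n)" by simp
    also have "(\<Sum>n\<in>{1..N}. a n * \<phi> ^ n) = (\<Sum>n\<in>{1..N}. \<phi> * (a n * \<phi> ^ (n - 1)))"
      by (intro sum.cong) (auto simp: power_eq_if)
    finally show ?thesis by (simp add: sum_distrib_left)
  qed
  show ?case using 0 by (simp add: eq mod_poly_less)
next
  case (Suc k)
  show ?case
  proof (cases N)
    case 0
    have "a 0 div \<phi> ^ Suc k = 0"
    proof (rule div_poly_less)
      show "degree (a 0) < degree (\<phi> ^ Suc k)"
        using Suc.prems assms(1)
        by (cases "\<phi> = 0") (auto simp: degree_power_eq simp del: power_Suc intro: less_le_trans)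
    qed
    then show ?thesis using 0 by simp
  next
    case (Suc M)
    have eq: "(\<Sum>n\<le>N. a n * \<phi> ^ n) = a 0 + \<phi> * (\<Sum>n\<le>M. a (Suc n) * \<phi> ^ n)"
      unfolding Suc by (subst sum.atMost_Suc_shift) (simp add: sum_distrib_left algebra_simps)
    have "\<phi> \<noteq> 0" using assms(1) by auto
    then have "(\<Sum>n\<le>N. a n * \<phi> ^ n) div \<phi> = (\<Sum>n\<le>M. a (Suc n) * \<phi> ^ n)"
      using Suc.prems by (simp add: eq div_poly_less)
    then have "(\<Sum>n\<le>N. a n * \<phi> ^ n) div \<phi> ^ Suc k = (\<Sum>n\<le>M. a (Suc n) * \<phi> ^ n) div \<phi> ^ k"
      by (metis poly_div_mult_right power_Suc)
    then show ?thesis using Suc.IH[of M "\<lambda>n. a (Suc n)"] Suc.prems Suc by simp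
  qed
qed

lemma Min_padding:
  fixes h :: "nat \<Rightarrow> 'g::linorder with_infty"
  assumes "\<forall>n>N. h n = Infty" and "N \<le> M"
  shows "Min (h ` {..M}) = Min (h ` {..N})"
proof (rule antisym)
  show "Min (h ` {..M}) \<le> Min (h ` {..N})"
    using assms(2) by (intro Min_antimono) auto
  have "Min (h ` {..N}) \<le> h n" for n
  proof (cases "n \<le> N")
    case False
    then show ?thesis using assms(1) by (simp add: less_eq_with_infty_def)
  qed simp
  then show "Min (h ` {..N}) \<le> Min (h ` {..M})" by (subst Min_ge_iff) auto
qed

lemma expansion_val_eq:
  fixes \<phi> :: "'k::field poly" and w :: "'k poly \<Rightarrow> 'g::linordered_ab_group_add with_infty"
  assumes "degree \<phi> > 0" and "w 0 = Infty" and "\<forall>n\<le>N. degree (a n) < degree \<phi>"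
  shows "expansion_val w \<phi> \<gamma> (\<Sum>n\<le>N. a n * \<phi> ^ n) = Min ((\<lambda>n. w (a n) + nmul n \<gamma>) ` {..N})"
proof -
  define f where "f = (\<Sum>n\<le>N. a n * \<phi> ^ n)"
  define h where "h n = w (f div \<phi> ^ n mod \<phi>) + nmul n \<gamma>" for n
  have "h n = Infty" if "n > N" for n
    using that expansion_digits[OF assms(1,3), of n] assms(2)
    by (simp add: h_def f_def plus_with_infty_def)
  moreover have "h n = Infty" if "n > degree f" for n
  proof -
    have "degree f < degree (\<phi> ^ n)"
      using that assms(1) by (cases "\<phi> = 0") (auto simp: degree_power_eq intro: less_le_trans)
    then show ?thesis using assms(2) by (simp add: h_def div_poly_less plus_with_infty_def)
  qed
  ultimately have "Min (h ` {..degree f}) = Min (h ` {..N})"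
    by (metis Min_padding nat_le_linear)
  also have "h ` {..N} = (\<lambda>n. w (a n) + nmul n \<gamma>) ` {..N}"
    using expansion_digits[OF assms(1,3)] by (auto simp: h_def f_def image_iff)
  finally show ?thesis by (simp add: expansion_val_def h_def f_def)
qed

definition ordinary_augmentation ::
  "('k::field poly \<Rightarrow> 'g::linordered_ab_group_add with_infty) \<Rightarrow> 'k poly \<Rightarrow> 'g with_infty
     \<Rightarrow> ('k poly \<Rightarrow> 'g with_infty) \<Rightarrow> bool" where
  "ordinary_augmentation \<mu> \<phi> \<gamma> \<mu>' \<longleftrightarrow>
     \<phi> \<in> key_polynomials \<mu> \<and> \<mu> \<phi> < \<gamma> \<and> \<mu>' = expansion_val \<mu> \<phi> \<gamma>"

text \<open>
  A family \<open>(\<rho>\<^sub>i)\<close>, \<open>i \<in> I\<close>, is given by its index set, the (reflexive) total order on the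
  index set, and the map \<open>\<rho>\<close>.
\<close>

type_synonym ('i, 'k, 'g) family = "'i set \<times> 'i rel \<times> ('i \<Rightarrow> 'k poly \<Rightarrow> 'g with_infty)"

fun augmentation_family ::
  "('k::field \<Rightarrow> 'l::field) \<Rightarrow> ('l \<Rightarrow> 'g::linordered_ab_group_add with_infty)
     \<Rightarrow> ('k poly \<Rightarrow> 'g with_infty) \<Rightarrow> ('i, 'k, 'g) family \<Rightarrow> bool" where
  "augmentation_family \<iota> v \<mu> (I, R, \<rho>) \<longleftrightarrow>
     linear_order_on I R \<and> (\<forall>i\<in>I. \<rho> i \<in> extensions \<iota> v) \<and>
     (\<forall>i\<in>I. \<exists>j\<in>I. (i, j) \<in> R - Id) \<and>
     (\<exists>i\<^sub>0\<in>I. (\<forall>i\<in>I. (i\<^sub>0, i) \<in> R) \<and> \<rho> i\<^sub>0 = \<mu>) \<and>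
     (\<exists>(\<chi> :: 'i \<Rightarrow> 'k poly) (\<beta> :: 'i \<Rightarrow> 'g) m.
        \<forall>i j. (i, j) \<in> R - Id \<longrightarrow>
          ordinary_augmentation (\<rho> i) (\<chi> j) (Fin (\<beta> j)) (\<rho> j) \<and> degree (\<chi> j) = m)"

fun eventual_value :: "('i, 'k::field, 'g) family \<Rightarrow> 'k poly \<Rightarrow> 'g with_infty \<Rightarrow> bool" where
  "eventual_value (I, R, \<rho>) f c \<longleftrightarrow> (\<exists>i\<in>I. \<forall>j\<in>I. (i, j) \<in> R \<longrightarrow> \<rho> j f = c)"

definition stable :: "('i, 'k::field, 'g) family \<Rightarrow> 'k poly \<Rightarrow> bool" where
  "stable A f \<longleftrightarrow> (\<exists>c. eventual_value A f c)"

definition stable_val :: "('i, 'k::field, 'g) family \<Rightarrow> 'k poly \<Rightarrow> 'g with_infty" where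
  "stable_val A f = (THE c. eventual_value A f c)"

definition limit_key_polynomial :: "('i, 'k::field, 'g) family \<Rightarrow> 'k poly \<Rightarrow> bool" where
  "limit_key_polynomial A \<phi> \<longleftrightarrow> lead_coeff \<phi> = 1 \<and> \<not> stable A \<phi> \<and>
     (\<forall>f. \<not> stable A f \<longrightarrow> degree \<phi> \<le> degree f)"

fun limit_augmentation ::
  "('k::field \<Rightarrow> 'l::field) \<Rightarrow> ('l \<Rightarrow> 'g::linordered_ab_group_add with_infty)
     \<Rightarrow> ('k poly \<Rightarrow> 'g with_infty) \<Rightarrow> ('i, 'k, 'g) family \<Rightarrow> 'k poly \<Rightarrow> 'g with_infty
     \<Rightarrow> ('k poly \<Rightarrow> 'g with_infty) \<Rightarrow> bool" where
  "limit_augmentation \<iota> v \<mu> (I, R, \<rho>) \<phi> \<gamma> \<mu>' \<longleftrightarrow>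
     augmentation_family \<iota> v \<mu> (I, R, \<rho>) \<and> limit_key_polynomial (I, R, \<rho>) \<phi> \<and>
     (\<forall>i\<in>I. \<rho> i \<phi> < \<gamma>) \<and> \<mu>' = expansion_val (stable_val (I, R, \<rho>)) \<phi> \<gamma>"


section \<open>Mac Lane--Vaquie chains and depth\<close>

datatype 'f augmentation = Ordinary | Limit 'f

text \<open>
  The \<open>n\<close>-th entry of \<open>s\<close> is the kind of the augmentation \<open>\<mu>\<^sub>n \<rightarrow> \<mu>\<^sub>n\<^sub>+\<^sub>1\<close>.
\<close>

definition mlv_chain ::
  "('k::field \<Rightarrow> 'l::field) \<Rightarrow> ('l \<Rightarrow> 'g::linordered_ab_group_add with_infty) \<Rightarrow> 'l \<Rightarrow> nat
     \<Rightarrow> (nat \<Rightarrow> 'k poly) \<Rightarrow> (nat \<Rightarrow> 'g with_infty) \<Rightarrow> (nat \<Rightarrow> 'k poly \<Rightarrow> 'g with_infty)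
     \<Rightarrow> (nat \<Rightarrow> ('i, 'k, 'g) family augmentation) \<Rightarrow> bool" where
  "mlv_chain \<iota> v \<theta> r \<phi> \<gamma> \<mu> s \<longleftrightarrow>
     lead_coeff (\<phi> 0) = 1 \<and> degree (\<phi> 0) = 1 \<and>
     \<mu> 0 = expansion_val (\<lambda>a. v (\<iota> (coeff a 0))) (\<phi> 0) (\<gamma> 0) \<and>
     (\<forall>n<r. case s n of
        Ordinary \<Rightarrow> ordinary_augmentation (\<mu> n) (\<phi> (Suc n)) (\<gamma> (Suc n)) (\<mu> (Suc n))
      | Limit A \<Rightarrow> limit_augmentation \<iota> v (\<mu> n) A (\<phi> (Suc n)) (\<gamma> (Suc n)) (\<mu> (Suc n)) \<and>
          val_at \<iota> v \<theta> (\<phi> n) = \<gamma> n \<and>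
          (case A of (I, R, \<rho>) \<Rightarrow> \<forall>i\<in>I. val_degree (\<rho> i) = degree (\<phi> n))) \<and>
     \<mu> r = val_at \<iota> v \<theta> \<and>
     (\<forall>n<r. \<gamma> n \<noteq> Infty) \<and> \<gamma> r = Infty \<and> \<phi> r = min_poly \<iota> \<theta> \<and>
     (\<forall>n<r. degree (\<phi> n) < degree (\<phi> (Suc n)))"

text \<open>
  In a family as above \<open>\<rho>\<^sub>i(\<chi>\<^sub>j) < \<beta>\<^sub>j = \<rho>\<^sub>j(\<chi>\<^sub>j)\<close> for \<open>i < j\<close>, so \<open>i \<mapsto> \<rho>\<^sub>i\<close> is injective and every
  family can be reindexed by a set of valuations. Using the type of valuations as index type
  (with arbitrary index set and order) therefore covers all MLV chains.
\<close>

definition depth ::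
  "('k::field \<Rightarrow> 'l::field) \<Rightarrow> ('l \<Rightarrow> 'g::linordered_ab_group_add with_infty) \<Rightarrow> 'l \<Rightarrow> nat" where
  "depth \<iota> v \<theta> = (THE r. \<exists>\<phi> \<gamma> \<mu> (s :: nat \<Rightarrow> ('k poly \<Rightarrow> 'g with_infty, 'k, 'g) family augmentation).
     mlv_chain \<iota> v \<theta> r \<phi> \<gamma> \<mu> s)"


section \<open>Okutsu sequences\<close>

definition distances ::
  "('k::field \<Rightarrow> 'l::field) \<Rightarrow> ('l \<Rightarrow> 'g with_infty) \<Rightarrow> 'l \<Rightarrow> nat \<Rightarrow> 'g with_infty set" where
  "distances \<iota> v \<theta> m = {v (\<theta> - b) | b. deg_over \<iota> b = m}"

definition has_max :: "'a::linorder set \<Rightarrow> bool" where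
  "has_max D \<longleftrightarrow> (\<exists>d\<in>D. \<forall>e\<in>D. e \<le> d)"

definition common_degree :: "('k::field \<Rightarrow> 'l::field) \<Rightarrow> 'l set \<Rightarrow> nat \<Rightarrow> bool" where
  "common_degree \<iota> S m \<longleftrightarrow> S \<noteq> {} \<and> (\<forall>a\<in>S. deg_over \<iota> a = m)"

definition okutsu_sequence ::
  "('k::field \<Rightarrow> 'l::field) \<Rightarrow> ('l \<Rightarrow> 'g::linordered_ab_group_add with_infty) \<Rightarrow> 'l \<Rightarrow> nat
     \<Rightarrow> (nat \<Rightarrow> 'l set) \<Rightarrow> (nat \<Rightarrow> nat) \<Rightarrow> bool" where
  "okutsu_sequence \<iota> v \<theta> r A m \<longleftrightarrow>
     A r = {\<theta>} \<and> (\<forall>l\<le>r. common_degree \<iota> (A l) (m l)) \<and>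
     m 0 = 1 \<and> (\<forall>l<r. m l < m (Suc l)) \<and> m r = deg_over \<iota> \<theta> \<and>
     (\<forall>l<r.
        (\<forall>b. deg_over \<iota> b < m (Suc l) \<longrightarrow> (\<exists>a\<in>A l. v (\<theta> - b) \<le> v (\<theta> - a))) \<and>
        (has_max (distances \<iota> v \<theta> (m l)) \<longrightarrow> card (A l) = 1) \<and>
        (\<not> has_max (distances \<iota> v \<theta> (m l)) \<longrightarrow>
           well_order_on (A l) {(a, a'). a \<in> A l \<and> a' \<in> A l \<and> (a = a' \<or> v (\<theta> - a) < v (\<theta> - a'))}) \<and>
        (\<forall>a\<in>A l. \<forall>b\<in>A (Suc l). v (\<theta> - a) < v (\<theta> - b)))"

end

theory Submission
  imports Defs "HOL-Library.Poly_Mapping"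
begin

text \<open>
  For \<open>\<delta>\<close> in \<open>\<Gamma>\<^sub>\<infinity>\<close>, the value at a generic point of the ball \<open>B(\<theta>, \<delta>)\<close> is a valuation \<open>\<omega>\<^sub>\<delta>\<close> below \<open>v\<^sub>\<theta>\<close>, and
  \<open>\<omega>\<^sub>\<delta>(f) = v\<^sub>\<theta>(f)\<close> holds if and only if no root of \<open>f\<close> is closer to \<open>\<theta>\<close> than \<open>\<delta>\<close>. Let \<open>\<phi>\<close> be a monic
  polynomial whose closest root, at distance \<open>\<delta>\<close>, is closer to \<open>\<theta>\<close> than every element of degree
  smaller than \<open>deg \<phi>\<close>. Then \<open>\<omega>\<^sub>\<delta>\<close> is the truncation of \<open>v\<^sub>\<theta>\<close> on \<open>\<phi>\<close>-expansions. In an MLV chain every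
  \<open>\<mu>\<^sub>n\<close> is the truncation of \<open>v\<^sub>\<theta>\<close> at \<open>\<phi>\<^sub>n\<close>, and \<open>\<phi>\<^sub>n\<close> is such a polynomial; hence \<open>deg \<phi>\<^sub>n\<^sub>+\<^sub>1\<close> is the
  least degree of an element closer to \<open>\<theta>\<close> than all elements of degree at most \<open>deg \<phi>\<^sub>n\<close>, which is
  the recursion satisfied by the degrees of an Okutsu sequence. Conversely, if \<open>\<mu> \<le> \<nu>\<close> are valuations and
  \<open>\<chi>\<close> is monic of least degree with \<open>\<mu>(\<chi>) < \<nu>(\<chi>)\<close>, then \<open>\<chi>\<close> is a key polynomial for \<open>\<mu>\<close>, because the
  initial forms of the \<open>f\<close> with \<open>\<mu>(f) < \<nu>(f)\<close> span the kernel of a homomorphism of graded domains,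
  generated by the initial form of \<open>\<chi>\<close>. So the ball valuations around \<open>\<theta>\<close> form an MLV chain.
\<close>

text \<open>Two obstacles shape the proof. Nothing in a chain relates \<open>\<mu>\<^sub>n\<close>
  to \<open>v\<^sub>\<theta>\<close> except at its last term, so agreement in degrees below that of
  \<open>\<phi>\<^sub>n\<close> is carried backwards from the end, whereas the key property of
  \<open>\<phi>\<^sub>n\<close> is carried forwards from degree one. In a limit step the members of
  the family need not be ball valuations; yet the polynomials \<chi> of the family have the key
  property, their values \<beta> never exceed \<open>v\<^sub>\<theta>(\<chi>)\<close>, and so every
  member lies below a ball valuation. Stability, a statement on the family, can therefore be read as
  a statement on distances to \<theta>. In the other direction, a family of balls is built whose
  radii are distances attained in one degree; it has no last member because the distances of that
  degree have no maximum. The valuation axioms for balls come from points of the algebraically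
  closed field: finitely many polynomials share a generic point, so neither residue fields nor
  transcendental extensions enter.\<close>

instance with_infty :: (linordered_ab_group_add) ordered_comm_monoid_add
  by standard (auto simp: less_eq_with_infty_def plus_with_infty_def split: with_infty.splits)

lemma with_infty_simps [simp]:
  fixes x y :: "'g::linordered_ab_group_add with_infty" and \<alpha> \<beta> :: 'g
  shows
  "Fin \<alpha> + Fin \<beta> = Fin (\<alpha> + \<beta>)" "Infty + x = Infty" "x + Infty = Infty"
  "(Fin \<alpha> \<le> Fin \<beta>) = (\<alpha> \<le> \<beta>)" "x \<le> Infty" "(Infty \<le> x) = (x = Infty)"
  "(Fin \<alpha> < Fin \<beta>) = (\<alpha> < \<beta>)" "\<not> Infty < x" "(x < Infty) = (x \<noteq> Infty)"
  "(x + y = Infty) = (x = Infty \<or> y = Infty)" "0 \<noteq> (Infty :: 'g with_infty)"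
  "(Infty :: 'g with_infty) \<noteq> 0"
  by (auto simp: less_eq_with_infty_def less_with_infty_def plus_with_infty_def
      zero_with_infty_def split: with_infty.splits)

lemma with_infty_add_left_cancel:
  fixes x y c :: "'g::linordered_ab_group_add with_infty"
  assumes "c \<noteq> Infty"
  shows "(c + x \<le> c + y) = (x \<le> y)" and "(c + x < c + y) = (x < y)"
    and "(c + x = c + y) = (x = y)"
proof -
  obtain \<delta> where c: "c = Fin \<delta>"
    using assms by (cases c) auto
  show "(c + x \<le> c + y) = (x \<le> y)" "(c + x < c + y) = (x < y)" "(c + x = c + y) = (x = y)"
    unfolding c by (cases x; cases y; simp)+
qed

lemma with_infty_add_right_cancel:
  fixes x y c :: "'g::linordered_ab_group_add with_infty"
  assumes "c \<noteq> Infty"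
  shows "(x + c \<le> y + c) = (x \<le> y)" and "(x + c < y + c) = (x < y)"
    and "(x + c = y + c) = (x = y)"
  unfolding add.commute[of _ c] by (rule with_infty_add_left_cancel[OF assms])+

lemma with_infty_double_eq_0:
  fixes x :: "'g::linordered_ab_group_add with_infty"
  assumes "x + x = 0" shows "x = 0"
  using assms by (cases x) (auto simp: zero_with_infty_def double_zero)

lemma with_infty_add_less_le_mono:
  fixes a b c d :: "'g::linordered_ab_group_add with_infty"
  assumes "a < b" "c \<le> d" "c \<noteq> Infty" shows "a + c < b + d"
  using assms by (cases a; cases b; cases c; cases d) (auto intro: add_less_le_mono)

lemma with_infty_add_le_less_mono:
  fixes a b c d :: "'g::linordered_ab_group_add with_infty"
  assumes "a \<le> b" "c < d" "a \<noteq> Infty" shows "a + c < b + d"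
  using assms by (cases a; cases b; cases c; cases d) (auto intro: add_le_less_mono)

lemma nmul_0 [simp]: "nmul 0 x = 0"
  by (simp add: nmul_def)

lemma nmul_Suc: "nmul (Suc n) x = x + nmul n x"
  by (simp add: nmul_def add.commute)

lemma nmul_mono:
  fixes x y :: "'g::linordered_ab_group_add with_infty"
  shows "x \<le> y \<Longrightarrow> nmul n x \<le> nmul n y"
  by (simp add: nmul_def sum_mono)

section \<open>Valuations on commutative rings\<close>

locale valued =
  fixes w :: "'r::comm_ring_1 \<Rightarrow> 'g::linordered_ab_group_add with_infty"
  assumes valuation: "valuation w"
begin

lemma val_0 [simp]: "w 0 = Infty"
  and val_1 [simp]: "w 1 = 0"
  and val_mult: "w (x * y) = w x + w y"
  and val_add: "min (w x) (w y) \<le> w (x + y)"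
  using valuation by (simp_all add: valuation_def)

lemma val_minus [simp]: "w (- x) = w x"
proof -
  have "w (- 1) + w (- 1) = 0"
    using val_mult[of "-1" "-1"] by simp
  then have "w (- 1) = 0"
    by (rule with_infty_double_eq_0)
  then show ?thesis using val_mult[of "-1" x] by simp
qed

lemma val_diff_commute: "w (x - y) = w (y - x)"
  using val_minus[of "x - y"] by simp

lemma val_add_ge: "c \<le> w x \<Longrightarrow> c \<le> w y \<Longrightarrow> c \<le> w (x + y)"
  using val_add[of x y] by (meson min.boundedI order_trans)

lemma val_add_gt: "c < w x \<Longrightarrow> c < w y \<Longrightarrow> c < w (x + y)"
  using val_add[of x y] by (meson less_le_trans min_less_iff_conj)

lemma val_diff_ge: "c \<le> w x \<Longrightarrow> c \<le> w y \<Longrightarrow> c \<le> w (x - y)"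
  using val_add_ge[of c x "- y"] by simp

lemma val_diff_gt: "c < w x \<Longrightarrow> c < w y \<Longrightarrow> c < w (x - y)"
  using val_add_gt[of c x "- y"] by simp

lemma val_add_eq:
  assumes "w x < w y" shows "w (x + y) = w x"
proof (rule antisym)
  show "w x \<le> w (x + y)"
    using assms by (intro val_add_ge) auto
  show "w (x + y) \<le> w x"
  proof (rule ccontr)
    assume "\<not> w (x + y) \<le> w x"
    then have "w x < w (x + y - y)"
      using assms by (intro val_diff_gt) auto
    then show False by simp
  qed
qed

lemma val_diff_eq: "w x < w y \<Longrightarrow> w (x - y) = w x"
  using val_add_eq[of x "- y"] by simp

lemma val_add_neq:
  assumes "w x \<noteq> w y" shows "w (x + y) = min (w x) (w y)"
  using assms val_add_eq[of x y] val_add_eq[of y x]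
  by (cases "w x < w y") (auto simp: min_def add.commute)

lemma val_cong:
  assumes "w x < w (x - y)" shows "w y = w x"
  using val_diff_eq[OF assms] by simp

lemma val_sum_ge: "(\<And>i. i \<in> I \<Longrightarrow> c \<le> w (f i)) \<Longrightarrow> c \<le> w (sum f I)"
  by (induction I rule: infinite_finite_induct) (auto intro: val_add_ge)

lemma val_sum_gt:
  assumes "\<And>i. i \<in> I \<Longrightarrow> c < w (f i)" "c \<noteq> Infty" shows "c < w (sum f I)"
  using assms by (induction I rule: infinite_finite_induct) (auto intro: val_add_gt)

lemma value_group_iff:
  "\<epsilon> \<in> value_group w \<longleftrightarrow> (\<exists>x y \<alpha> \<beta>. w x = Fin \<alpha> \<and> w y = Fin \<beta> \<and> \<epsilon> = \<alpha> - \<beta>)"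
proof -
  have "Fin \<alpha> \<in> range w \<longleftrightarrow> (\<exists>x. w x = Fin \<alpha>)" for \<alpha>
    by (metis rangeE rangeI)
  then show ?thesis
    unfolding value_group_def by blast
qed

lemma value_group_value: "w x = Fin \<alpha> \<Longrightarrow> \<alpha> \<in> value_group w"
  unfolding value_group_iff
  by (rule exI[of _ x], rule exI[of _ 1], rule exI[of _ \<alpha>], rule exI[of _ 0])
    (simp add: zero_with_infty_def)

lemma value_group_0 [simp]: "0 \<in> value_group w"
  by (rule value_group_value[of 1]) (simp add: zero_with_infty_def)

lemma value_group_diff:
  assumes "\<alpha> \<in> value_group w" "\<beta> \<in> value_group w" shows "\<alpha> - \<beta> \<in> value_group w"
proof -
  obtain a b \<alpha>1 \<alpha>2 where 1: "w a = Fin \<alpha>1" "w b = Fin \<alpha>2" "\<alpha> = \<alpha>1 - \<alpha>2"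
    using assms(1) unfolding value_group_iff by blast
  obtain c d \<beta>1 \<beta>2 where 2: "w c = Fin \<beta>1" "w d = Fin \<beta>2" "\<beta> = \<beta>1 - \<beta>2"
    using assms(2) unfolding value_group_iff by blast
  have "w (a * d) = Fin (\<alpha>1 + \<beta>2)" "w (b * c) = Fin (\<alpha>2 + \<beta>1)"
    "\<alpha> - \<beta> = (\<alpha>1 + \<beta>2) - (\<alpha>2 + \<beta>1)"
    using 1 2 by (simp_all add: val_mult)
  then show ?thesis
    unfolding value_group_iff by blast
qed

lemma value_group_add:
  assumes "\<alpha> \<in> value_group w" "\<beta> \<in> value_group w" shows "\<alpha> + \<beta> \<in> value_group w"
  using value_group_diff[OF assms(1) value_group_diff[OF value_group_0 assms(2)]] by simp

end

lemma valuation_field_eq_Infty: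
  fixes w :: "'r::field \<Rightarrow> 'g::linordered_ab_group_add with_infty"
  assumes "valuation w" shows "w x = Infty \<longleftrightarrow> x = 0"
proof -
  interpret valued w by standard (rule assms)
  have False if "w x = Infty" "x \<noteq> 0"
    using that val_mult[of x "inverse x"] by simp
  then show ?thesis by auto
qed

section \<open>The graded algebra\<close>

abbreviation (input) "lookup \<equiv> Poly_Mapping.lookup"
abbreviation (input) "keys \<equiv> Poly_Mapping.keys"

text \<open>In a group the first exponent determines the second, so the convolution is a finite sum
  over the keys of \<open>F\<close>. This is the shape in which \<open>graded_algebra\<close>
  defines its product.\<close>

lemma lookup_mult_group:
  fixes F G :: "'g::ab_group_add \<Rightarrow>\<^sub>0 'r::comm_ring_1"
  shows "lookup (F * G) \<epsilon> = (\<Sum>\<alpha>\<in>keys F. lookup F \<alpha> * lookup G (\<epsilon> - \<alpha>))"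
proof -
  have "(\<lambda>q. Poly_Mapping.when (lookup G q) (\<epsilon> = l + q)) =
      (\<lambda>q. Poly_Mapping.when (lookup G q) (q = \<epsilon> - l))" for l
    by (auto simp: fun_eq_iff algebra_simps when_def)
  then have "Sum_any (\<lambda>q. Poly_Mapping.when (lookup G q) (\<epsilon> = l + q)) = lookup G (\<epsilon> - l)" for l
    by (simp only: Sum_any_when_equal)
  then have "lookup (F * G) \<epsilon> = Sum_any (\<lambda>l. lookup F l * lookup G (\<epsilon> - l))"
    by (simp add: lookup_mult)
  also have "\<dots> = (\<Sum>\<alpha>\<in>keys F. lookup F \<alpha> * lookup G (\<epsilon> - \<alpha>))"
    by (rule Sum_any.expand_superset) (auto simp: in_keys_iff)
  finally show ?thesis .
qed

lemma lookup_sum_single: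
  assumes "finite A"
  shows "lookup (\<Sum>\<alpha>\<in>A. Poly_Mapping.single \<alpha> (h \<alpha>)) \<epsilon> = (if \<epsilon> \<in> A then h \<epsilon> else 0)"
  using assms by (simp add: lookup_sum lookup_single when_def)

text \<open>
  The graded algebra is a quotient of the Rees ring
  \<open>\<Oplus>\<^sub>\<epsilon> P\<^sub>\<epsilon>\<close>, a subring of the group algebra of the value group over \<open>K[x]\<close>.
\<close>

definition rees :: "('k::field poly \<Rightarrow> 'g::linordered_ab_group_add with_infty) \<Rightarrow> ('g \<Rightarrow>\<^sub>0 'k poly) set" where
  "rees \<mu> = {F. \<forall>\<epsilon>\<in>keys F. \<epsilon> \<in> value_group \<mu> \<and> Fin \<epsilon> \<le> \<mu> (lookup F \<epsilon>)}"

definition homog_class ::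
  "('k::field poly \<Rightarrow> 'g::linordered_ab_group_add with_infty) \<Rightarrow> 'g \<Rightarrow> 'k poly \<Rightarrow> 'k poly set" where
  "homog_class \<mu> \<epsilon> f = filt_plus \<mu> \<epsilon> #>\<^bsub>filt \<mu> \<epsilon>\<^esub> f"

text \<open>The quotient map of the Rees ring. Restriction to the value group makes its values
  extensional functions, as the carrier of \<open>sum_group\<close> demands.\<close>

definition rees_class ::
  "('k::field poly \<Rightarrow> 'g::linordered_ab_group_add with_infty) \<Rightarrow> ('g \<Rightarrow>\<^sub>0 'k poly) \<Rightarrow> 'g \<Rightarrow> 'k poly set" where
  "rees_class \<mu> F = (\<lambda>\<epsilon>\<in>value_group \<mu>. homog_class \<mu> \<epsilon> (lookup F \<epsilon>))"

locale poly_valued = valued \<mu> for \<mu> :: "'k::field poly \<Rightarrow> 'g::linordered_ab_group_add with_infty"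
begin

abbreviation "cls \<equiv> homog_class \<mu>"

lemma mem_homog_class: "x \<in> cls \<epsilon> f \<longleftrightarrow> Fin \<epsilon> < \<mu> (x - f)"
  by (auto simp: homog_class_def r_coset_def filt_def filt_plus_def intro: exI[of _ "x - f"])

lemma homog_class_eq_iff: "cls \<epsilon> f = cls \<epsilon> g \<longleftrightarrow> Fin \<epsilon> < \<mu> (f - g)"
proof
  assume "cls \<epsilon> f = cls \<epsilon> g"
  then have "f \<in> cls \<epsilon> g" by (metis mem_homog_class diff_self val_0 with_infty_simps(9) with_infty.distinct(1))
  then show "Fin \<epsilon> < \<mu> (f - g)" by (simp add: mem_homog_class)
next
  assume *: "Fin \<epsilon> < \<mu> (f - g)"
  have "Fin \<epsilon> < \<mu> (x - f) \<longleftrightarrow> Fin \<epsilon> < \<mu> (x - g)" for x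
    using val_add_gt[OF _ *, of "x - f"] val_diff_gt[OF _ *, of "x - g"] by (auto simp: algebra_simps)
  then show "cls \<epsilon> f = cls \<epsilon> g" by (auto simp: mem_homog_class)
qed

lemma homog_class_0: "cls \<epsilon> 0 = filt_plus \<mu> \<epsilon>"
  by (auto simp: mem_homog_class filt_plus_def)

lemma homog_class_eq_0_iff: "cls \<epsilon> f = filt_plus \<mu> \<epsilon> \<longleftrightarrow> Fin \<epsilon> < \<mu> f"
  using homog_class_eq_iff[of \<epsilon> f 0] by (simp add: homog_class_0)

lemma carrier_graded_piece: "carrier (graded_piece \<mu> \<epsilon>) = cls \<epsilon> ` {f. Fin \<epsilon> \<le> \<mu> f}"
  by (auto simp: graded_piece_def FactGroup_def RCOSETS_def homog_class_def filt_def)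

lemma one_graded_piece: "\<one>\<^bsub>graded_piece \<mu> \<epsilon>\<^esub> = cls \<epsilon> 0"
  by (simp add: graded_piece_def FactGroup_def homog_class_0)

lemma mult_graded_piece: "cls \<epsilon> f \<otimes>\<^bsub>graded_piece \<mu> \<epsilon>\<^esub> cls \<epsilon> g = cls \<epsilon> (f + g)"
proof -
  have "x \<in> cls \<epsilon> (f + g)" if "x = y + z" "y \<in> cls \<epsilon> f" "z \<in> cls \<epsilon> g" for x y z
    using that val_add_gt[of "Fin \<epsilon>" "y - f" "z - g"] by (simp add: mem_homog_class algebra_simps)
  moreover have "\<exists>y\<in>cls \<epsilon> f. \<exists>z\<in>cls \<epsilon> g. x = y + z" if "x \<in> cls \<epsilon> (f + g)" for x
    using that by (intro bexI[of _ "x - g"] bexI[of _ g]) (auto simp: mem_homog_class algebra_simps)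
  ultimately show ?thesis
    by (auto simp: graded_piece_def FactGroup_def set_mult_def filt_def)
qed

lemma comm_group_graded_piece: "comm_group (graded_piece \<mu> \<epsilon>)"
proof (rule comm_groupI)
  fix x assume "x \<in> carrier (graded_piece \<mu> \<epsilon>)"
  then obtain f where "x = cls \<epsilon> f" "Fin \<epsilon> \<le> \<mu> f" by (auto simp: carrier_graded_piece)
  then show "\<exists>y\<in>carrier (graded_piece \<mu> \<epsilon>). y \<otimes>\<^bsub>graded_piece \<mu> \<epsilon>\<^esub> x = \<one>\<^bsub>graded_piece \<mu> \<epsilon>\<^esub>"
    by (intro bexI[of _ "cls \<epsilon> (- f)"]) (auto simp: carrier_graded_piece mult_graded_piece one_graded_piece)
qed (auto simp: carrier_graded_piece mult_graded_piece one_graded_piece add_ac intro!: imageI val_add_ge)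

lemma finprod_graded_piece:
  assumes "\<And>a. a \<in> A \<Longrightarrow> Fin \<epsilon> \<le> \<mu> (h a)" and "finite A"
  shows "finprod (graded_piece \<mu> \<epsilon>) (\<lambda>a. cls \<epsilon> (h a)) A = cls \<epsilon> (sum h A)"
proof -
  interpret comm_group "graded_piece \<mu> \<epsilon>" by (rule comm_group_graded_piece)
  show ?thesis using assms(2,1)
  proof (induction A)
    case (insert a A)
    then show ?case
      by (subst finprod_insert) (auto simp: carrier_graded_piece mult_graded_piece)
  qed (simp add: one_graded_piece)
qed

text \<open>\<open>class_mult\<close> is a union over all representatives. Passing from
  \<open>f\<close>, \<open>g\<close> to other representatives changes the product by
  \<open>(f' - f) * g' + f * (g' - g)\<close>, of value above \<epsilon>, so all classes in the
  union coincide; \<open>f\<close> and \<open>g\<close> themselves show that it is nonempty.\<close>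

lemma class_mult_homog_class:
  assumes "Fin \<alpha> \<le> \<mu> f" "Fin \<beta> \<le> \<mu> g" "\<epsilon> = \<alpha> + \<beta>"
  shows "class_mult \<mu> \<epsilon> (cls \<alpha> f) (cls \<beta> g) = cls \<epsilon> (f * g)"
proof -
  have "cls \<epsilon> (f' * g') = cls \<epsilon> (f * g)" if "f' \<in> cls \<alpha> f" "g' \<in> cls \<beta> g" for f' g'
  proof -
    have f': "Fin \<alpha> < \<mu> (f' - f)" and g': "Fin \<beta> < \<mu> (g' - g)"
      using that by (simp_all add: mem_homog_class)
    then have "Fin \<beta> \<le> \<mu> g'"
      using val_add_ge[of "Fin \<beta>" "g' - g" g] assms by simp
    with f' have "Fin \<epsilon> < \<mu> ((f' - f) * g')"
      using with_infty_add_less_le_mono[of "Fin \<alpha>" _ "Fin \<beta>"] assms(3) by (simp add: val_mult)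
    moreover have "Fin \<epsilon> < \<mu> (f * (g' - g))"
      using with_infty_add_le_less_mono[OF assms(1) g'] assms(3) by (simp add: val_mult)
    ultimately have "Fin \<epsilon> < \<mu> ((f' - f) * g' + f * (g' - g))" by (rule val_add_gt)
    then show ?thesis by (simp add: homog_class_eq_iff algebra_simps)
  qed
  moreover have "f \<in> cls \<alpha> f" "g \<in> cls \<beta> g" by (simp_all add: mem_homog_class)
  ultimately show ?thesis
    unfolding class_mult_def homog_class_def[symmetric] by blast
qed

lemma rees_lookup: "F \<in> rees \<mu> \<Longrightarrow> Fin \<epsilon> \<le> \<mu> (lookup F \<epsilon>)"
  by (cases "\<epsilon> \<in> keys F") (auto simp: rees_def in_keys_iff)

lemma reesI:
  assumes "\<And>\<epsilon>. lookup F \<epsilon> \<noteq> 0 \<Longrightarrow> \<epsilon> \<in> value_group \<mu>" "\<And>\<epsilon>. Fin \<epsilon> \<le> \<mu> (lookup F \<epsilon>)"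
  shows "F \<in> rees \<mu>"
  using assms by (auto simp: rees_def in_keys_iff)

lemma rees_keys: "F \<in> rees \<mu> \<Longrightarrow> lookup F \<epsilon> \<noteq> 0 \<Longrightarrow> \<epsilon> \<in> value_group \<mu>"
  by (auto simp: rees_def in_keys_iff)

lemma rees_single:
  "\<epsilon> \<in> value_group \<mu> \<Longrightarrow> Fin \<epsilon> \<le> \<mu> f \<Longrightarrow> Poly_Mapping.single \<epsilon> f \<in> rees \<mu>"
  by (rule reesI) (auto simp: lookup_single when_def split: if_splits)

lemma rees_0: "0 \<in> rees \<mu>"
  by (rule reesI) auto

lemma rees_1: "1 \<in> rees \<mu>"
  using rees_single[of 0 1] by (simp add: zero_with_infty_def)

lemma rees_add:
  assumes "F \<in> rees \<mu>" "G \<in> rees \<mu>" shows "F + G \<in> rees \<mu>"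
proof (rule reesI)
  fix \<epsilon> show "Fin \<epsilon> \<le> \<mu> (lookup (F + G) \<epsilon>)"
    using assms by (auto simp: lookup_add intro!: val_add_ge rees_lookup)
  assume "lookup (F + G) \<epsilon> \<noteq> 0"
  then have "lookup F \<epsilon> \<noteq> 0 \<or> lookup G \<epsilon> \<noteq> 0" by (auto simp: lookup_add)
  then show "\<epsilon> \<in> value_group \<mu>" using assms rees_keys by blast
qed

lemma rees_minus: "F \<in> rees \<mu> \<Longrightarrow> - F \<in> rees \<mu>"
  by (rule reesI) (auto simp: rees_keys rees_lookup)

lemma rees_term:
  assumes "F \<in> rees \<mu>" "G \<in> rees \<mu>"
  shows "Fin \<epsilon> \<le> \<mu> (lookup F \<alpha> * lookup G (\<epsilon> - \<alpha>))"
  using add_mono[OF rees_lookup[OF assms(1), of \<alpha>] rees_lookup[OF assms(2), of "\<epsilon> - \<alpha>"]]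
  by (simp add: val_mult)

lemma rees_mult:
  assumes "F \<in> rees \<mu>" "G \<in> rees \<mu>" shows "F * G \<in> rees \<mu>"
proof (rule reesI)
  fix \<epsilon> show "Fin \<epsilon> \<le> \<mu> (lookup (F * G) \<epsilon>)"
    unfolding lookup_mult_group by (intro val_sum_ge rees_term assms)
  assume "lookup (F * G) \<epsilon> \<noteq> 0"
  then obtain \<alpha> where "lookup F \<alpha> * lookup G (\<epsilon> - \<alpha>) \<noteq> 0"
    unfolding lookup_mult_group by (meson sum.neutral)
  then have "\<alpha> \<in> value_group \<mu>" "\<epsilon> - \<alpha> \<in> value_group \<mu>"
    using assms rees_keys by auto
  from value_group_add[OF this] show "\<epsilon> \<in> value_group \<mu>" by simp
qed

lemma graded_algebra_simps:
  "carrier (graded_algebra \<mu>) = {x \<in> \<Pi>\<^sub>E \<epsilon>\<in>value_group \<mu>. carrier (graded_piece \<mu> \<epsilon>).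
     finite {\<epsilon> \<in> value_group \<mu>. x \<epsilon> \<noteq> cls \<epsilon> 0}}"
  "\<one>\<^bsub>graded_algebra \<mu>\<^esub> = initial_form \<mu> 1"
  "\<zero>\<^bsub>graded_algebra \<mu>\<^esub> = (\<lambda>\<epsilon>\<in>value_group \<mu>. cls \<epsilon> 0)"
  "x \<oplus>\<^bsub>graded_algebra \<mu>\<^esub> y = (\<lambda>\<epsilon>\<in>value_group \<mu>. x \<epsilon> \<otimes>\<^bsub>graded_piece \<mu> \<epsilon>\<^esub> y \<epsilon>)"
  "x \<otimes>\<^bsub>graded_algebra \<mu>\<^esub> y = (\<lambda>\<epsilon>\<in>value_group \<mu>.
     finprod (graded_piece \<mu> \<epsilon>) (\<lambda>\<alpha>. class_mult \<mu> \<epsilon> (x \<alpha>) (y (\<epsilon> - \<alpha>)))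
       {\<alpha> \<in> value_group \<mu>. x \<alpha> \<noteq> filt_plus \<mu> \<alpha>})"
  using comm_group_graded_piece
  by (simp_all add: graded_algebra_def Let_def carrier_sum_group one_graded_piece comm_group.axioms(2))

lemma carrier_graded_algebra: "carrier (graded_algebra \<mu>) = rees_class \<mu> ` rees \<mu>"
proof (intro equalityI subsetI)
  fix x assume "x \<in> carrier (graded_algebra \<mu>)"
  then have x: "x \<in> extensional (value_group \<mu>)" "finite {\<epsilon> \<in> value_group \<mu>. x \<epsilon> \<noteq> cls \<epsilon> 0}"
    and "\<forall>\<epsilon>\<in>value_group \<mu>. \<exists>f. Fin \<epsilon> \<le> \<mu> f \<and> x \<epsilon> = cls \<epsilon> f"
    by (auto simp: graded_algebra_simps carrier_graded_piece PiE_iff image_iff)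
  then obtain f where f: "\<And>\<epsilon>. \<epsilon> \<in> value_group \<mu> \<Longrightarrow> Fin \<epsilon> \<le> \<mu> (f \<epsilon>) \<and> x \<epsilon> = cls \<epsilon> (f \<epsilon>)"
    by metis
  \<comment> \<open>Representatives are kept in the finitely many degrees of nonzero class;
    elsewhere the component 0 represents the same class.\<close>
  define F where "F = (\<Sum>\<epsilon>\<in>{\<epsilon> \<in> value_group \<mu>. x \<epsilon> \<noteq> cls \<epsilon> 0}. Poly_Mapping.single \<epsilon> (f \<epsilon>))"
  have F: "lookup F \<epsilon> = (if \<epsilon> \<in> value_group \<mu> \<and> x \<epsilon> \<noteq> cls \<epsilon> 0 then f \<epsilon> else 0)" for \<epsilon>
    unfolding F_def lookup_sum_single[OF x(2)] by simp
  have "F \<in> rees \<mu>"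
    by (rule reesI) (auto simp: F f split: if_splits)
  moreover have "x = rees_class \<mu> F"
    using x(1) f by (intro extensionalityI[of _ "value_group \<mu>"]) (auto simp: rees_class_def F)
  ultimately show "x \<in> rees_class \<mu> ` rees \<mu>" by blast
next
  fix x assume "x \<in> rees_class \<mu> ` rees \<mu>"
  then obtain F where F: "F \<in> rees \<mu>" "x = rees_class \<mu> F" by blast
  have "finite {\<epsilon> \<in> value_group \<mu>. x \<epsilon> \<noteq> cls \<epsilon> 0}"
    by (rule finite_subset[of _ "keys F"]) (auto simp: F(2) rees_class_def in_keys_iff)
  then show "x \<in> carrier (graded_algebra \<mu>)"
    using F by (auto simp: graded_algebra_simps rees_class_def carrier_graded_piece rees_lookup)
qed

lemma rees_class_eq_iff:
  "rees_class \<mu> F = rees_class \<mu> G \<longleftrightarrow> (\<forall>\<epsilon>\<in>value_group \<mu>. Fin \<epsilon> < \<mu> (lookup F \<epsilon> - lookup G \<epsilon>))"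
  by (simp add: rees_class_def fun_eq_iff homog_class_eq_iff[symmetric] restrict_def) blast

lemma rees_class_eqD:
  assumes "F \<in> rees \<mu>" "G \<in> rees \<mu>" "rees_class \<mu> F = rees_class \<mu> G"
  shows "Fin \<epsilon> < \<mu> (lookup F \<epsilon> - lookup G \<epsilon>)"
proof (cases "\<epsilon> \<in> value_group \<mu>")
  case False
  then have "lookup F \<epsilon> = 0" "lookup G \<epsilon> = 0" using assms rees_keys by blast+
  then show ?thesis by simp
qed (use assms rees_class_eq_iff in blast)

lemma initial_form_eq:
  "\<mu> f = Fin \<alpha> \<Longrightarrow> initial_form \<mu> f = rees_class \<mu> (Poly_Mapping.single \<alpha> f)"
  by (auto simp: initial_form_def rees_class_def fun_eq_iff lookup_single when_def restrict_def
      homog_class_def[symmetric] homog_class_0)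

lemma one_graded_algebra: "\<one>\<^bsub>graded_algebra \<mu>\<^esub> = rees_class \<mu> 1"
  using initial_form_eq[of 1 0] by (simp add: graded_algebra_simps zero_with_infty_def)

lemma zero_graded_algebra: "\<zero>\<^bsub>graded_algebra \<mu>\<^esub> = rees_class \<mu> 0"
  by (simp add: graded_algebra_simps rees_class_def)

lemma add_graded_algebra:
  "rees_class \<mu> F \<oplus>\<^bsub>graded_algebra \<mu>\<^esub> rees_class \<mu> G = rees_class \<mu> (F + G)"
  by (simp add: graded_algebra_simps rees_class_def fun_eq_iff mult_graded_piece lookup_add)

text \<open>The product in \<open>graded_algebra\<close> runs over the degrees where the class of
  \<open>F\<close> is nonzero, the one in the Rees ring over all keys of \<open>F\<close>. The extra
  terms have a first factor of value above its degree, so they do not change the class of the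
  sum.\<close>

lemma mult_graded_algebra:
  assumes "F \<in> rees \<mu>" "G \<in> rees \<mu>"
  shows "rees_class \<mu> F \<otimes>\<^bsub>graded_algebra \<mu>\<^esub> rees_class \<mu> G = rees_class \<mu> (F * G)"
proof -
  define A where "A = {\<alpha> \<in> value_group \<mu>. \<not> Fin \<alpha> < \<mu> (lookup F \<alpha>)}"
  have A: "A \<subseteq> keys F" by (auto simp: A_def in_keys_iff)
  then have fin: "finite A" by (rule finite_subset) simp
  have A': "{\<alpha> \<in> value_group \<mu>. rees_class \<mu> F \<alpha> \<noteq> filt_plus \<mu> \<alpha>} = A"
    by (auto simp: A_def rees_class_def homog_class_eq_0_iff)
  have "finprod (graded_piece \<mu> \<epsilon>)
      (\<lambda>\<alpha>. class_mult \<mu> \<epsilon> (rees_class \<mu> F \<alpha>) (rees_class \<mu> G (\<epsilon> - \<alpha>))) A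
      = cls \<epsilon> (lookup (F * G) \<epsilon>)" if \<epsilon>: "\<epsilon> \<in> value_group \<mu>" for \<epsilon>
  proof -
    have "class_mult \<mu> \<epsilon> (rees_class \<mu> F \<alpha>) (rees_class \<mu> G (\<epsilon> - \<alpha>))
      = cls \<epsilon> (lookup F \<alpha> * lookup G (\<epsilon> - \<alpha>))" if "\<alpha> \<in> A" for \<alpha>
      using that \<epsilon> value_group_diff assms
      by (simp add: A_def rees_class_def class_mult_homog_class rees_lookup)
    moreover interpret comm_group "graded_piece \<mu> \<epsilon>" by (rule comm_group_graded_piece)
    have "cls \<epsilon> (lookup F \<alpha> * lookup G (\<epsilon> - \<alpha>)) \<in> carrier (graded_piece \<mu> \<epsilon>)" for \<alpha>
      using rees_term[OF assms] by (auto simp: carrier_graded_piece)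
    ultimately have "finprod (graded_piece \<mu> \<epsilon>)
      (\<lambda>\<alpha>. class_mult \<mu> \<epsilon> (rees_class \<mu> F \<alpha>) (rees_class \<mu> G (\<epsilon> - \<alpha>))) A
      = finprod (graded_piece \<mu> \<epsilon>) (\<lambda>\<alpha>. cls \<epsilon> (lookup F \<alpha> * lookup G (\<epsilon> - \<alpha>))) A"
      by (intro finprod_cong') auto
    also have "\<dots> = cls \<epsilon> (\<Sum>\<alpha>\<in>A. lookup F \<alpha> * lookup G (\<epsilon> - \<alpha>))"
      using rees_term[OF assms] fin by (rule finprod_graded_piece)
    also have "\<dots> = cls \<epsilon> (lookup (F * G) \<epsilon>)"
    proof -
      have "lookup (F * G) \<epsilon> - (\<Sum>\<alpha>\<in>A. lookup F \<alpha> * lookup G (\<epsilon> - \<alpha>))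
        = (\<Sum>\<alpha>\<in>keys F - A. lookup F \<alpha> * lookup G (\<epsilon> - \<alpha>))"
        unfolding lookup_mult_group using A by (simp add: sum_diff)
      moreover have "Fin \<epsilon> < \<mu> (lookup F \<alpha> * lookup G (\<epsilon> - \<alpha>))" if "\<alpha> \<in> keys F - A" for \<alpha>
      proof -
        have "Fin \<alpha> < \<mu> (lookup F \<alpha>)"
          using that assms by (auto simp: A_def rees_def)
        from with_infty_add_less_le_mono[OF this rees_lookup[OF assms(2), of "\<epsilon> - \<alpha>"]]
        show ?thesis by (simp add: val_mult)
      qed
      ultimately have "Fin \<epsilon> < \<mu> (lookup (F * G) \<epsilon> - (\<Sum>\<alpha>\<in>A. lookup F \<alpha> * lookup G (\<epsilon> - \<alpha>)))"
        by (auto intro!: val_sum_gt)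
      then show ?thesis by (simp add: homog_class_eq_iff val_diff_commute)
    qed
    finally show ?thesis .
  qed
  then show ?thesis
    unfolding graded_algebra_simps(5) A' rees_class_def[of \<mu> "F * G"]
    by (simp add: fun_eq_iff restrict_def)
qed

lemma cring_graded_algebra: "cring (graded_algebra \<mu>)"
proof (rule cringI)
  note [simp] = carrier_graded_algebra zero_graded_algebra one_graded_algebra add_graded_algebra
    mult_graded_algebra rees_0 rees_1 rees_add rees_mult rees_minus
  show "abelian_group (graded_algebra \<mu>)"
  proof (rule abelian_groupI)
    fix x assume "x \<in> carrier (graded_algebra \<mu>)"
    then obtain F where "F \<in> rees \<mu>" "x = rees_class \<mu> F" by auto
    then show "\<exists>y\<in>carrier (graded_algebra \<mu>). y \<oplus>\<^bsub>graded_algebra \<mu>\<^esub> x = \<zero>\<^bsub>graded_algebra \<mu>\<^esub>"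
      by (intro bexI[of _ "rees_class \<mu> (- F)"]) auto
  qed (auto simp: add_ac intro!: imageI)
  show "comm_monoid (graded_algebra \<mu>)"
    by (rule comm_monoidI) (auto simp: mult_ac intro!: imageI)
  fix x y z assume "x \<in> carrier (graded_algebra \<mu>)" "y \<in> carrier (graded_algebra \<mu>)"
    "z \<in> carrier (graded_algebra \<mu>)"
  then show "(x \<oplus>\<^bsub>graded_algebra \<mu>\<^esub> y) \<otimes>\<^bsub>graded_algebra \<mu>\<^esub> z =
      x \<otimes>\<^bsub>graded_algebra \<mu>\<^esub> z \<oplus>\<^bsub>graded_algebra \<mu>\<^esub> y \<otimes>\<^bsub>graded_algebra \<mu>\<^esub> z"
    by (auto simp: algebra_simps)
qed

end

section \<open>Key polynomials\<close>

context poly_valued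
begin

lemma initial_form_carrier: "\<mu> f \<noteq> Infty \<Longrightarrow> initial_form \<mu> f \<in> carrier (graded_algebra \<mu>)"
  by (cases "\<mu> f") (auto simp: initial_form_eq carrier_graded_algebra value_group_value intro!: imageI rees_single)

lemma initial_form_mult:
  assumes "\<mu> f \<noteq> Infty" "\<mu> g \<noteq> Infty"
  shows "initial_form \<mu> f \<otimes>\<^bsub>graded_algebra \<mu>\<^esub> initial_form \<mu> g = initial_form \<mu> (f * g)"
proof -
  obtain \<alpha> \<beta> where *: "\<mu> f = Fin \<alpha>" "\<mu> g = Fin \<beta>"
    using assms by (cases "\<mu> f"; cases "\<mu> g") auto
  then have "initial_form \<mu> (f * g) = rees_class \<mu> (Poly_Mapping.single (\<alpha> + \<beta>) (f * g))"
    by (intro initial_form_eq) (simp add: val_mult)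
  moreover have "Poly_Mapping.single \<alpha> f \<in> rees \<mu>" "Poly_Mapping.single \<beta> g \<in> rees \<mu>"
    using * by (auto intro!: rees_single value_group_value)
  ultimately show ?thesis
    by (simp add: initial_form_eq * mult_graded_algebra mult_single)
qed

lemma initial_form_cong:
  assumes "\<mu> f \<noteq> Infty" "\<mu> f < \<mu> (f - g)"
  shows "initial_form \<mu> f = initial_form \<mu> g"
proof -
  obtain \<alpha> where *: "\<mu> f = Fin \<alpha>" using assms(1) by (cases "\<mu> f") auto
  moreover have "\<mu> g = Fin \<alpha>" using val_cong[OF assms(2)] * by simp
  ultimately show ?thesis
    using assms(2) by (auto simp: initial_form_eq rees_class_eq_iff lookup_single when_def)
qed

context
  fixes \<phi> I
  assumes key: "\<phi> \<in> key_polynomials \<mu>"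
  defines "I \<equiv> PIdl\<^bsub>graded_algebra \<mu>\<^esub> (initial_form \<mu> \<phi>)"
begin

lemma key_polynomial_monic: "lead_coeff \<phi> = 1"
  and key_polynomial_value: "\<mu> \<phi> \<noteq> Infty"
  and key_polynomial_prime: "primeideal I (graded_algebra \<mu>)"
  and key_polynomial_initial_form:
    "\<mu> f \<noteq> Infty \<Longrightarrow> degree f < degree \<phi> \<Longrightarrow> initial_form \<mu> f \<notin> I"
  using key by (simp_all add: key_polynomials_def Let_def I_def)

lemma mult_initial_form_key: "\<mu> g \<noteq> Infty \<Longrightarrow> initial_form \<mu> (g * \<phi>) \<in> I"
  using initial_form_mult[of g \<phi>] key_polynomial_value initial_form_carrier[of g]
  unfolding I_def cgenideal_def by (metis (mono_tags, lifting) mem_Collect_eq)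

text \<open>If the inequality failed, \<open>f\<close> and \<open>g * \<phi>\<close> would have the
  same initial form; it would lie in the principal ideal of \<phi> although \<open>f\<close> has
  smaller degree.\<close>

lemma key_polynomial_minimal:
  assumes "\<mu> f \<noteq> Infty" "degree f < degree \<phi>"
  shows "\<mu> (g * \<phi> - f) \<le> \<mu> f"
proof (rule ccontr)
  assume "\<not> ?thesis"
  then have *: "\<mu> f < \<mu> (f - g * \<phi>)" by (simp add: val_diff_commute)
  then have "\<mu> (g * \<phi>) \<noteq> Infty" using val_cong assms(1) by metis
  then have "\<mu> g \<noteq> Infty" by (auto simp: val_mult)
  then show False
    using mult_initial_form_key key_polynomial_initial_form[OF assms] initial_form_cong[OF assms(1) *]
    by metis
qed

text \<open>In a factorization, primality puts the initial form of one factor into the ideal, which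
  contains no initial form from a degree below that of \<phi>.\<close>

lemma key_polynomial_irreducible:
  assumes "\<phi> = g * h" "degree g < degree \<phi>" "degree h < degree \<phi>"
  shows False
proof -
  interpret primeideal I "graded_algebra \<mu>" by (rule key_polynomial_prime)
  have *: "\<mu> g \<noteq> Infty" "\<mu> h \<noteq> Infty"
    using key_polynomial_value by (auto simp: assms(1) val_mult)
  then have "initial_form \<mu> g \<otimes>\<^bsub>graded_algebra \<mu>\<^esub> initial_form \<mu> h \<in> I"
    using initial_form_mult[of g h] mult_initial_form_key[of 1] assms(1) by simp
  then show False
    using I_prime initial_form_carrier key_polynomial_initial_form * assms(2,3) by blast
qed

text \<open>Such an \<open>h\<close> would put the unit element into a proper ideal. Further on,
  this is how polynomials of small degree are excluded as key polynomials: a Bezout identity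
  exhibits them as units up to terms of positive value.\<close>

lemma key_polynomial_not_unit: "\<not> 0 < \<mu> (h * \<phi> - 1)"
proof
  assume "0 < \<mu> (h * \<phi> - 1)"
  then have *: "\<mu> 1 < \<mu> (1 - h * \<phi>)" by (simp add: val_diff_commute[of 1])
  from initial_form_cong[OF _ this] have 1: "initial_form \<mu> 1 = initial_form \<mu> (h * \<phi>)" by simp
  have "\<mu> (h * \<phi>) = 0" using val_cong[OF *] by simp
  then have "\<mu> h \<noteq> Infty" by (auto simp: val_mult)
  then have "\<one>\<^bsub>graded_algebra \<mu>\<^esub> \<in> I"
    using mult_initial_form_key 1 by (simp add: graded_algebra_simps)
  then show False
    using ideal.one_imp_carrier key_polynomial_prime primeideal.I_notcarr primeideal.axioms(1) by metis
qed

lemma key_polynomial_degree: "degree \<phi> > 0"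
proof (rule ccontr)
  assume "\<not> ?thesis"
  then have "\<phi> = 1" using key_polynomial_monic by (metis degree_0_id gr0I one_pCons)
  then show False using key_polynomial_not_unit[of 1] by simp
qed

end

end

text \<open>The situation is met twice. With \<mu> a ball valuation around \<theta> and \<nu> =
  \<open>v\<^sub>\<theta>\<close> it produces key polynomials; with \<nu> the value at a closest
  root of \<chi> it shows that the \<chi>-expansion computes the ball valuation.\<close>

locale minimal_divisor = poly_valued \<mu> + upper: poly_valued \<nu>
  for \<mu> \<nu> :: "'k::field poly \<Rightarrow> 'g::linordered_ab_group_add with_infty" +
  fixes \<chi> :: "'k poly"
  assumes le: "\<mu> f \<le> \<nu> f"
    and monic: "lead_coeff \<chi> = 1"
    and less: "\<mu> \<chi> < \<nu> \<chi>"
    and eq: "degree f < degree \<chi> \<Longrightarrow> \<mu> f = \<nu> f"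
begin

lemma degree_pos: "degree \<chi> > 0"
proof (rule ccontr)
  assume "\<not> ?thesis"
  then have "\<chi> = 1" using monic by (metis degree_0_id gr0I one_pCons)
  then show False using less by simp
qed

lemma degree_mod: "degree (f mod \<chi>) < degree \<chi>"
  using degree_pos degree_mod_less[of \<chi> f] by force

lemma mult_less: "\<mu> q \<noteq> Infty \<Longrightarrow> \<mu> (q * \<chi>) < \<nu> (q * \<chi>)"
  using le less by (simp add: val_mult upper.val_mult with_infty_add_le_less_mono)

text \<open>Only a tie \<open>\<mu> c = \<mu> (q * \<chi>)\<close> is critical. A cancellation there
  would make both \<open>\<nu> (c + q * \<chi>)\<close> and \<open>\<nu> (q * \<chi>)\<close> exceed
  \<open>\<mu> c\<close>, hence \<open>\<nu> c\<close> as well, against \<open>eq\<close>.\<close>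

lemma add_mult_eq:
  assumes "degree c < degree \<chi>"
  shows "\<mu> (c + q * \<chi>) = min (\<mu> c) (\<mu> (q * \<chi>))"
proof (cases "\<mu> c = \<mu> (q * \<chi>)")
  case True
  have "\<mu> (c + q * \<chi>) \<le> \<mu> c"
  proof (rule ccontr)
    assume *: "\<not> ?thesis"
    then have "\<mu> c \<noteq> Infty" by auto
    then have "\<mu> q \<noteq> Infty" using True by (auto simp: val_mult)
    then have "\<mu> c < \<nu> (q * \<chi>)" using mult_less True by simp
    moreover have "\<mu> c < \<nu> (c + q * \<chi>)" using * le[of "c + q * \<chi>"] by simp
    ultimately have "\<mu> c < \<nu> (c + q * \<chi> - q * \<chi>)" by (rule upper.val_diff_gt[rotated])
    then show False using eq[OF assms] by simp
  qed
  then show ?thesis using True val_add[of c "q * \<chi>"] by simp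
qed (rule val_add_neq)

text \<open>The initial form of such an \<open>f\<close> is thus a multiple of that of \<chi>. If
  the remainder attained the minimum in \<open>add_mult_eq\<close>, its \<nu>-value would exceed its
  \<mu>-value, since both \<open>\<nu> f\<close> and \<open>\<nu> (f div \<chi> * \<chi>)\<close>
  exceed \<open>\<mu> f\<close>; this contradicts \<open>eq\<close>.\<close>

lemma remainder_gt:
  assumes "\<mu> f < \<nu> f"
  shows "\<mu> f < \<mu> (f mod \<chi>)"
proof -
  have f: "f mod \<chi> + f div \<chi> * \<chi> = f" by (simp add: add.commute)
  have "\<mu> f = min (\<mu> (f mod \<chi>)) (\<mu> (f div \<chi> * \<chi>))"
    using add_mult_eq[OF degree_mod, of f "f div \<chi>"] unfolding f .
  moreover have False if *: "\<mu> f = \<mu> (f mod \<chi>)" "\<mu> (f mod \<chi>) \<le> \<mu> (f div \<chi> * \<chi>)"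
  proof -
    have "\<mu> f < \<nu> (f div \<chi> * \<chi>)"
    proof (cases "\<mu> (f div \<chi>) = Infty")
      case True
      then have "\<nu> (f div \<chi>) = Infty" using le[of "f div \<chi>"] by simp
      then show ?thesis using assms by (auto simp: upper.val_mult)
    qed (use * mult_less in fastforce)
    from upper.val_diff_gt[OF assms this] have "\<mu> f < \<nu> (f mod \<chi>)"
      by (simp add: minus_div_mult_eq_mod)
    then show False using *(1) eq[OF degree_mod, of f] by simp
  qed
  ultimately show ?thesis
    using min.strict_order_iff by (metis min_def order_le_less linorder_not_le)
qed

text \<open>The kernel of the map to the graded algebra of \<nu>, expressed on Rees elements of
  \<mu> so that no second graded algebra has to be formed.\<close>

definition dominated :: "('g \<Rightarrow>\<^sub>0 'k poly) \<Rightarrow> bool" where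
  "dominated F \<longleftrightarrow> (\<forall>\<epsilon>. Fin \<epsilon> < \<nu> (lookup F \<epsilon>))"

lemma dominated_cong:
  assumes "F \<in> rees \<mu>" "G \<in> rees \<mu>" "rees_class \<mu> F = rees_class \<mu> G" "dominated F"
  shows "dominated G"
  unfolding dominated_def
proof
  fix \<epsilon>
  have "Fin \<epsilon> < \<nu> (lookup F \<epsilon>)" using assms(4) by (simp add: dominated_def)
  moreover have "Fin \<epsilon> < \<nu> (lookup F \<epsilon> - lookup G \<epsilon>)"
    using rees_class_eqD[OF assms(1-3)] le less_le_trans by blast
  ultimately have "Fin \<epsilon> < \<nu> (lookup F \<epsilon> - (lookup F \<epsilon> - lookup G \<epsilon>))"
    by (rule upper.val_diff_gt)
  then show "Fin \<epsilon> < \<nu> (lookup G \<epsilon>)" by simp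
qed

lemma rees_lookup_upper: "F \<in> rees \<mu> \<Longrightarrow> Fin \<epsilon> \<le> \<nu> (lookup F \<epsilon>)"
  using rees_lookup le order_trans by blast

lemma dominated_mult:
  assumes "F \<in> rees \<mu>" "G \<in> rees \<mu>" "dominated G"
  shows "dominated (F * G)"
  unfolding dominated_def lookup_mult_group
proof (intro allI upper.val_sum_gt)
  fix \<epsilon> \<alpha>
  have "Fin \<alpha> + Fin (\<epsilon> - \<alpha>) < \<nu> (lookup F \<alpha>) + \<nu> (lookup G (\<epsilon> - \<alpha>))"
    using assms by (intro with_infty_add_le_less_mono rees_lookup_upper) (auto simp: dominated_def)
  then show "Fin \<epsilon> < \<nu> (lookup F \<alpha> * lookup G (\<epsilon> - \<alpha>))" by (simp add: upper.val_mult)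
qed simp

lemma least_not_dominated:
  assumes "\<not> dominated F" "F \<in> rees \<mu>"
  obtains \<alpha> where "\<nu> (lookup F \<alpha>) = Fin \<alpha>" "\<And>\<kappa>. \<kappa> < \<alpha> \<Longrightarrow> Fin \<kappa> < \<nu> (lookup F \<kappa>)"
proof -
  let ?S = "{\<alpha>. \<not> Fin \<alpha> < \<nu> (lookup F \<alpha>)}"
  have sub: "?S \<subseteq> keys F" by (auto simp: in_keys_iff)
  then have fin: "finite ?S" by (rule finite_subset) simp
  have "?S \<noteq> {}" using assms(1) by (auto simp: dominated_def)
  then have "Min ?S \<in> ?S" by (rule Min_in[OF fin])
  then have "\<nu> (lookup F (Min ?S)) = Fin (Min ?S)"
    using rees_lookup_upper[OF assms(2), of "Min ?S"] by auto
  moreover have "Fin \<kappa> < \<nu> (lookup F \<kappa>)" if "\<kappa> < Min ?S" for \<kappa>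
    using that Min_le[OF fin, of \<kappa>] by (meson linorder_not_le mem_Collect_eq)
  ultimately show thesis by (rule that)
qed

text \<open>Lowest components cannot cancel: with \<alpha> and \<beta> the least degrees where
  domination fails for \<open>F\<close> and \<open>G\<close>, exactly one term of the convolution in
  degree \<open>\<alpha> + \<beta>\<close> has \<nu>-value \<open>\<alpha> + \<beta>\<close>; all
  others exceed it.\<close>

lemma dominated_prime:
  assumes F: "F \<in> rees \<mu>" and G: "G \<in> rees \<mu>" and FG: "dominated (F * G)"
  shows "dominated F \<or> dominated G"
proof (rule ccontr)
  assume "\<not> ?thesis"
  then obtain \<alpha> \<beta> where
    \<alpha>: "\<nu> (lookup F \<alpha>) = Fin \<alpha>" "\<And>\<kappa>. \<kappa> < \<alpha> \<Longrightarrow> Fin \<kappa> < \<nu> (lookup F \<kappa>)" and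
    \<beta>: "\<nu> (lookup G \<beta>) = Fin \<beta>" "\<And>\<kappa>. \<kappa> < \<beta> \<Longrightarrow> Fin \<kappa> < \<nu> (lookup G \<kappa>)"
    using least_not_dominated F G by metis
  define t where "t \<kappa> = lookup F \<kappa> * lookup G (\<alpha> + \<beta> - \<kappa>)" for \<kappa>
  have "Fin (\<alpha> + \<beta>) < \<nu> (t \<kappa>)" if "\<kappa> \<noteq> \<alpha>" for \<kappa>
  proof -
    have "Fin \<kappa> + Fin (\<alpha> + \<beta> - \<kappa>) < \<nu> (lookup F \<kappa>) + \<nu> (lookup G (\<alpha> + \<beta> - \<kappa>))"
    proof (cases "\<kappa> < \<alpha>")
      case True
      then show ?thesis using \<alpha>(2) rees_lookup_upper[OF G] by (intro with_infty_add_less_le_mono) auto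
    next
      case False
      then have "\<alpha> + \<beta> - \<kappa> < \<beta>" using that by (simp add: algebra_simps)
      then show ?thesis using \<beta>(2) rees_lookup_upper[OF F] by (intro with_infty_add_le_less_mono) auto
    qed
    then show ?thesis by (simp add: t_def upper.val_mult)
  qed
  then have "Fin (\<alpha> + \<beta>) < \<nu> (sum t (keys F - {\<alpha>}))" by (intro upper.val_sum_gt) auto
  moreover have "\<alpha> \<in> keys F" using \<alpha>(1) by (auto simp: in_keys_iff)
  then have "lookup (F * G) (\<alpha> + \<beta>) = t \<alpha> + sum t (keys F - {\<alpha>})"
    unfolding lookup_mult_group t_def by (simp add: sum.remove)
  moreover have "\<nu> (t \<alpha>) = Fin (\<alpha> + \<beta>)" by (simp add: t_def upper.val_mult \<alpha> \<beta>)
  ultimately have "\<nu> (lookup (F * G) (\<alpha> + \<beta>)) = Fin (\<alpha> + \<beta>)"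
    using upper.val_add_eq[of "t \<alpha>" "sum t (keys F - {\<alpha>})"] by simp
  then show False using FG by (metis dominated_def less_irrefl)
qed

lemma dominated_single: "dominated (Poly_Mapping.single \<epsilon> f) \<longleftrightarrow> Fin \<epsilon> < \<nu> f"
  by (auto simp: dominated_def lookup_single when_def)

lemma principal_ideal_eq:
  "PIdl\<^bsub>graded_algebra \<mu>\<^esub> (initial_form \<mu> \<chi>) = rees_class \<mu> ` {F \<in> rees \<mu>. dominated F}"
proof -
  obtain \<beta> where \<beta>: "\<mu> \<chi> = Fin \<beta>" using less by (cases "\<mu> \<chi>") auto
  define X where "X = Poly_Mapping.single \<beta> \<chi>"
  have X: "X \<in> rees \<mu>" "initial_form \<mu> \<chi> = rees_class \<mu> X"
    using \<beta> by (auto simp: X_def initial_form_eq value_group_value intro!: rees_single)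
  have "rees_class \<mu> F \<otimes>\<^bsub>graded_algebra \<mu>\<^esub> rees_class \<mu> X \<in> rees_class \<mu> ` {F \<in> rees \<mu>. dominated F}"
    if "F \<in> rees \<mu>" for F
    using that X(1) less \<beta> dominated_mult[OF that X(1)]
    by (auto simp: mult_graded_algebra rees_mult X_def dominated_single intro!: imageI)
  moreover have "\<exists>Q\<in>rees \<mu>. rees_class \<mu> F = rees_class \<mu> Q \<otimes>\<^bsub>graded_algebra \<mu>\<^esub> rees_class \<mu> X"
    if F: "F \<in> rees \<mu>" "dominated F" for F
  proof -
    \<comment> \<open>In degrees outside \<open>A\<close> the class of \<open>F\<close> vanishes
      already; in degrees of \<open>A\<close> domination makes \<open>remainder_gt\<close>
      applicable.\<close>
    define A where "A = {\<epsilon>. \<mu> (lookup F \<epsilon>) = Fin \<epsilon>}"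
    have A: "A \<subseteq> keys F" by (auto simp: A_def in_keys_iff)
    then have fin: "finite ((\<lambda>\<epsilon>. \<epsilon> - \<beta>) ` A)" by (intro finite_imageI) (rule finite_subset, auto)
    \<comment> \<open>Division by \<chi> lowers the degree by \<beta>, the degree of the initial
      form of \<chi>. The remainders are dropped because their values are larger.\<close>
    define Q where "Q = (\<Sum>\<epsilon>\<in>(\<lambda>\<epsilon>. \<epsilon> - \<beta>) ` A. Poly_Mapping.single \<epsilon> (lookup F (\<epsilon> + \<beta>) div \<chi>))"
    have Q: "lookup Q \<epsilon> = (if \<epsilon> + \<beta> \<in> A then lookup F (\<epsilon> + \<beta>) div \<chi> else 0)" for \<epsilon>
    proof -
      have "\<epsilon> \<in> (\<lambda>\<epsilon>. \<epsilon> - \<beta>) ` A \<longleftrightarrow> \<epsilon> + \<beta> \<in> A"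
        by (auto simp: image_iff intro: bexI[of _ "\<epsilon> + \<beta>"])
      then show ?thesis unfolding Q_def lookup_sum_single[OF fin] by simp
    qed
    have gt: "Fin \<epsilon> < \<mu> (lookup F \<epsilon> - lookup F \<epsilon> div \<chi> * \<chi>)" if "\<epsilon> \<in> A" for \<epsilon>
    proof -
      have "\<mu> (lookup F \<epsilon>) < \<nu> (lookup F \<epsilon>)"
        using that F(2) by (auto simp: A_def dominated_def)
      from remainder_gt[OF this] show ?thesis
        using that by (simp add: A_def minus_div_mult_eq_mod)
    qed
    have Q_rees: "Q \<in> rees \<mu>"
    proof (rule reesI)
      fix \<epsilon>
      have val: "\<mu> (lookup F (\<epsilon> + \<beta>) div \<chi>) = Fin \<epsilon>" if "\<epsilon> + \<beta> \<in> A"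
      proof -
        have "\<mu> (lookup F (\<epsilon> + \<beta>)) < \<mu> (lookup F (\<epsilon> + \<beta>) - lookup F (\<epsilon> + \<beta>) div \<chi> * \<chi>)"
          using gt[OF that] that by (simp add: A_def)
        from val_cong[OF this] have "\<mu> (lookup F (\<epsilon> + \<beta>) div \<chi>) + Fin \<beta> = Fin (\<epsilon> + \<beta>)"
          using that by (simp add: A_def val_mult \<beta>)
        then show ?thesis by (cases "\<mu> (lookup F (\<epsilon> + \<beta>) div \<chi>)") auto
      qed
      then show "Fin \<epsilon> \<le> \<mu> (lookup Q \<epsilon>)" by (simp add: Q)
      assume "lookup Q \<epsilon> \<noteq> 0"
      then show "\<epsilon> \<in> value_group \<mu>" using val value_group_value by (auto simp: Q split: if_splits)
    qed
    have "lookup (Q * X) \<epsilon> = lookup Q (\<epsilon> - \<beta>) * \<chi>" for \<epsilon>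
    proof -
      have "keys X = {\<beta>}" using monic by (auto simp: X_def)
      then show ?thesis
        by (subst mult.commute, subst lookup_mult_group) (simp add: X_def mult.commute)
    qed
    moreover have "Fin \<epsilon> < \<mu> (lookup F \<epsilon>)" if "\<epsilon> \<notin> A" for \<epsilon>
      using that rees_lookup[OF F(1), of \<epsilon>] by (auto simp: A_def order_less_le)
    ultimately have "rees_class \<mu> F = rees_class \<mu> (Q * X)"
      using gt by (simp add: rees_class_eq_iff Q)
    then show ?thesis by (intro bexI[of _ Q]) (simp_all only: mult_graded_algebra X(1) Q_rees)
  qed
  ultimately show ?thesis
    unfolding cgenideal_def X(2) carrier_graded_algebra by blast
qed

lemma rees_class_mem_principal_ideal:
  assumes "F \<in> rees \<mu>"
  shows "rees_class \<mu> F \<in> PIdl\<^bsub>graded_algebra \<mu>\<^esub> (initial_form \<mu> \<chi>) \<longleftrightarrow> dominated F"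
  unfolding principal_ideal_eq using assms dominated_cong[OF _ assms] by auto

lemma key_polynomial: "\<chi> \<in> key_polynomials \<mu>"
proof -
  define J where "J = PIdl\<^bsub>graded_algebra \<mu>\<^esub> (initial_form \<mu> \<chi>)"
  note J = rees_class_mem_principal_ideal[folded J_def]
  have fin: "\<mu> \<chi> \<noteq> Infty" using less by auto
  \<comment> \<open>For \<open>f = 1\<close> this makes the ideal proper, and together with
    \<open>eq\<close> it gives the degree condition on key polynomials.\<close>
  have initial: "initial_form \<mu> f \<in> J \<longleftrightarrow> \<mu> f < \<nu> f" if f: "\<mu> f \<noteq> Infty" for f
  proof -
    obtain \<alpha> where "\<mu> f = Fin \<alpha>" using f by (cases "\<mu> f") auto
    then show ?thesis
      by (simp add: initial_form_eq J rees_single value_group_value dominated_single)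
  qed
  have "homogeneous \<mu> J"
    unfolding homogeneous_def
  proof (intro ballI)
    fix x \<epsilon> assume x: "x \<in> J" and \<epsilon>: "\<epsilon> \<in> value_group \<mu>"
    then obtain F where F: "F \<in> rees \<mu>" "dominated F" "x = rees_class \<mu> F"
      unfolding J_def principal_ideal_eq by blast
    have "rees_class \<mu> (Poly_Mapping.single \<epsilon> (lookup F \<epsilon>)) \<in> J"
      using F(2) \<epsilon> rees_lookup[OF F(1)]
      by (subst J) (simp_all add: rees_single dominated_single dominated_def[of F])
    also have "rees_class \<mu> (Poly_Mapping.single \<epsilon> (lookup F \<epsilon>)) =
        (\<lambda>\<alpha>\<in>value_group \<mu>. if \<alpha> = \<epsilon> then x \<alpha> else filt_plus \<mu> \<alpha>)"
      by (auto simp: rees_class_def F(3) fun_eq_iff lookup_single when_def homog_class_0)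
    finally show "(\<lambda>\<alpha>\<in>value_group \<mu>. if \<alpha> = \<epsilon> then x \<alpha> else filt_plus \<mu> \<alpha>) \<in> J" .
  qed
  moreover have "primeideal J (graded_algebra \<mu>)"
  proof (rule primeidealI)
    show "ideal J (graded_algebra \<mu>)"
      unfolding J_def
      by (intro cring.cgenideal_ideal cring_graded_algebra initial_form_carrier fin)
    show "cring (graded_algebra \<mu>)" by (rule cring_graded_algebra)
    have "initial_form \<mu> 1 \<notin> J" using initial[of 1] by simp
    then show "carrier (graded_algebra \<mu>) \<noteq> J" using initial_form_carrier[of 1] by auto
    fix x y assume "x \<in> carrier (graded_algebra \<mu>)" "y \<in> carrier (graded_algebra \<mu>)"
      and xy: "x \<otimes>\<^bsub>graded_algebra \<mu>\<^esub> y \<in> J"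
    then obtain F G where "F \<in> rees \<mu>" "G \<in> rees \<mu>" "x = rees_class \<mu> F" "y = rees_class \<mu> G"
      unfolding carrier_graded_algebra by blast
    then show "x \<in> J \<or> y \<in> J"
      using xy dominated_prime by (simp add: J mult_graded_algebra rees_mult)
  qed
  ultimately show ?thesis
    using monic fin initial eq by (auto simp: key_polynomials_def Let_def J_def)
qed

end

section \<open>Expansions and augmentations\<close>

lemma expansion_val_small:
  fixes \<phi> :: "'k::field poly" and w :: "'k poly \<Rightarrow> 'g::linordered_ab_group_add with_infty"
  assumes "degree f < degree \<phi>" "w 0 = Infty"
  shows "expansion_val w \<phi> \<gamma> f = w f"
  using expansion_val_eq[of \<phi> w 0 "\<lambda>_. f" \<gamma>] assms by simp

lemma degree_mod_less_pos:
  fixes \<phi> :: "'k::field poly"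
  assumes "degree \<phi> > 0" shows "degree (f mod \<phi>) < degree \<phi>"
  using assms degree_mod_less[of \<phi> f] by force

lemma expansion_val_cong:
  fixes \<phi> :: "'k::field poly"
  assumes "degree \<phi> > 0" "\<And>f. degree f < degree \<phi> \<Longrightarrow> w f = w' f"
  shows "expansion_val w \<phi> \<gamma> = expansion_val w' \<phi> \<gamma>"
  using assms degree_mod_less_pos[OF assms(1)] by (simp add: expansion_val_def fun_eq_iff)

lemma degree_div_less_pos:
  fixes \<phi> :: "'k::field poly"
  assumes "degree \<phi> > 0" "\<not> degree f < degree \<phi>" shows "degree (f div \<phi>) < degree f"
  using assms by (intro degree_div_less) auto

lemma expansion_exists:
  fixes \<phi> :: "'k::field poly"
  assumes "degree \<phi> > 0"
  shows "\<exists>N a. f = (\<Sum>n\<le>N. a n * \<phi> ^ n) \<and> (\<forall>n\<le>N. degree (a n) < degree \<phi>)"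
proof (induction "degree f" arbitrary: f rule: less_induct)
  case less
  show ?case
  proof (cases "degree f < degree \<phi>")
    case True
    then show ?thesis by (intro exI[of _ 0] exI[of _ "\<lambda>_. f"]) auto
  next
    case False
    then obtain N a where a: "f div \<phi> = (\<Sum>n\<le>N. a n * \<phi> ^ n)" "\<forall>n\<le>N. degree (a n) < degree \<phi>"
      using less degree_div_less_pos[OF assms] by blast
    have "f = f mod \<phi> + \<phi> * (f div \<phi>)" by simp
    also have "\<dots> = f mod \<phi> + (\<Sum>n\<le>N. a n * \<phi> ^ Suc n)"
      unfolding a(1) sum_distrib_left by (simp add: mult_ac)
    also have "\<dots> = (\<Sum>n\<le>Suc N. case_nat (f mod \<phi>) a n * \<phi> ^ n)"
      by (subst sum.atMost_Suc_shift) simp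
    finally show ?thesis
      using a(2) degree_mod_less_pos[OF assms]
      by (intro exI[of _ "Suc N"] exI[of _ "case_nat (f mod \<phi>) a"]) (auto split: nat.split)
  qed
qed

text \<open>Multiplication by \<phi> shifts the digits by one place and adds one \<gamma> to each
  term. Statements on expansions thereby become inductions on the degree along \<open>mod\<close>
  and \<open>div\<close>.\<close>

lemma expansion_val_rec:
  fixes \<phi> :: "'k::field poly" and w :: "'k poly \<Rightarrow> 'g::linordered_ab_group_add with_infty"
  assumes \<phi>: "degree \<phi> > 0" and w: "w 0 = Infty" and c: "degree c < degree \<phi>"
  shows "expansion_val w \<phi> \<gamma> (c + q * \<phi>) = min (w c) (\<gamma> + expansion_val w \<phi> \<gamma> q)"
proof -
  obtain N a where a: "q = (\<Sum>n\<le>N. a n * \<phi> ^ n)" "\<forall>n\<le>N. degree (a n) < degree \<phi>"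
    using expansion_exists[OF \<phi>] by blast
  define b where "b = case_nat c a"
  define h where "h n = w (b n) + nmul n \<gamma>" for n
  have "c + q * \<phi> = c + (\<Sum>n\<le>N. a n * \<phi> ^ Suc n)"
    unfolding a(1) sum_distrib_right by (simp add: mult_ac)
  also have "\<dots> = (\<Sum>n\<le>Suc N. b n * \<phi> ^ n)"
    by (subst sum.atMost_Suc_shift) (simp add: b_def)
  finally have "expansion_val w \<phi> \<gamma> (c + q * \<phi>) = Min (h ` {..Suc N})"
    using expansion_val_eq[where w = w and a = b and N = "Suc N", OF \<phi> w] a(2) c by (simp add: h_def b_def split: nat.split)
  also have "h ` {..Suc N} = insert (w c) ((\<lambda>x. \<gamma> + x) ` (\<lambda>n. w (a n) + nmul n \<gamma>) ` {..N})"
    unfolding atMost_Suc_eq_insert_0 by (simp add: image_image h_def b_def nmul_Suc add_ac)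
  also have "Min \<dots> = min (w c) (Min ((\<lambda>x. \<gamma> + x) ` (\<lambda>n. w (a n) + nmul n \<gamma>) ` {..N}))"
    by (rule Min_insert) auto
  also have "Min ((\<lambda>x. \<gamma> + x) ` (\<lambda>n. w (a n) + nmul n \<gamma>) ` {..N})
      = \<gamma> + Min ((\<lambda>n. w (a n) + nmul n \<gamma>) ` {..N})"
    by (rule mono_Min_commute[symmetric]) (auto intro!: monoI add_left_mono)
  also have "Min ((\<lambda>n. w (a n) + nmul n \<gamma>) ` {..N}) = expansion_val w \<phi> \<gamma> q"
    using expansion_val_eq[where w = w and a = a, OF \<phi> w a(2)] by (simp add: a(1))
  finally show ?thesis .
qed

lemma expansion_val_linear:
  fixes \<phi> :: "'k::field poly" and w :: "'k poly \<Rightarrow> 'g::linordered_ab_group_add with_infty"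
  assumes "w 0 = Infty" "degree c < degree \<phi>" "degree q < degree \<phi>"
  shows "expansion_val w \<phi> \<gamma> (c + q * \<phi>) = min (w c) (\<gamma> + w q)"
  using assms by (subst expansion_val_rec) (auto simp: expansion_val_small)

text \<open>The leading terms cancel, so \<open>(f - \<phi>) + 1 * \<phi>\<close> is the expansion
  of \<open>f\<close>. Polynomials of equal degree within a limit family are compared in this
  form.\<close>

lemma expansion_val_monic:
  fixes \<phi> :: "'k::field poly" and w :: "'k poly \<Rightarrow> 'g::linordered_ab_group_add with_infty"
  assumes "w 0 = Infty" "w 1 = 0" "degree f = degree \<phi>" "degree \<phi> > 0" "lead_coeff f = lead_coeff \<phi>"
  shows "degree (f - \<phi>) < degree \<phi>" "expansion_val w \<phi> \<gamma> f = min (w (f - \<phi>)) \<gamma>"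
proof -
  show d: "degree (f - \<phi>) < degree \<phi>"
    using assms(3-5) by (metis coeff_diff degree_0 degree_diff_le dual_order.order_iff_strict
        eq_iff_diff_eq_0 leading_coeff_0_iff)
  then show "expansion_val w \<phi> \<gamma> f = min (w (f - \<phi>)) \<gamma>"
    using expansion_val_linear[where w = w and q = 1, OF assms(1) d] assms by simp
qed

lemma expansion_val_key:
  fixes \<phi> :: "'k::field poly" and w :: "'k poly \<Rightarrow> 'g::linordered_ab_group_add with_infty"
  assumes "degree \<phi> > 0" "w 0 = Infty" "w 1 = 0"
  shows "expansion_val w \<phi> \<gamma> \<phi> = \<gamma>"
  using expansion_val_monic(2)[of w \<phi> \<phi>] assms by simp

lemma expansion_val_mono:
  fixes w :: "'k::field poly \<Rightarrow> 'g::linordered_ab_group_add with_infty"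
  assumes "\<gamma> \<le> \<gamma>'"
  shows "expansion_val w \<phi> \<gamma> f \<le> expansion_val w \<phi> \<gamma>' f"
  unfolding expansion_val_def
proof (rule Min.boundedI)
  fix x assume "x \<in> (\<lambda>n. w (f div \<phi> ^ n mod \<phi>) + nmul n \<gamma>') ` {..degree f}"
  then obtain n where n: "n \<le> degree f" "x = w (f div \<phi> ^ n mod \<phi>) + nmul n \<gamma>'" by auto
  have "Min ((\<lambda>n. w (f div \<phi> ^ n mod \<phi>) + nmul n \<gamma>) ` {..degree f}) \<le> w (f div \<phi> ^ n mod \<phi>) + nmul n \<gamma>"
    using n by (intro Min_le) auto
  also have "\<dots> \<le> x" using n nmul_mono[OF assms] by (simp add: add_left_mono)
  finally show "Min ((\<lambda>n. w (f div \<phi> ^ n mod \<phi>) + nmul n \<gamma>) ` {..degree f}) \<le> x" .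
qed auto

context poly_valued
begin

lemma expansion_val_le:
  assumes "degree \<phi> > 0"
  shows "expansion_val \<mu> \<phi> (\<mu> \<phi>) f \<le> \<mu> f"
proof (induction "degree f" arbitrary: f rule: less_induct)
  case less
  show ?case
  proof (cases "degree f < degree \<phi>")
    case False
    have f: "f mod \<phi> + f div \<phi> * \<phi> = f" by (simp add: add.commute)
    have "expansion_val \<mu> \<phi> (\<mu> \<phi>) f = min (\<mu> (f mod \<phi>)) (\<mu> \<phi> + expansion_val \<mu> \<phi> (\<mu> \<phi>) (f div \<phi>))"
      using expansion_val_rec[OF assms, of \<mu> "f mod \<phi>" "\<mu> \<phi>" "f div \<phi>"] degree_mod_less_pos[OF assms]
      by (simp add: f)
    also have "\<dots> \<le> min (\<mu> (f mod \<phi>)) (\<mu> (f div \<phi> * \<phi>))"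
      using less degree_div_less_pos[OF assms False]
      by (intro min.mono order_refl) (auto simp: val_mult add.commute intro: add_left_mono)
    also have "\<dots> \<le> \<mu> f" using val_add[of "f mod \<phi>" "f div \<phi> * \<phi>"] by (simp add: f)
    finally show ?thesis .
  qed (simp add: expansion_val_small)
qed

lemma expansion_val_self:
  assumes "degree \<phi> > 0"
    and "\<And>c q. degree c < degree \<phi> \<Longrightarrow> \<mu> (c + q * \<phi>) = min (\<mu> c) (\<mu> (q * \<phi>))"
  shows "expansion_val \<mu> \<phi> (\<mu> \<phi>) = \<mu>"
proof
  fix f show "expansion_val \<mu> \<phi> (\<mu> \<phi>) f = \<mu> f"
  proof (induction "degree f" arbitrary: f rule: less_induct)
    case less
    show ?case
    proof (cases "degree f < degree \<phi>")
      case False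
      have f: "f mod \<phi> + f div \<phi> * \<phi> = f" by (simp add: add.commute)
      have "expansion_val \<mu> \<phi> (\<mu> \<phi>) (f mod \<phi> + f div \<phi> * \<phi>) = min (\<mu> (f mod \<phi>)) (\<mu> \<phi> + \<mu> (f div \<phi>))"
        using less degree_div_less_pos[OF assms(1) False] degree_mod_less_pos[OF assms(1)]
        by (subst expansion_val_rec) (auto simp: assms(1))
      also have "\<dots> = \<mu> (f mod \<phi> + f div \<phi> * \<phi>)"
        using assms(2)[of "f mod \<phi>" "f div \<phi>"] degree_mod_less_pos[OF assms(1)]
        by (simp add: val_mult add.commute)
      finally show ?thesis by (simp only: f)
    qed (simp add: expansion_val_small)
  qed
qed

end

text \<open>Euclid's algorithm: the remainder of \<chi> by a nonconstant \<open>f\<close> is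
  nonzero, since otherwise \<open>f\<close> would be a proper factor. Once \<open>h\<close> is
  reduced modulo \<chi>, comparing degrees bounds the other cofactor too. With these bounds
  \<open>f * h = 1 - g * \<chi>\<close> is a \<chi>-expansion with two digits.\<close>

lemma bezout_poly:
  fixes \<chi> :: "'k::field poly"
  assumes "\<And>g h. \<chi> = g * h \<Longrightarrow> degree g < degree \<chi> \<Longrightarrow> degree h < degree \<chi> \<Longrightarrow> False"
    and "f \<noteq> 0" "degree f < degree \<chi>"
  shows "\<exists>h g. f * h + g * \<chi> = 1 \<and> degree h < degree \<chi> \<and> degree g < degree \<chi>"
proof -
  have "\<exists>h g. f * h + g * \<chi> = 1"
    using assms(2,3)
  proof (induction "degree f" arbitrary: f rule: less_induct)
    case less
    show ?case
    proof (cases "degree f = 0")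
      case True
      then obtain c where "f = [:c:]" "c \<noteq> 0" using less.prems by (auto elim!: degree_eq_zeroE)
      then show ?thesis by (intro exI[of _ "[:inverse c:]"] exI[of _ 0]) (simp add: one_pCons)
    next
      case False
      define r where "r = \<chi> mod f"
      have r: "\<chi> = f * (\<chi> div f) + r" by (simp add: r_def)
      have "r \<noteq> 0"
      proof
        assume "r = 0"
        then have "\<chi> = f * (\<chi> div f)" using r by simp
        moreover from this have "degree \<chi> = degree f + degree (\<chi> div f)"
          using less.prems by (metis degree_0 degree_mult_eq less_nat_zero_code mult_zero_right)
        ultimately show False using assms(1)[of f "\<chi> div f"] False less.prems(2) by simp
      qed
      moreover have "degree r < degree f"
        unfolding r_def using False by (intro degree_mod_less_pos) auto
      ultimately obtain h g where "r * h + g * \<chi> = 1"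
        using less by (meson less_trans)
      then have "f * (- (\<chi> div f) * h) + (g + h) * \<chi> = 1"
        unfolding r_def minus_mult_div_eq_mod[symmetric] by (simp add: algebra_simps)
      then show ?thesis by blast
    qed
  qed
  then obtain h g where hg: "f * h + g * \<chi> = 1" by blast
  have pos: "degree \<chi> > 0" using assms(3) by simp
  define h' where "h' = h mod \<chi>"
  define g' where "g' = g + f * (h div \<chi>)"
  have eq: "f * h' + g' * \<chi> = 1"
    unfolding hg[symmetric] h'_def g'_def minus_div_mult_eq_mod[symmetric] by (simp add: algebra_simps)
  have h': "degree h' < degree \<chi>" unfolding h'_def by (rule degree_mod_less_pos[OF pos])
  have "degree g' < degree \<chi>"
  proof (cases "g' = 0")
    case False
    have "g' * \<chi> = 1 - f * h'" unfolding eq[symmetric] by simp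
    then have "degree (g' * \<chi>) = degree (1 - f * h')" by simp
    also have "\<dots> \<le> max (degree (1::'k poly)) (degree (f * h'))" by (rule degree_diff_le_max)
    also have "\<dots> < degree \<chi> + degree \<chi>"
      using degree_mult_le[of f h'] h' assms(3) by auto
    finally show ?thesis using False pos by (subst (asm) degree_mult_eq) auto
  qed (use pos in simp)
  with eq h' show ?thesis by blast
qed

text \<open>For \<open>f\<close> of smaller degree than \<chi> take
  \<open>f * h + g * \<chi> = 1\<close>. Both valuations agree on \<open>f\<close> and
  \<open>h\<close>, hence on \<open>f * h = 1 - g * \<chi>\<close>, although they differ on
  \<open>g * \<chi>\<close> if its value is finite. This forces \<open>g * \<chi>\<close> to have
  positive \<rho>-value, so \<open>f\<close> is a unit up to positive value and not a key
  polynomial.\<close>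

lemma key_polynomial_augmentation_degree:
  fixes \<mu> \<rho> :: "'k::field poly \<Rightarrow> 'g::linordered_ab_group_add with_infty"
  assumes "valuation \<mu>" "valuation \<rho>" "ordinary_augmentation \<mu> \<chi> \<beta> \<rho>" "f \<in> key_polynomials \<rho>"
  shows "degree \<chi> \<le> degree f"
proof (rule ccontr)
  assume "\<not> ?thesis"
  then have f: "degree f < degree \<chi>" by simp
  interpret \<mu>: poly_valued \<mu> by standard (rule assms)
  interpret \<rho>: poly_valued \<rho> by standard (rule assms)
  have \<chi>: "\<chi> \<in> key_polynomials \<mu>" "\<mu> \<chi> < \<beta>" and \<rho>: "\<rho> = expansion_val \<mu> \<chi> \<beta>"
    using assms(3) by (auto simp: ordinary_augmentation_def)
  have "f \<noteq> 0" using \<rho>.key_polynomial_monic[OF assms(4)] by auto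
  then obtain h g where hg: "f * h + g * \<chi> = 1" "degree h < degree \<chi>" "degree g < degree \<chi>"
    using bezout_poly \<mu>.key_polynomial_irreducible[OF \<chi>(1)] f by blast
  have fh_eq: "\<mu> (f * h) = \<rho> (f * h)"
    unfolding \<mu>.val_mult \<rho>.val_mult using f hg(2) by (simp add: \<rho> expansion_val_small)
  have fh: "f * h = 1 + (- g) * \<chi>" using hg(1) by (simp add: algebra_simps)
  have "\<rho> (c + (- g) * \<chi>) = min (\<mu> c) (\<beta> + \<mu> g)" if "degree c = 0" for c
    unfolding \<rho> using expansion_val_linear[of \<mu> c \<chi> "- g" \<beta>] hg(3) that by simp
  from this[of 1] this[of 0] have \<rho>_eq: "\<rho> (1 + (- g) * \<chi>) = min 0 (\<beta> + \<mu> g)" "\<rho> ((- g) * \<chi>) = \<beta> + \<mu> g"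
    by simp_all
  \<comment> \<open>Otherwise \<open>g * \<chi>\<close> has a smaller \<mu>-value than \<rho>-value,
    and the term 1 affects neither minimum; the two values of \<open>f * h\<close> would then
    differ.\<close>
  moreover have "0 < \<beta> + \<mu> g"
  proof (rule ccontr)
    assume *: "\<not> ?thesis"
    then have "\<mu> g \<noteq> Infty" by auto
    then have less: "\<mu> g + \<mu> \<chi> < \<beta> + \<mu> g"
      using \<chi>(2) with_infty_add_right_cancel(2)[of "\<mu> g" "\<mu> \<chi>" \<beta>] by (simp add: add.commute)
    then have "\<mu> ((- g) * \<chi>) < \<mu> 1" using * by (simp add: \<mu>.val_mult)
    then have "\<mu> (1 + (- g) * \<chi>) = \<mu> g + \<mu> \<chi>"
      using \<mu>.val_add_eq[of "(- g) * \<chi>" 1] by (simp add: \<mu>.val_mult add.commute)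
    moreover have "\<mu> (1 + (- g) * \<chi>) = \<beta> + \<mu> g"
      using \<rho>_eq(1) fh_eq * by (simp add: fh min_def)
    ultimately show False using less by simp
  qed
  moreover have "h * f - 1 = (- g) * \<chi>" using fh by (simp add: algebra_simps)
  ultimately show False using \<rho>.key_polynomial_not_unit[OF assms(4), of h] by simp
qed

section \<open>Ball valuations and abstract key polynomials\<close>

text \<open>A root \<open>u\<close> of \<open>(\<Prod>y\<in>Y. [:- y, 1:]) - 1\<close> makes the
  values \<open>v (u - y)\<close> add up to 0, and they are nonnegative because a negative
  \<open>v u\<close> would make all of them negative. Algebraic closedness thus replaces the
  infinite residue field. That 0 lies in \<open>Y\<close> makes this polynomial nonconstant.\<close>

lemma ex_all_differences_valuation_0:
  fixes v :: "'l::alg_closed_field \<Rightarrow> 'g::linordered_ab_group_add with_infty"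
  assumes "valuation v" "finite Y" "0 \<in> Y" "\<And>y. y \<in> Y \<Longrightarrow> 0 \<le> v y"
  shows "\<exists>u. \<forall>y\<in>Y. v (u - y) = 0"
proof -
  interpret v: valued v by standard (rule assms)
  define P where "P = (\<Prod>y\<in>Y. [:- y, 1:]) - 1"
  have "degree (\<Prod>y\<in>Y. [:- y, 1:]) = card Y"
    by (subst degree_prod_eq_sum_degree) auto
  then have "degree P > 0"
    unfolding P_def diff_conv_add_uminus using assms(2,3)
    by (subst degree_add_eq_left) (auto simp: card_gt_0_iff)
  then obtain u where "poly P u = 0" using alg_closed_imp_poly_has_root by blast
  then have "(\<Prod>y\<in>Y. u - y) = 1" by (simp add: P_def poly_prod)
  moreover have "v (\<Prod>y\<in>Y. u - y) = (\<Sum>y\<in>Y. v (u - y))"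
    using assms(2) by induction (simp_all add: v.val_mult)
  ultimately have sum: "(\<Sum>y\<in>Y. v (u - y)) = 0" by simp
  have "0 \<le> v u"
  proof (rule ccontr)
    assume "\<not> 0 \<le> v u"
    then have neg: "v (u - y) < 0" if "y \<in> Y" for y
      using v.val_diff_eq[of u y] assms(4)[OF that] by simp
    have "(\<Sum>y\<in>Y. v (u - y)) = v (u - 0) + (\<Sum>y\<in>Y - {0}. v (u - y))"
      using assms(2,3) by (rule sum.remove)
    also have "\<dots> \<le> v (u - 0) + 0"
      using neg by (intro add_left_mono sum_nonpos) (auto intro: less_imp_le)
    also have "\<dots> < 0" using neg[OF assms(3)] by simp
    finally show False using sum by simp
  qed
  then have "0 \<le> v (u - y)" if "y \<in> Y" for y
    using assms(4)[OF that] by (rule v.val_diff_ge)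
  then have "\<forall>y\<in>Y. v (u - y) = 0"
    using sum sum_nonneg_eq_0_iff[OF assms(2), of "\<lambda>y. v (u - y)"] by simp
  then show ?thesis ..
qed

text \<open>The points of \<open>X\<close> inside the ball are rescaled by an element
  \<open>t\<close> of value \<delta>, and \<open>u\<close> avoids all their residues; then
  \<open>\<theta> + t * u\<close> has distance exactly \<delta> from each of them. Points outside
  keep their distance.\<close>

lemma ex_generic_point:
  fixes v :: "'l::alg_closed_field \<Rightarrow> 'g::linordered_ab_group_add with_infty"
  assumes "valuation v" "range v = UNIV" "finite X"
  shows "\<exists>z. \<forall>x\<in>X. v (z - x) = min (v (\<theta> - x)) \<delta>"
proof (cases \<delta>)
  case Infty
  then show ?thesis by (intro exI[of _ \<theta>]) (simp add: min_def)
next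
  case (Fin d)
  interpret v: valued v by standard (rule assms)
  obtain t where t: "v t = \<delta>" using assms(2) by (metis rangeE UNIV_I)
  then have "t \<noteq> 0" using Fin by auto
  have div: "0 \<le> v (x / t) \<longleftrightarrow> \<delta> \<le> v x" for x
  proof -
    have "v x = v (x / t) + \<delta>" using v.val_mult[of "x / t" t] t \<open>t \<noteq> 0\<close> by simp
    then show ?thesis using with_infty_add_right_cancel(1)[of \<delta> 0 "v (x / t)"] Fin by simp
  qed
  \<comment> \<open>\<theta> is added to \<open>X\<close> so that 0 lies in \<open>Y\<close>; this
    also yields \<open>v u = 0\<close>, which gives \<open>t * u\<close> the value \<delta> when
    points outside the ball are treated.\<close>
  define Y where "Y = (\<lambda>x. (x - \<theta>) / t) ` {x \<in> insert \<theta> X. \<delta> \<le> v (\<theta> - x)}"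
  have "finite Y" using assms(3) by (simp add: Y_def)
  moreover have "0 \<in> Y" by (auto simp: Y_def image_iff intro!: exI[of _ \<theta>])
  moreover have "0 \<le> v y" if "y \<in> Y" for y
    using that div by (auto simp: Y_def v.val_diff_commute)
  ultimately obtain u where u: "\<And>y. y \<in> Y \<Longrightarrow> v (u - y) = 0"
    using ex_all_differences_valuation_0[OF assms(1)] by metis
  have "v (\<theta> + t * u - x) = min (v (\<theta> - x)) \<delta>" if "x \<in> X" for x
  proof (cases "\<delta> \<le> v (\<theta> - x)")
    case True
    then have "v (u - (x - \<theta>) / t) = 0" using that by (intro u) (auto simp: Y_def)
    moreover have "\<theta> + t * u - x = t * (u - (x - \<theta>) / t)"
      using \<open>t \<noteq> 0\<close> by (simp add: field_simps)
    ultimately show ?thesis using True t by (simp add: v.val_mult min_def)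
  next
    case False
    have "v (t * u) = \<delta>" using u[OF \<open>0 \<in> Y\<close>] t by (simp add: v.val_mult)
    then have "v (\<theta> - x + t * u) = v (\<theta> - x)" using False by (intro v.val_add_eq) simp
    then show ?thesis using False by (simp add: min_absorb1 algebra_simps)
  qed
  then show ?thesis by blast
qed

text \<open>
  The value at a generic point of the closed ball \<open>B(\<theta>, \<delta>)\<close>; for \<open>\<delta> = \<infinity>\<close>, the value at \<open>\<theta>\<close>.
\<close>

definition ball_val ::
  "('l::field \<Rightarrow> 'g::linordered_ab_group_add with_infty) \<Rightarrow> 'l \<Rightarrow> 'g with_infty \<Rightarrow> 'l poly \<Rightarrow> 'g with_infty" where
  "ball_val v \<theta> \<delta> F = v (lead_coeff F) + (\<Sum>z\<in>#proots F. min (v (\<theta> - z)) \<delta>)"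

locale closed_valued = valued v
  for v :: "'l::alg_closed_field \<Rightarrow> 'g::linordered_ab_group_add with_infty" +
  assumes surj_v: "range v = UNIV"
begin

lemma val_poly: "v (poly F z) = v (lead_coeff F) + (\<Sum>w\<in>#proots F. v (z - w))"
proof (cases "F = 0")
  case False
  then obtain A where A: "F = smult (lead_coeff F) (\<Prod>x\<in>#A. [:-x, 1:])"
    using alg_closed_imp_factorization by blast
  have prod: "proots (\<Prod>x\<in>#A. [:-x, 1:]) = A"
  proof (induction A)
    case (add x A)
    have "(\<Prod>x\<in>#A. [:-x, 1:]) \<noteq> 0" by (auto simp: prod_mset_zero_iff)
    then have "proots ([:-x, 1:] * (\<Prod>x\<in>#A. [:-x, 1:])) = {#x#} + A"
      by (subst proots_mult) (simp_all only: add.IH proots_linear_factor minus_minus, simp_all)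
    then show ?case by simp
  qed simp
  have "proots F = proots (smult (lead_coeff F) (\<Prod>x\<in>#A. [:-x, 1:]))" using A by simp
  also have "\<dots> = A" using False by (simp add: prod)
  finally have "proots F = A" .
  moreover have "poly F z = lead_coeff F * (\<Prod>x\<in>#A. z - x)"
    by (subst A) (simp add: poly_prod_mset)
  moreover have "v (\<Prod>x\<in>#A. z - x) = (\<Sum>w\<in>#A. v (z - w))"
    by (induction A) (simp_all add: val_mult)
  ultimately show ?thesis by (simp add: val_mult)
qed simp

lemma ball_val_Infty: "ball_val v \<theta> Infty F = v (poly F \<theta>)"
  by (simp add: ball_val_def val_poly min_def)

text \<open>One point serves finitely many polynomials at once, and each instance of a valuation
  axiom involves finitely many. So the axioms for \<open>ball_val\<close>, whose definition by roots
  says nothing about sums, are inherited from \<open>v\<close>.\<close>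

lemma ball_val_generic:
  assumes "finite \<F>"
  shows "\<exists>z. \<forall>F\<in>\<F>. v (poly F z) = ball_val v \<theta> \<delta> F"
proof -
  have "finite (\<Union>F\<in>\<F>. set_mset (proots F))" using assms by auto
  from ex_generic_point[OF valuation surj_v this] obtain z where
    z: "\<forall>x\<in>(\<Union>F\<in>\<F>. set_mset (proots F)). v (z - x) = min (v (\<theta> - x)) \<delta>" by blast
  have "v (poly F z) = ball_val v \<theta> \<delta> F" if "F \<in> \<F>" for F
    unfolding val_poly ball_val_def using z that
    by (intro arg_cong2[where f = "(+)"] arg_cong[where f = sum_mset] image_mset_cong) auto
  then show ?thesis by blast
qed

lemma valuation_ball_val: "valuation (ball_val v \<theta> \<delta>)"
  unfolding valuation_def
proof (intro conjI allI)
  fix F G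
  obtain z where "\<forall>H\<in>{F, G, F + G, F * G}. v (poly H z) = ball_val v \<theta> \<delta> H"
    using ball_val_generic[of "{F, G, F + G, F * G}" \<theta> \<delta>] by blast
  then show "ball_val v \<theta> \<delta> (F * G) = ball_val v \<theta> \<delta> F + ball_val v \<theta> \<delta> G"
    and "min (ball_val v \<theta> \<delta> F) (ball_val v \<theta> \<delta> G) \<le> ball_val v \<theta> \<delta> (F + G)"
    using val_mult[of "poly F z" "poly G z"] val_add[of "poly F z" "poly G z"] by auto
qed (simp_all add: ball_val_def)

lemma ball_val_const: "ball_val v \<theta> \<delta> [:c:] = v c"
  by (simp add: ball_val_def)

lemma ball_val_linear: "ball_val v \<theta> \<delta> [:- z, 1:] = min (v (\<theta> - z)) \<delta>"
  by (simp add: ball_val_def)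

lemma ball_val_mono:
  assumes "\<delta> \<le> \<delta>'" shows "ball_val v \<theta> \<delta> F \<le> ball_val v \<theta> \<delta>' F"
  unfolding ball_val_def
  by (intro add_left_mono sum_mset_mono min.mono assms order_refl)

lemma ball_val_eq:
  assumes "\<And>z. F \<noteq> 0 \<Longrightarrow> poly F z = 0 \<Longrightarrow> v (\<theta> - z) \<le> \<delta>" "\<delta> \<le> \<delta>'"
  shows "ball_val v \<theta> \<delta> F = ball_val v \<theta> \<delta>' F"
proof (cases "F = 0")
  case False
  have "min (v (\<theta> - z)) \<delta> = min (v (\<theta> - z)) \<delta>'" if "z \<in># proots F" for z
  proof -
    have "v (\<theta> - z) \<le> \<delta>" using that False assms(1) by simp
    moreover from this have "v (\<theta> - z) \<le> \<delta>'" using assms(2) by (rule order_trans)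
    ultimately show ?thesis by (simp add: min_absorb1)
  qed
  then show ?thesis
    unfolding ball_val_def
    by (intro arg_cong2[where f = "(+)"] arg_cong[where f = sum_mset] image_mset_cong) auto
qed (simp add: ball_val_def)

text \<open>Every point of an ultrametric ball is a center: the distances of \<open>z\<close> from
  \<theta> and from \<open>a\<close> agree below \<delta>, and both are cut off at \<delta>.\<close>

lemma ball_val_center:
  assumes "\<delta> \<le> v (\<theta> - a)" shows "ball_val v \<theta> \<delta> = ball_val v a \<delta>"
proof -
  have "min (v (\<theta> - z)) \<delta> = min (v (a - z)) \<delta>" for z
  proof (cases "\<delta> \<le> v (\<theta> - z)")
    case True
    have "\<delta> \<le> v (\<theta> - z - (\<theta> - a))" by (rule val_diff_ge[OF True assms])
    then show ?thesis using True by (simp add: min_def)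
  next
    case False
    then have "v (\<theta> - z - (\<theta> - a)) = v (\<theta> - z)" using assms by (intro val_diff_eq) simp
    then show ?thesis by simp
  qed
  then show ?thesis by (simp add: ball_val_def fun_eq_iff)
qed

lemma ball_val_finite:
  assumes "F \<noteq> 0" "\<delta> \<noteq> Infty" shows "ball_val v \<theta> \<delta> F \<noteq> Infty"
proof -
  have "(\<Sum>z\<in>#M. min (v (\<theta> - z)) \<delta>) \<noteq> Infty" for M
    using assms(2) by (induction M) (auto simp: min_def)
  then show ?thesis using assms(1) by (simp add: ball_val_def valuation_field_eq_Infty[OF valuation])
qed

text \<open>The linear factor of the root \<open>z\<close> gains value when the ball shrinks and the
  cofactor loses none; as the cofactor has finite value in the larger ball, the gain is not
  absorbed.\<close>

lemma ball_val_less: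
  assumes "F \<noteq> 0" "poly F z = 0" "\<delta> < v (\<theta> - z)" "\<delta> < \<delta>'"
  shows "ball_val v \<theta> \<delta> F < ball_val v \<theta> \<delta>' F"
proof -
  interpret w: valued "ball_val v \<theta> \<delta>" by standard (rule valuation_ball_val)
  interpret w': valued "ball_val v \<theta> \<delta>'" by standard (rule valuation_ball_val)
  obtain G where G: "F = [:- z, 1:] * G" using assms(2) by (auto simp: poly_eq_0_iff_dvd)
  moreover have "ball_val v \<theta> \<delta> [:- z, 1:] < ball_val v \<theta> \<delta>' [:- z, 1:]"
    using assms(3,4) by (auto simp: ball_val_linear min_def)
  moreover have "G \<noteq> 0" using G assms(1) by auto
  then have "ball_val v \<theta> \<delta> G \<noteq> Infty" using assms(4) by (intro ball_val_finite) auto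
  moreover have "ball_val v \<theta> \<delta> G \<le> ball_val v \<theta> \<delta>' G"
    using assms(4) by (intro ball_val_mono) simp
  ultimately show ?thesis
    unfolding G w.val_mult w'.val_mult by (intro with_infty_add_less_le_mono)
qed

end

section \<open>Polynomials over the base field and their ball valuations\<close>

locale closure_valued = closed_valued v
  for \<iota> :: "'k::field \<Rightarrow> 'l::alg_closed_field"
    and v :: "'l \<Rightarrow> 'g::linordered_ab_group_add with_infty" +
  assumes closure: "algebraic_closure \<iota>"
begin

abbreviation lift :: "'k poly \<Rightarrow> 'l poly" where "lift \<equiv> map_poly \<iota>"

lemma embed_1: "\<iota> 1 = 1" and embed_add: "\<iota> (x + y) = \<iota> x + \<iota> y"
  and embed_mult: "\<iota> (x * y) = \<iota> x * \<iota> y"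
  using closure by (simp_all add: algebraic_closure_def)

lemma embed_0 [simp]: "\<iota> 0 = 0"
  by (metis add.right_neutral add_left_cancel embed_add)

lemma embed_eq_0_iff [simp]: "\<iota> x = 0 \<longleftrightarrow> x = 0"
  using embed_mult[of x "inverse x"] by (cases "x = 0") (auto simp: embed_1)

lemma embed_sum: "\<iota> (sum f I) = (\<Sum>i\<in>I. \<iota> (f i))"
  by (induction I rule: infinite_finite_induct) (simp_all add: embed_add)

lemma lift_add: "lift (f + g) = lift f + lift g"
  by (rule poly_eqI) (simp add: coeff_map_poly embed_add)

lemma lift_mult: "lift (f * g) = lift f * lift g"
  by (rule poly_eqI) (simp add: coeff_map_poly coeff_mult embed_sum embed_mult)

lemma lift_const: "lift [:c:] = [:\<iota> c:]"
  by (simp add: map_poly_pCons)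

lemma lift_eq_0_iff [simp]: "lift f = 0 \<longleftrightarrow> f = 0"
  by (rule map_poly_eq_0_iff) auto

lemma degree_lift [simp]: "degree (lift f) = degree f"
  by (rule degree_map_poly) auto

lemma ex_root:
  assumes "degree f > 0" obtains z where "poly (lift f) z = 0"
  using alg_closed_imp_poly_has_root[of "lift f"] assms by auto

lemma finite_roots: "f \<noteq> 0 \<Longrightarrow> finite {z. poly (lift f) z = 0}"
  by (rule poly_roots_finite) simp

lemma ex_closest_root:
  assumes "f \<noteq> 0" "poly (lift f) z = 0"
  obtains a where "poly (lift f) a = 0" "\<And>z. poly (lift f) z = 0 \<Longrightarrow> v (\<theta> - z) \<le> v (\<theta> - a)"
proof -
  let ?S = "(\<lambda>z. v (\<theta> - z)) ` {z. poly (lift f) z = 0}"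
  have fin: "finite ?S" and "?S \<noteq> {}" using assms finite_roots by auto
  then have "Max ?S \<in> ?S" by (rule Max_in)
  then obtain a where "poly (lift f) a = 0" "v (\<theta> - a) = Max ?S" by auto
  then show thesis using that Max_ge[OF fin] by auto
qed

lemma min_poly_exists_unique:
  "\<exists>!p. lead_coeff p = 1 \<and> poly (lift p) a = 0 \<and>
     (\<forall>q. q \<noteq> 0 \<and> poly (lift q) a = 0 \<longrightarrow> degree p \<le> degree q)"
proof -
  obtain p0 where "p0 \<noteq> 0 \<and> poly (lift p0) a = 0"
    using closure unfolding algebraic_closure_def by blast
  from ex_has_least_nat[of "\<lambda>p. p \<noteq> 0 \<and> poly (lift p) a = 0", OF this, of degree]
  obtain p where p: "p \<noteq> 0" "poly (lift p) a = 0"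
    "\<And>q. q \<noteq> 0 \<Longrightarrow> poly (lift q) a = 0 \<Longrightarrow> degree p \<le> degree q" by blast
  define p' where "p' = [:inverse (lead_coeff p):] * p"
  have p': "lead_coeff p' = 1" "degree p' = degree p"
    using p(1) by (simp_all add: p'_def)
  have "poly (lift p') a = 0" unfolding p'_def lift_mult using p(2) by simp
  moreover have "p1 = p2"
    if "lead_coeff p1 = 1" "poly (lift p1) a = 0" "\<And>q. q \<noteq> 0 \<and> poly (lift q) a = 0 \<longrightarrow> degree p1 \<le> degree q"
      "lead_coeff p2 = 1" "poly (lift p2) a = 0" "\<And>q. q \<noteq> 0 \<and> poly (lift q) a = 0 \<longrightarrow> degree p2 \<le> degree q"
    for p1 p2
  proof (rule ccontr)
    assume "p1 \<noteq> p2"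
    then have ne: "p1 - p2 \<noteq> 0" by simp
    have deg: "degree p1 = degree p2"
      using that by (metis le_antisym leading_coeff_0_iff zero_neq_one)
    have "lift p1 = lift (p1 - p2) + lift p2" using lift_add[of "p1 - p2" p2] by simp
    then have "poly (lift (p1 - p2)) a = 0" using that by simp
    then have "degree p2 \<le> degree (p1 - p2)" using that ne by blast
    moreover have "degree (p1 - p2) \<le> degree p2" using deg by (intro degree_diff_le) simp_all
    moreover have "coeff (p1 - p2) (degree p2) = 0" using that deg by simp
    ultimately show False using ne by (metis le_antisym leading_coeff_0_iff)
  qed
  ultimately show ?thesis
    using p p' by (intro ex_ex1I exI[of _ p']) auto
qed

lemma min_poly_monic: "lead_coeff (min_poly \<iota> a) = 1"
  and min_poly_root: "poly (lift (min_poly \<iota> a)) a = 0"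
  and deg_over_le: "q \<noteq> 0 \<Longrightarrow> poly (lift q) a = 0 \<Longrightarrow> deg_over \<iota> a \<le> degree q"
  using theI'[OF min_poly_exists_unique[of a]] by (auto simp: min_poly_def deg_over_def)

lemma min_poly_nonzero: "min_poly \<iota> a \<noteq> 0"
  using min_poly_monic[of a] by auto

lemma degree_min_poly: "degree (min_poly \<iota> a) = deg_over \<iota> a"
  by (simp add: deg_over_def)

lemma root_degree_pos:
  assumes "f \<noteq> 0" "poly (lift f) z = 0" shows "degree f > 0"
proof (rule ccontr)
  assume "\<not> ?thesis"
  then obtain c where "f = [:c:]" by (auto elim!: degree_eq_zeroE)
  then show False using assms by (simp add: lift_const)
qed

lemma deg_over_pos: "deg_over \<iota> a > 0"
  unfolding degree_min_poly[symmetric] by (rule root_degree_pos[OF min_poly_nonzero min_poly_root])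

text \<open>A ball valuation restricted to the base field. The name anticipates
  \<open>trunc_eq_expansion_val\<close>: at the radius of a suitable polynomial this is a truncation
  of \<open>v\<^sub>\<theta>\<close>.\<close>

definition trunc :: "'l \<Rightarrow> 'g with_infty \<Rightarrow> 'k poly \<Rightarrow> 'g with_infty" where
  "trunc \<theta> \<delta> f = ball_val v \<theta> \<delta> (lift f)"

lemma trunc_Infty: "trunc \<theta> Infty = val_at \<iota> v \<theta>"
  by (simp add: trunc_def val_at_def ball_val_Infty fun_eq_iff)

lemma valuation_trunc: "valuation (trunc \<theta> \<delta>)"
proof -
  interpret w: valued "ball_val v \<theta> \<delta>" by standard (rule valuation_ball_val)
  show ?thesis
    using w.val_add by (simp add: valuation_def trunc_def lift_add lift_mult w.val_mult embed_1)
qed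

lemma trunc_const: "trunc \<theta> \<delta> [:c:] = v (\<iota> c)"
  by (simp add: trunc_def lift_const ball_val_const)

lemma trunc_mono: "\<delta> \<le> \<delta>' \<Longrightarrow> trunc \<theta> \<delta> f \<le> trunc \<theta> \<delta>' f"
  by (simp add: trunc_def ball_val_mono)

lemma trunc_le_val_at: "trunc \<theta> \<delta> f \<le> val_at \<iota> v \<theta> f"
  unfolding trunc_Infty[symmetric] by (rule trunc_mono) simp

lemma trunc_eq:
  assumes "\<And>z. f \<noteq> 0 \<Longrightarrow> poly (lift f) z = 0 \<Longrightarrow> v (\<theta> - z) \<le> \<delta>" "\<delta> \<le> \<delta>'"
  shows "trunc \<theta> \<delta> f = trunc \<theta> \<delta>' f"
  unfolding trunc_def using assms by (intro ball_val_eq) auto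

lemma trunc_eq_val_at:
  assumes "\<And>z. f \<noteq> 0 \<Longrightarrow> poly (lift f) z = 0 \<Longrightarrow> v (\<theta> - z) \<le> \<delta>"
  shows "trunc \<theta> \<delta> f = val_at \<iota> v \<theta> f"
  unfolding trunc_Infty[symmetric] using assms by (rule trunc_eq) auto

lemma trunc_less:
  assumes "f \<noteq> 0" "poly (lift f) z = 0" "\<delta> < v (\<theta> - z)" "\<delta> < \<delta>'"
  shows "trunc \<theta> \<delta> f < trunc \<theta> \<delta>' f"
  unfolding trunc_def using assms by (intro ball_val_less) auto

lemma trunc_less_val_at:
  assumes "f \<noteq> 0" "poly (lift f) z = 0" "\<delta> < v (\<theta> - z)"
  shows "trunc \<theta> \<delta> f < val_at \<iota> v \<theta> f"
proof -
  have "\<delta> < Infty" using assms(3) by auto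
  from trunc_less[OF assms this] show ?thesis by (simp add: trunc_Infty)
qed

lemma trunc_finite: "f \<noteq> 0 \<Longrightarrow> \<delta> \<noteq> Infty \<Longrightarrow> trunc \<theta> \<delta> f \<noteq> Infty"
  unfolding trunc_def by (rule ball_val_finite) auto

lemma trunc_center: "\<delta> \<le> v (\<theta> - a) \<Longrightarrow> trunc \<theta> \<delta> = trunc a \<delta>"
  by (simp add: trunc_def fun_eq_iff ball_val_center)

lemma poly_valued_trunc: "poly_valued (trunc \<theta> \<delta>)"
  by (intro poly_valued.intro valued.intro valuation_trunc)

lemma poly_valued_val_at: "poly_valued (val_at \<iota> v \<theta>)"
  unfolding trunc_Infty[symmetric] by (rule poly_valued_trunc)

lemma root_le_of_trunc_eq:
  assumes "trunc \<theta> \<delta> f = val_at \<iota> v \<theta> f" "f \<noteq> 0" "poly (lift f) z = 0"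
  shows "v (\<theta> - z) \<le> \<delta>"
  using trunc_less_val_at[OF assms(2,3), of \<delta> \<theta>] assms(1) by (intro leI notI) simp

text \<open>\<delta> is determined by \<phi> and is carried along because it is the radius of the
  ball that belongs to \<phi>. For \<open>\<delta> = Infty\<close> the only such polynomial is the
  minimal polynomial of \<theta>.\<close>

definition abstract_key :: "'l \<Rightarrow> 'k poly \<Rightarrow> 'g with_infty \<Rightarrow> bool" where
  "abstract_key \<theta> \<phi> \<delta> \<longleftrightarrow> lead_coeff \<phi> = 1 \<and> (\<exists>a. poly (lift \<phi>) a = 0 \<and> v (\<theta> - a) = \<delta>) \<and>
     (\<forall>z. poly (lift \<phi>) z = 0 \<longrightarrow> v (\<theta> - z) \<le> \<delta>) \<and>
     (\<forall>b. deg_over \<iota> b < degree \<phi> \<longrightarrow> v (\<theta> - b) < \<delta>)"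

context
  fixes \<theta> \<phi> \<delta>
  assumes key: "abstract_key \<theta> \<phi> \<delta>"
begin

lemma abstract_key_monic: "lead_coeff \<phi> = 1"
  and abstract_key_root_le: "poly (lift \<phi>) z = 0 \<Longrightarrow> v (\<theta> - z) \<le> \<delta>"
  and abstract_key_less: "deg_over \<iota> b < degree \<phi> \<Longrightarrow> v (\<theta> - b) < \<delta>"
  using key by (auto simp: abstract_key_def)

lemma abstract_key_nonzero: "\<phi> \<noteq> 0"
  using abstract_key_monic by auto

lemma abstract_key_root:
  obtains a where "poly (lift \<phi>) a = 0" "v (\<theta> - a) = \<delta>" "deg_over \<iota> a = degree \<phi>"
proof -
  obtain a where a: "poly (lift \<phi>) a = 0" "v (\<theta> - a) = \<delta>" using key by (auto simp: abstract_key_def)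
  then have "deg_over \<iota> a = degree \<phi>"
    using deg_over_le[OF abstract_key_nonzero a(1)] abstract_key_less[of a] by fastforce
  with a show thesis by (rule that)
qed

lemma abstract_key_degree_pos: "degree \<phi> > 0"
  using abstract_key_root root_degree_pos abstract_key_nonzero by metis

lemma abstract_key_lower_root_less:
  "f \<noteq> 0 \<Longrightarrow> degree f < degree \<phi> \<Longrightarrow> poly (lift f) z = 0 \<Longrightarrow> v (\<theta> - z) < \<delta>"
  using deg_over_le abstract_key_less le_less_trans by blast

lemma trunc_eq_val_at_lower: "degree f < degree \<phi> \<Longrightarrow> trunc \<theta> \<delta> f = val_at \<iota> v \<theta> f"
  using abstract_key_lower_root_less by (intro trunc_eq_val_at) (auto intro: less_imp_le)

lemma trunc_abstract_key: "trunc \<theta> \<delta> \<phi> = val_at \<iota> v \<theta> \<phi>"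
  using abstract_key_root_le by (intro trunc_eq_val_at)

lemma abstract_key_irreducible:
  assumes "\<phi> = g * h" "degree g < degree \<phi>" "degree h < degree \<phi>" shows False
proof -
  obtain a where a: "poly (lift \<phi>) a = 0" "v (\<theta> - a) = \<delta>" by (rule abstract_key_root)
  have "g \<noteq> 0" "h \<noteq> 0" using assms(1) abstract_key_nonzero by auto
  moreover have "poly (lift g) a = 0 \<or> poly (lift h) a = 0"
    using a(1) by (simp add: assms(1) lift_mult)
  ultimately show False
    using abstract_key_lower_root_less[of _ a] assms(2,3) a(2) by blast
qed

text \<open>
  A closest root \<open>a\<close> of \<open>\<phi>\<close> is also a center of the ball \<open>B(\<theta>, \<delta>)\<close>, and \<open>\<phi>\<close> is a polynomial of
  least degree on which the ball valuation and \<open>v\<^sub>a\<close> differ.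
\<close>

lemma trunc_eq_expansion_val: "trunc \<theta> \<delta> = expansion_val (val_at \<iota> v \<theta>) \<phi> (val_at \<iota> v \<theta> \<phi>)"
proof -
  interpret w: poly_valued "trunc \<theta> \<delta>" by (rule poly_valued_trunc)
  have "expansion_val (trunc \<theta> \<delta>) \<phi> (trunc \<theta> \<delta> \<phi>) = trunc \<theta> \<delta>"
  proof (rule w.expansion_val_self[OF abstract_key_degree_pos])
    fix c q :: "'k poly" assume c: "degree c < degree \<phi>"
    obtain a where a: "poly (lift \<phi>) a = 0" "v (\<theta> - a) = \<delta>" by (rule abstract_key_root)
    show "trunc \<theta> \<delta> (c + q * \<phi>) = min (trunc \<theta> \<delta> c) (trunc \<theta> \<delta> (q * \<phi>))"
    proof (cases "\<delta> = Infty")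
      case True
      then have "a = \<theta>" using a(2) by (simp add: valuation_field_eq_Infty[OF valuation])
      then show ?thesis using a(1) True by (simp add: trunc_Infty val_at_def lift_add lift_mult)
    next
      case False
      have center: "trunc \<theta> \<delta> = trunc a \<delta>" using a(2) by (simp add: trunc_center)
      have "minimal_divisor (trunc a \<delta>) (val_at \<iota> v a) \<phi>"
      proof (intro minimal_divisor.intro minimal_divisor_axioms.intro poly_valued_trunc poly_valued_val_at)
        show "trunc a \<delta> f \<le> val_at \<iota> v a f" for f by (rule trunc_le_val_at)
        show "lead_coeff \<phi> = 1" by (rule abstract_key_monic)
        \<comment> \<open>\<phi> vanishes at \<open>a\<close>, whereas a ball of finite radius gives
          a nonzero polynomial a finite value.\<close>
        show "trunc a \<delta> \<phi> < val_at \<iota> v a \<phi>"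
          using a(1) False abstract_key_nonzero by (auto simp: val_at_def trunc_finite)
        fix f :: "'k poly" assume f: "degree f < degree \<phi>"
        show "trunc a \<delta> f = val_at \<iota> v a f"
        proof (rule trunc_eq_val_at)
          fix z assume "f \<noteq> 0" "poly (lift f) z = 0"
          then have less: "v (\<theta> - z) < \<delta>" by (rule abstract_key_lower_root_less[OF _ f])
          then have "v (\<theta> - z - (\<theta> - a)) = v (\<theta> - z)"
            using a(2) by (intro val_diff_eq) simp
          then show "v (a - z) \<le> \<delta>" using less by simp
        qed
      qed
      then interpret m: minimal_divisor "trunc a \<delta>" "val_at \<iota> v a" \<phi> .
      show ?thesis unfolding center by (rule m.add_mult_eq[OF c])
    qed
  qed
  then have "trunc \<theta> \<delta> = expansion_val (trunc \<theta> \<delta>) \<phi> (trunc \<theta> \<delta> \<phi>)" by simp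
  also have "\<dots> = expansion_val (val_at \<iota> v \<theta>) \<phi> (val_at \<iota> v \<theta> \<phi>)"
    unfolding trunc_abstract_key by (intro expansion_val_cong abstract_key_degree_pos trunc_eq_val_at_lower)
  finally show ?thesis .
qed

text \<open>As for augmentations, a key polynomial \<open>f\<close> of smaller degree would be a
  unit up to positive value, by \<open>f * h + g * \<phi> = 1\<close>. Here no preceding valuation
  is given, and one has to be made.\<close>

lemma trunc_key_polynomial_degree:
  assumes f: "f \<in> key_polynomials (trunc \<theta> \<delta>)"
  shows "degree \<phi> \<le> degree f"
proof (rule ccontr)
  assume "\<not> ?thesis"
  then have deg: "degree f < degree \<phi>" by simp
  interpret w: poly_valued "trunc \<theta> \<delta>" by (rule poly_valued_trunc)
  have "f \<noteq> 0" using w.key_polynomial_monic[OF f] by auto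
  then obtain h g where hg: "f * h + g * \<phi> = 1" "degree h < degree \<phi>"
    using bezout_poly abstract_key_irreducible deg by blast
  have pos: "degree f > 0" by (rule w.key_polynomial_degree[OF f])
  have "h \<noteq> 0"
  proof
    assume "h = 0"
    then have "degree (g * \<phi>) = 0" using hg(1) by simp
    moreover have "g \<noteq> 0" using hg(1) \<open>h = 0\<close> by auto
    ultimately show False
      using abstract_key_degree_pos abstract_key_nonzero by (simp add: degree_mult_eq)
  qed
  with \<open>f \<noteq> 0\<close> have fh: "f * h \<noteq> 0" by simp
  have "degree (f * h) > 0" using pos \<open>h \<noteq> 0\<close> \<open>f \<noteq> 0\<close> by (simp add: degree_mult_eq)
  then obtain z where "poly (lift (f * h)) z = 0" by (rule ex_root)
  then obtain b where b: "poly (lift (f * h)) b = 0"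
    "\<And>z. poly (lift (f * h)) z = 0 \<Longrightarrow> v (\<theta> - z) \<le> v (\<theta> - b)"
    using ex_closest_root[OF fh] by metis
  \<comment> \<open>The ball through the closest root of \<open>f * h\<close> takes the role of the
    preceding valuation: it gives \<open>f * h\<close> the same value, but \<open>g * \<phi>\<close>
    a smaller one if that value is finite, since \<phi> has a root closer than \<epsilon>.\<close>
  define \<epsilon> where "\<epsilon> = v (\<theta> - b)"
  interpret w0: poly_valued "trunc \<theta> \<epsilon>" by (rule poly_valued_trunc)
  have "\<epsilon> < \<delta>"
    using b(1) abstract_key_lower_root_less[OF \<open>f \<noteq> 0\<close> deg] abstract_key_lower_root_less[OF \<open>h \<noteq> 0\<close> hg(2)]
    unfolding \<epsilon>_def lift_mult by auto
  have eq: "trunc \<theta> \<epsilon> (f * h) = trunc \<theta> \<delta> (f * h)"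
    using b(2) \<open>\<epsilon> < \<delta>\<close> by (intro trunc_eq) (auto simp: \<epsilon>_def)
  have fh_eq: "1 - g * \<phi> = f * h" unfolding hg(1)[symmetric] by simp
  have "0 < trunc \<theta> \<delta> (g * \<phi>)"
  proof (rule ccontr)
    assume *: "\<not> ?thesis"
    obtain a where a: "poly (lift \<phi>) a = 0" "v (\<theta> - a) = \<delta>" by (rule abstract_key_root)
    have "g * \<phi> \<noteq> 0" using * by auto
    then have less: "trunc \<theta> \<epsilon> (g * \<phi>) < trunc \<theta> \<delta> (g * \<phi>)"
      using a \<open>\<epsilon> < \<delta>\<close> by (intro trunc_less[of _ a]) (auto simp: lift_mult)
    then have "trunc \<theta> \<epsilon> (g * \<phi>) < trunc \<theta> \<epsilon> 1" using * by auto
    then have "trunc \<theta> \<epsilon> (1 - g * \<phi>) = trunc \<theta> \<epsilon> (g * \<phi>)"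
      using w0.val_diff_eq[of "g * \<phi>" 1] w0.val_diff_commute[of 1] by simp
    moreover have "trunc \<theta> \<delta> (g * \<phi>) \<le> trunc \<theta> \<delta> (1 - g * \<phi>)"
      using * by (intro w.val_diff_ge) auto
    ultimately show False using less eq unfolding fh_eq by simp
  qed
  moreover have "h * f - 1 = - (g * \<phi>)" using fh_eq by (simp add: algebra_simps)
  ultimately show False using w.key_polynomial_not_unit[OF f, of h] by simp
qed

text \<open>\<phi> has least degree among the polynomials on which
  \<open>trunc \<theta> \<epsilon>\<close> is below \<open>v\<^sub>\<theta>\<close>, since those of
  smaller degree have no root closer than \<epsilon>. The agreement in smaller degree also allows
  the digits to be evaluated by \<open>trunc \<theta> \<epsilon>\<close> instead of
  \<open>v\<^sub>\<theta>\<close>.\<close>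

lemma abstract_key_trunc_key_polynomial:
  assumes "\<epsilon> < \<delta>" "\<And>b. deg_over \<iota> b < degree \<phi> \<Longrightarrow> v (\<theta> - b) \<le> \<epsilon>"
  shows "ordinary_augmentation (trunc \<theta> \<epsilon>) \<phi> (val_at \<iota> v \<theta> \<phi>) (trunc \<theta> \<delta>)"
proof -
  have eq: "trunc \<theta> \<epsilon> f = val_at \<iota> v \<theta> f" if "degree f < degree \<phi>" for f
    using deg_over_le that assms(2) le_less_trans by (intro trunc_eq_val_at) blast
  obtain a where a: "poly (lift \<phi>) a = 0" "v (\<theta> - a) = \<delta>" by (rule abstract_key_root)
  have less: "trunc \<theta> \<epsilon> \<phi> < val_at \<iota> v \<theta> \<phi>"
    using a assms(1) abstract_key_nonzero by (intro trunc_less_val_at[of _ a]) auto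
  have "minimal_divisor (trunc \<theta> \<epsilon>) (val_at \<iota> v \<theta>) \<phi>"
    by (intro minimal_divisor.intro minimal_divisor_axioms.intro poly_valued_trunc poly_valued_val_at
        trunc_le_val_at abstract_key_monic less eq)
  then have "\<phi> \<in> key_polynomials (trunc \<theta> \<epsilon>)" by (rule minimal_divisor.key_polynomial)
  moreover have "trunc \<theta> \<delta> = expansion_val (trunc \<theta> \<epsilon>) \<phi> (val_at \<iota> v \<theta> \<phi>)"
    unfolding trunc_eq_expansion_val
    by (intro expansion_val_cong abstract_key_degree_pos) (simp add: eq)
  ultimately show ?thesis using less by (simp add: ordinary_augmentation_def)
qed

end

end

section \<open>The steps of a Mac Lane--Vaquie chain\<close>

lemma stable_val_eq:
  assumes lin: "linear_order_on I R" and c: "eventual_value (I, R, \<rho>) f c"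
  shows "stable_val (I, R, \<rho>) f = c"
  unfolding stable_val_def
proof (rule the_equality)
  show "eventual_value (I, R, \<rho>) f c" by (rule c)
next
  fix c' assume "eventual_value (I, R, \<rho>) f c'"
  then obtain i' where i': "i' \<in> I" "\<And>j. j \<in> I \<Longrightarrow> (i', j) \<in> R \<Longrightarrow> \<rho> j f = c'" by auto
  obtain i where i: "i \<in> I" "\<And>j. j \<in> I \<Longrightarrow> (i, j) \<in> R \<Longrightarrow> \<rho> j f = c" using c by auto
  have "(i, i') \<in> R \<or> (i', i) \<in> R" "(i, i) \<in> R" "(i', i') \<in> R"
    using lin i(1) i'(1) by (cases "i = i'"; auto simp: order_on_defs refl_on_def total_on_def)+
  then show "c' = c" using i i' by metis
qed

context closure_valued
begin

lemma abstract_keyI: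
  assumes "lead_coeff \<phi> = 1" "poly (lift \<phi>) z = 0" "\<epsilon> < v (\<theta> - z)"
    and "\<And>b. deg_over \<iota> b < degree \<phi> \<Longrightarrow> v (\<theta> - b) \<le> \<epsilon>"
  obtains \<delta> where "abstract_key \<theta> \<phi> \<delta>" "\<epsilon> < \<delta>"
proof -
  have "\<phi> \<noteq> 0" using assms(1) by auto
  then obtain a where a: "poly (lift \<phi>) a = 0" "\<And>z. poly (lift \<phi>) z = 0 \<Longrightarrow> v (\<theta> - z) \<le> v (\<theta> - a)"
    using ex_closest_root[OF _ assms(2)] by metis
  have "\<epsilon> < v (\<theta> - a)" using a(2)[OF assms(2)] assms(3) by simp
  moreover from this have "abstract_key \<theta> \<phi> (v (\<theta> - a))"
    unfolding abstract_key_def using assms(1,4) a by (blast intro: le_less_trans)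
  ultimately show thesis using that by blast
qed

lemma root_gt_of_trunc_less:
  assumes "trunc \<theta> \<delta> f < val_at \<iota> v \<theta> f"
  obtains z where "poly (lift f) z = 0" "\<delta> < v (\<theta> - z)"
  using assms trunc_eq_val_at[of f \<theta> \<delta>] by (metis less_irrefl linorder_not_le)

lemma abstract_keyI_trunc:
  assumes "lead_coeff \<phi> = 1" "trunc \<theta> \<epsilon> \<phi> < val_at \<iota> v \<theta> \<phi>"
    and "\<And>b. deg_over \<iota> b < degree \<phi> \<Longrightarrow> v (\<theta> - b) \<le> \<epsilon>"
  obtains \<delta> where "abstract_key \<theta> \<phi> \<delta>" "\<epsilon> < \<delta>"
proof -
  obtain z where "poly (lift \<phi>) z = 0" "\<epsilon> < v (\<theta> - z)" using assms(2) by (rule root_gt_of_trunc_less)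
  from abstract_keyI[OF assms(1) this assms(3)] show thesis using that by blast
qed

text \<open>A closer \<open>b\<close> would be detected on its minimal polynomial. Agreement of
  valuations in small degrees is converted in this way into a bound on distances.\<close>

lemma distance_le_of_trunc_eq:
  assumes "\<And>f. degree f < d \<Longrightarrow> trunc \<theta> \<delta> f = val_at \<iota> v \<theta> f" "deg_over \<iota> b < d"
  shows "v (\<theta> - b) \<le> \<delta>"
  using assms by (intro root_le_of_trunc_eq[of _ _ "min_poly \<iota> b"])
    (auto simp: degree_min_poly min_poly_nonzero min_poly_root)

text \<open>The common outcome of ordinary and limit steps, with \<open>d\<close> the previous
  degree. Its second condition has the form of (OS0), which is what allows the degrees of chains and
  of Okutsu sequences to be compared.\<close>

definition next_key :: "'l \<Rightarrow> nat \<Rightarrow> 'k poly \<Rightarrow> bool" where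
  "next_key \<theta> d \<phi> \<longleftrightarrow> (\<exists>\<delta>. abstract_key \<theta> \<phi> \<delta>) \<and>
     (\<forall>b. deg_over \<iota> b < degree \<phi> \<longrightarrow> (\<exists>b'. deg_over \<iota> b' = d \<and> v (\<theta> - b) \<le> v (\<theta> - b')))"

text \<open>By \<open>low\<close> no element of degree below \<open>degree \<phi>'\<close> is closer
  to \<theta> than \<delta>, and \<delta> is the distance of a root of \<phi>. At this root the
  maximum of the distances is attained.\<close>

lemma ordinary_step:
  assumes key: "abstract_key \<theta> \<phi> \<delta>" and deg: "degree \<phi> < degree \<phi>'"
    and \<phi>': "lead_coeff \<phi>' = 1" "trunc \<theta> \<delta> \<phi>' < val_at \<iota> v \<theta> \<phi>'"
    and low: "\<And>f. degree f < degree \<phi>' \<Longrightarrow> trunc \<theta> \<delta> f = val_at \<iota> v \<theta> f"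
  shows "next_key \<theta> (degree \<phi>) \<phi>' \<and> has_max (distances \<iota> v \<theta> (degree \<phi>))"
proof -
  have le: "v (\<theta> - b) \<le> \<delta>" if "deg_over \<iota> b < degree \<phi>'" for b
    by (rule distance_le_of_trunc_eq[OF low that])
  obtain a where a: "v (\<theta> - a) = \<delta>" "deg_over \<iota> a = degree \<phi>" by (rule abstract_key_root[OF key])
  obtain \<delta>' where "abstract_key \<theta> \<phi>' \<delta>'" using abstract_keyI_trunc[OF \<phi>' le] by blast
  then have "next_key \<theta> (degree \<phi>) \<phi>'" using a le by (auto simp: next_key_def)
  moreover have "has_max (distances \<iota> v \<theta> (degree \<phi>))"
    unfolding has_max_def distances_def using a le deg by auto
  ultimately show ?thesis ..
qed

end

text \<open>One limit augmentation of a chain, once the values \<gamma> have been identified with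
  those of \<open>v\<^sub>\<theta>\<close>. The members of the family after the first are not
  assumed to be ball valuations, nor to lie below \<open>v\<^sub>\<theta>\<close>; such comparisons
  have to be derived.\<close>

locale limit_step = closure_valued \<iota> v
  for \<iota> :: "'k::field \<Rightarrow> 'l::alg_closed_field"
    and v :: "'l \<Rightarrow> 'g::linordered_ab_group_add with_infty" +
  fixes \<theta> :: 'l and \<phi> \<phi>' :: "'k poly" and \<delta> :: "'g with_infty"
    and I :: "'i set" and R :: "'i rel" and \<rho> :: "'i \<Rightarrow> 'k poly \<Rightarrow> 'g with_infty"
  assumes key: "abstract_key \<theta> \<phi> \<delta>"
    and deg: "degree \<phi> < degree \<phi>'"
    and family: "augmentation_family \<iota> v (trunc \<theta> \<delta>) (I, R, \<rho>)"
    and val_degree: "\<And>i. i \<in> I \<Longrightarrow> val_degree (\<rho> i) = degree \<phi>"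
    and limit_key: "limit_key_polynomial (I, R, \<rho>) \<phi>'"
    and less: "\<And>i. i \<in> I \<Longrightarrow> \<rho> i \<phi>' < val_at \<iota> v \<theta> \<phi>'"
    and stable_low: "\<And>f. degree f < degree \<phi>' \<Longrightarrow> stable_val (I, R, \<rho>) f = val_at \<iota> v \<theta> f"
begin

abbreviation "v\<theta> \<equiv> val_at \<iota> v \<theta>"

lemma linear: "linear_order_on I R"
  using family by simp

lemma index: "(i, j) \<in> R \<Longrightarrow> i \<in> I \<and> j \<in> I"
  using linear by (auto simp: order_on_defs)

lemma poly_valued_family: "i \<in> I \<Longrightarrow> poly_valued (\<rho> i)"
  using family by (simp add: extensions_def poly_valued_def valued_def)

definition first :: 'i where
  "first = (SOME i. i \<in> I \<and> (\<forall>j\<in>I. (i, j) \<in> R) \<and> \<rho> i = trunc \<theta> \<delta>)"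

lemma first: "first \<in> I" "j \<in> I \<Longrightarrow> (first, j) \<in> R" "\<rho> first = trunc \<theta> \<delta>"
proof -
  have "\<exists>i. i \<in> I \<and> (\<forall>j\<in>I. (i, j) \<in> R) \<and> \<rho> i = trunc \<theta> \<delta>" using family by auto
  from someI_ex[OF this, folded first_def]
  show "first \<in> I" "j \<in> I \<Longrightarrow> (first, j) \<in> R" "\<rho> first = trunc \<theta> \<delta>" by auto
qed

lemma above_first: "(i, j) \<in> R - Id \<Longrightarrow> (first, j) \<in> R - Id"
  using first(2) index[of i j] linear by (auto simp: order_on_defs antisym_def)

lemma above:
  assumes "i \<in> I" "j \<in> I"
  obtains k where "(i, k) \<in> R - Id" "(j, k) \<in> R - Id"
proof -
  have "\<exists>l\<in>I. (i, l) \<in> R \<and> (j, l) \<in> R"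
    using linear assms unfolding order_on_defs refl_on_def total_on_def by metis
  then obtain l where l: "l \<in> I" "(i, l) \<in> R" "(j, l) \<in> R" by blast
  then obtain k where k: "(l, k) \<in> R - Id" using family by auto
  have "trans R" "antisym R" using linear by (auto simp: order_on_defs)
  then have "(i, k) \<in> R - Id" "(j, k) \<in> R - Id"
    using l k by (auto dest: transD antisymD)
  then show thesis by (rule that)
qed

text \<open>The common degree of the \<chi> is squeezed. A \<chi> is a key polynomial of the first
  member, so its degree is at least \<open>degree \<phi>\<close>; and every key polynomial of a
  later member has at least the degree of the \<chi> that produced this member.\<close>

lemma augmentations:
  obtains \<chi> \<beta> where "\<And>i j. (i, j) \<in> R - Id \<Longrightarrow>
    ordinary_augmentation (\<rho> i) (\<chi> j) (Fin (\<beta> j)) (\<rho> j) \<and> degree (\<chi> j) = degree \<phi>"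
proof -
  obtain \<chi> \<beta> m where aug: "\<And>i j. (i, j) \<in> R - Id \<Longrightarrow>
    ordinary_augmentation (\<rho> i) (\<chi> j) (Fin (\<beta> j)) (\<rho> j) \<and> degree (\<chi> j) = m"
    using family by (simp del: split_paired_All) blast
  obtain j where j: "(first, j) \<in> R - Id" using above[OF first(1) first(1)] by blast
  then have in_I: "first \<in> I" "j \<in> I" using index[of first j] by auto
  obtain k where k: "(j, k) \<in> R - Id" using above[OF in_I(2) in_I(2)] by blast
  have "\<chi> j \<in> key_polynomials (\<rho> first)" "degree (\<chi> j) = m" "ordinary_augmentation (\<rho> first) (\<chi> j) (Fin (\<beta> j)) (\<rho> j)"
    using aug[OF j] by (auto simp: ordinary_augmentation_def)
  note \<chi>j = this
  have "val_degree (\<rho> first) \<le> m"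
    unfolding val_degree_def using \<chi>j by (intro Least_le) auto
  moreover have "m \<le> val_degree (\<rho> j)"
  proof -
    \<comment> \<open>A further member supplies a key polynomial of \<open>\<rho> j\<close>, so that
      \<open>val_degree (\<rho> j)\<close> is attained; \<open>LEAST\<close> over an empty set would
      say nothing.\<close>
    have "degree (\<chi> k) \<in> degree ` key_polynomials (\<rho> j)"
      using aug[OF k] unfolding ordinary_augmentation_def by blast
    from LeastI[of "\<lambda>d. d \<in> degree ` key_polynomials (\<rho> j)", OF this]
    obtain f where f: "f \<in> key_polynomials (\<rho> j)" "degree f = val_degree (\<rho> j)"
      unfolding val_degree_def[symmetric] by auto
    have "valuation (\<rho> first)" "valuation (\<rho> j)"
      using poly_valued_family in_I by (simp_all add: poly_valued_def valued_def)
    from key_polynomial_augmentation_degree[OF this \<chi>j(3) f(1)] show ?thesis using \<chi>j(2) f(2) by simp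
  qed
  ultimately have "m = degree \<phi>" using val_degree in_I by simp
  then show thesis using that aug by blast
qed

definition next_aug :: "('i \<Rightarrow> 'k poly) \<Rightarrow> ('i \<Rightarrow> 'g) \<Rightarrow> bool" where
  "next_aug \<chi> \<beta> \<longleftrightarrow> (\<forall>i j. (i, j) \<in> R - Id \<longrightarrow>
    ordinary_augmentation (\<rho> i) (\<chi> j) (Fin (\<beta> j)) (\<rho> j) \<and> degree (\<chi> j) = degree \<phi>)"

lemma eventually_val:
  assumes "degree f < degree \<phi>'"
  obtains i where "i \<in> I" "\<And>j. (i, j) \<in> R \<Longrightarrow> \<rho> j f = v\<theta> f"
proof -
  have "stable (I, R, \<rho>) f"
    using limit_key assms unfolding limit_key_polynomial_def by (meson linorder_not_le)
  then obtain c where c: "eventual_value (I, R, \<rho>) f c" by (auto simp: stable_def)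
  then have "c = v\<theta> f" using stable_val_eq[OF linear c] stable_low[OF assms] by simp
  then show thesis using c that index by auto
qed

context
  fixes \<chi> \<beta>
  assumes next_aug: "next_aug \<chi> \<beta>"
begin

lemma aug:
  assumes "(i, j) \<in> R - Id"
  shows "\<chi> j \<in> key_polynomials (\<rho> i)" "\<rho> i (\<chi> j) < Fin (\<beta> j)"
    "\<rho> j = expansion_val (\<rho> i) (\<chi> j) (Fin (\<beta> j))" "degree (\<chi> j) = degree \<phi>" "lead_coeff (\<chi> j) = 1"
proof -
  show 1: "\<chi> j \<in> key_polynomials (\<rho> i)" "\<rho> i (\<chi> j) < Fin (\<beta> j)"
    "\<rho> j = expansion_val (\<rho> i) (\<chi> j) (Fin (\<beta> j))" "degree (\<chi> j) = degree \<phi>"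
    using next_aug assms by (auto simp: next_aug_def ordinary_augmentation_def)
  interpret poly_valued "\<rho> i" using assms index by (intro poly_valued_family) auto
  show "lead_coeff (\<chi> j) = 1" by (rule key_polynomial_monic[OF 1(1)])
qed

lemma degree_pos: "degree \<phi> > 0"
  by (rule abstract_key_degree_pos[OF key])

lemma family_low:
  assumes "i \<in> I" "degree f < degree \<phi>"
  shows "\<rho> i f = v\<theta> f"
proof (cases "i = first")
  case False
  then have "(first, i) \<in> R - Id" using first(2) assms by auto
  note * = aug[OF this]
  interpret poly_valued "\<rho> first" by (rule poly_valued_family[OF first(1)])
  have "\<rho> i f = \<rho> first f" using * assms(2) by (simp add: expansion_val_small)
  then show ?thesis using trunc_eq_val_at_lower[OF key assms(2)] by (simp add: first(3))
qed (simp add: first(3) trunc_eq_val_at_lower[OF key assms(2)])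

lemma family_key:
  assumes "(i, j) \<in> R - Id" shows "\<rho> j (\<chi> j) = Fin (\<beta> j)"
proof -
  interpret poly_valued "\<rho> i" using assms index by (intro poly_valued_family) auto
  show ?thesis using aug[OF assms] degree_pos by (simp add: expansion_val_key)
qed

text \<open>Past some index, \<open>v\<theta> (\<chi> j)\<close> equals
  \<open>\<rho> k (\<chi> j)\<close>, the minimum of \<open>\<beta> k\<close> and the value of
  \<open>\<chi> j - \<chi> k\<close>. The latter is at least \<open>\<beta> j\<close> because
  \<open>\<chi> k\<close> is a key polynomial of \<open>\<rho> j\<close>; this gives
  \<open>\<rho> j (\<chi> k) = Fin (\<beta> j)\<close>, hence
  \<open>\<beta> j < \<beta> k\<close>.\<close>

lemma key_value_le:
  assumes j: "(i, j) \<in> R - Id" shows "Fin (\<beta> j) \<le> v\<theta> (\<chi> j)"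
proof -
  have "degree (\<chi> j) < degree \<phi>'" using aug(4)[OF j] deg by simp
  then obtain l where l: "l \<in> I" "\<And>k. (l, k) \<in> R \<Longrightarrow> \<rho> k (\<chi> j) = v\<theta> (\<chi> j)"
    using eventually_val by blast
  have "j \<in> I" using j index by blast
  with l(1) obtain k where k: "(l, k) \<in> R - Id" "(j, k) \<in> R - Id" by (rule above)
  interpret i: poly_valued "\<rho> i" using j index by (intro poly_valued_family) auto
  interpret j: poly_valued "\<rho> j" by (rule poly_valued_family[OF \<open>j \<in> I\<close>])
  note aj = aug[OF j] and ak = aug[OF k(2)]
  have eqs: "degree (\<chi> k) = degree (\<chi> j)" "degree (\<chi> j) = degree (\<chi> k)" "degree (\<chi> j) > 0" "degree (\<chi> k) > 0"
    "lead_coeff (\<chi> k) = lead_coeff (\<chi> j)" "lead_coeff (\<chi> j) = lead_coeff (\<chi> k)"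
    using aj(4,5) ak(4,5) degree_pos by simp_all
  have d: "degree (\<chi> k - \<chi> j) < degree \<phi>"
    using expansion_val_monic(1)[of "\<rho> i", OF i.val_0 i.val_1 eqs(1,3,5)] aj(4) by simp
  have j_eq: "\<rho> j (\<chi> k) = min (\<rho> i (\<chi> k - \<chi> j)) (Fin (\<beta> j))"
    unfolding aj(3) by (rule expansion_val_monic(2)[of "\<rho> i", OF i.val_0 i.val_1 eqs(1,3,5)])
  have k_eq: "\<rho> k (\<chi> j) = min (\<rho> j (\<chi> j - \<chi> k)) (Fin (\<beta> k))"
    unfolding ak(3) by (rule expansion_val_monic(2)[of "\<rho> j", OF j.val_0 j.val_1 eqs(2,4,6)])
  have same: "\<rho> i (\<chi> k - \<chi> j) = \<rho> j (\<chi> j - \<chi> k)"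
    unfolding j.val_diff_commute[of "\<chi> j"] using family_low d index j by auto
  have "Fin (\<beta> j) \<le> \<rho> j (\<chi> j - \<chi> k)"
  proof (cases "\<rho> j (\<chi> j - \<chi> k) = Infty")
    case False
    then have "\<rho> j (\<chi> k - \<chi> j) \<noteq> Infty" by (simp add: j.val_diff_commute)
    \<comment> \<open>The cofactor is 1 and \<open>f = \<chi> k - \<chi> j\<close>: what is left of
      \<open>\<chi> k\<close> is \<open>\<chi> j\<close>, of value \<open>\<beta> j\<close>.\<close>
    from j.key_polynomial_minimal[OF ak(1) this, of 1] show ?thesis
      using d ak(4) family_key[OF j] by (simp add: j.val_diff_commute)
  qed simp
  moreover from this have "Fin (\<beta> j) < Fin (\<beta> k)"
    using ak(2) j_eq same by (simp add: min_absorb2)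
  moreover have "v\<theta> (\<chi> j) = min (\<rho> j (\<chi> j - \<chi> k)) (Fin (\<beta> k))"
    using k_eq l(2)[of k] k(1) by simp
  ultimately show ?thesis by simp
qed

text \<open>The first member is itself a ball valuation, so
  \<open>\<rho> first (\<chi> j) < Fin (\<beta> j)\<close> and
  \<open>Fin (\<beta> j) \<le> v\<theta> (\<chi> j)\<close> give \<open>\<chi> j\<close> a root
  closer to \<theta> than \<delta>. Elements of smaller degree stay farther away than \<delta> by
  the key property of \<phi>.\<close>

lemma family_abstract_key:
  assumes j: "(i, j) \<in> R - Id"
  obtains \<epsilon> where "abstract_key \<theta> (\<chi> j) \<epsilon>" "\<delta> < \<epsilon>"
proof -
  note aj = aug[OF above_first[OF j]]
  have "trunc \<theta> \<delta> (\<chi> j) < v\<theta> (\<chi> j)"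
    using aj(2) key_value_le[OF j] by (simp add: first(3))
  from abstract_keyI_trunc[OF aj(5) this] abstract_key_less[OF key] show thesis
    using that aj(4) by (auto intro: less_imp_le)
qed

text \<open>Both sides are expansion valuations in \<open>\<chi> j\<close> with digits evaluated by
  \<open>v\<theta>\<close>; they differ in the value given to \<open>\<chi> j\<close>, and
  \<open>key_value_le\<close> compares it.\<close>

lemma family_le_trunc:
  assumes j: "(i, j) \<in> R - Id" and \<epsilon>: "abstract_key \<theta> (\<chi> j) \<epsilon>"
  shows "\<rho> j f \<le> trunc \<theta> \<epsilon> f"
proof -
  have "\<rho> j f = expansion_val (\<rho> i) (\<chi> j) (Fin (\<beta> j)) f" by (simp add: aug(3)[OF j])
  also have "expansion_val (\<rho> i) (\<chi> j) (Fin (\<beta> j)) = expansion_val v\<theta> (\<chi> j) (Fin (\<beta> j))"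
    using aug(4)[OF j] degree_pos family_low index j by (intro expansion_val_cong) auto
  also have "\<dots> f \<le> expansion_val v\<theta> (\<chi> j) (v\<theta> (\<chi> j)) f"
    by (rule expansion_val_mono[OF key_value_le[OF j]])
  also have "\<dots> = trunc \<theta> \<epsilon> f" by (simp add: trunc_eq_expansion_val[OF \<epsilon>])
  finally show ?thesis .
qed

text \<open>On the minimal polynomial of \<open>b\<close> the family eventually reaches
  \<open>v\<theta>\<close>. A ball valuation lies in between and so equals \<open>v\<theta>\<close>
  there, which excludes roots closer than its radius.\<close>

lemma distance_bound:
  assumes "deg_over \<iota> b < degree \<phi>'"
  obtains j \<epsilon> where "(first, j) \<in> R - Id" "abstract_key \<theta> (\<chi> j) \<epsilon>" "\<delta> < \<epsilon>" "v (\<theta> - b) \<le> \<epsilon>"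
proof -
  let ?f = "min_poly \<iota> b"
  obtain i where i: "i \<in> I" "\<And>j. (i, j) \<in> R \<Longrightarrow> \<rho> j ?f = v\<theta> ?f"
    using eventually_val assms by (metis degree_min_poly)
  obtain j where j: "(i, j) \<in> R - Id" "(first, j) \<in> R - Id" using above[OF i(1) first(1)] by blast
  obtain \<epsilon> where \<epsilon>: "abstract_key \<theta> (\<chi> j) \<epsilon>" "\<delta> < \<epsilon>" by (rule family_abstract_key[OF j(1)])
  have "v\<theta> ?f \<le> trunc \<theta> \<epsilon> ?f" using family_le_trunc[OF j(1) \<epsilon>(1), of ?f] i(2)[of j] j(1) by auto
  then have "trunc \<theta> \<epsilon> ?f = v\<theta> ?f" using trunc_le_val_at by (intro antisym)
  then have "v (\<theta> - b) \<le> \<epsilon>" by (rule root_le_of_trunc_eq[OF _ min_poly_nonzero min_poly_root])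
  then show thesis using that j(2) \<epsilon> by blast
qed

text \<open>Suppose \<open>b\<close> attains the maximum. Its minimal polynomial \<open>Q\<close> is
  then an abstract key, and no root of any \<open>\<chi> k\<close> is closer than its radius, so
  \<open>v\<theta> (\<chi> k)\<close> is the minimum of the values of \<open>\<chi> k - Q\<close>
  and \<open>Q\<close>. Once \<open>\<rho> i Q\<close> has become stable, \<open>\<rho> i\<close>
  has the same two values, and \<open>\<rho> i (\<chi> k)\<close> would reach
  \<open>\<beta> k\<close>, which an augmentation forbids.\<close>

lemma no_max_distance: "\<not> has_max (distances \<iota> v \<theta> (degree \<phi>))"
proof
  assume "has_max (distances \<iota> v \<theta> (degree \<phi>))"
  then obtain b where b: "deg_over \<iota> b = degree \<phi>"
    "\<And>b'. deg_over \<iota> b' = degree \<phi> \<Longrightarrow> v (\<theta> - b') \<le> v (\<theta> - b)"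
    by (auto simp: has_max_def distances_def)
  define \<Delta> where "\<Delta> = v (\<theta> - b)"
  define Q where "Q = min_poly \<iota> b"
  have Q: "degree Q = degree \<phi>" "lead_coeff Q = 1" "Q \<noteq> 0"
    unfolding Q_def degree_min_poly by (rule b(1) min_poly_monic[unfolded degree_min_poly] min_poly_nonzero)+
  have \<epsilon>_le: "\<epsilon> \<le> \<Delta>" if ij: "(i, j) \<in> R - Id" and \<epsilon>: "abstract_key \<theta> (\<chi> j) \<epsilon>" for i j \<epsilon>
  proof -
    obtain a where "v (\<theta> - a) = \<epsilon>" "deg_over \<iota> a = degree (\<chi> j)"
      by (rule abstract_key_root[OF \<epsilon>])
    then show ?thesis using b(2)[of a] aug(4)[OF ij] by (simp add: \<Delta>_def)
  qed
  obtain j0 where j0: "(first, j0) \<in> R - Id" using above[OF first(1) first(1)] by blast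
  then have "\<delta> < \<Delta>" using \<epsilon>_le family_abstract_key less_le_trans by metis
  have root_le: "v (\<theta> - z) \<le> \<Delta>" if "poly (lift Q) z = 0" for z
  proof (cases "deg_over \<iota> z = degree \<phi>")
    case False
    then have "deg_over \<iota> z < degree \<phi>" using deg_over_le[OF Q(3) that] Q(1) by simp
    from abstract_key_less[OF key this] show ?thesis using \<open>\<delta> < \<Delta>\<close> by simp
  qed (use b(2) \<Delta>_def in simp)
  have Q_key: "abstract_key \<theta> Q \<Delta>"
    unfolding abstract_key_def
    using Q root_le abstract_key_less[OF key] \<open>\<delta> < \<Delta>\<close> min_poly_root[of b]
    by (auto simp: Q_def \<Delta>_def intro: less_trans)
  have "degree Q < degree \<phi>'" using Q(1) deg by simp
  then obtain i where i: "i \<in> I" "\<And>j. (i, j) \<in> R \<Longrightarrow> \<rho> j Q = v\<theta> Q"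
    using eventually_val by blast
  then have iQ: "\<rho> i Q = v\<theta> Q"
    using linear by (auto simp: order_on_defs refl_on_def)
  obtain k where k: "(i, k) \<in> R - Id" using above[OF i(1) i(1)] by blast
  note ak = aug[OF k]
  obtain \<epsilon> where \<epsilon>: "abstract_key \<theta> (\<chi> k) \<epsilon>" by (rule family_abstract_key[OF k])
  have dQ: "degree (\<chi> k - Q) < degree \<phi>"
    using expansion_val_monic(1)[of v\<theta> "\<chi> k" Q] ak Q degree_pos
      valued.val_0[of v\<theta>] valued.val_1[of v\<theta>] poly_valued_val_at[of \<theta>]
    by (simp add: poly_valued_def)
  have "v\<theta> (\<chi> k) = trunc \<theta> \<Delta> (\<chi> k)"
    using abstract_key_root_le[OF \<epsilon>] \<epsilon>_le[OF k \<epsilon>]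
    by (intro trunc_eq_val_at[symmetric]) (blast intro: order_trans)
  also have "\<dots> = expansion_val v\<theta> Q (v\<theta> Q) (\<chi> k)"
    by (simp add: trunc_eq_expansion_val[OF Q_key])
  also have "\<dots> = min (v\<theta> (\<chi> k - Q)) (v\<theta> Q)"
    using ak Q degree_pos valued.val_0[of v\<theta>] valued.val_1[of v\<theta>] poly_valued_val_at[of \<theta>]
    by (intro expansion_val_monic(2)) (auto simp: poly_valued_def)
  finally have \<chi>k: "v\<theta> (\<chi> k) = min (v\<theta> (\<chi> k - Q)) (v\<theta> Q)" .
  interpret \<rho>i: poly_valued "\<rho> i" by (rule poly_valued_family[OF i(1)])
  have "Fin (\<beta> k) \<le> v\<theta> (\<chi> k - Q)" "Fin (\<beta> k) \<le> v\<theta> Q"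
    using key_value_le[OF k] \<chi>k by simp_all
  moreover have "\<rho> i (\<chi> k - Q) = v\<theta> (\<chi> k - Q)" using family_low[OF i(1) dQ] .
  ultimately have "Fin (\<beta> k) \<le> \<rho> i (\<chi> k - Q + Q)" using iQ by (intro \<rho>i.val_add_ge) simp_all
  then show False using ak(2) by simp
qed

text \<open>Were the closest root of \<phi>' at distance at most \<epsilon>, the ball valuation
  would equal \<open>v\<theta>\<close> at \<phi>'. But it is computed by a
  \<open>\<chi> j\<close>-expansion, which is at most \<open>\<rho> l \<phi>'\<close> as soon as
  \<open>\<rho> l\<close> has the value of \<open>v\<theta>\<close> at \<open>\<chi> j\<close>, and
  this is too small by \<open>less\<close>.\<close>

lemma limit_key_root:
  obtains z where "poly (lift \<phi>') z = 0"
    "\<And>i j \<epsilon>. (i, j) \<in> R - Id \<Longrightarrow> abstract_key \<theta> (\<chi> j) \<epsilon> \<Longrightarrow> \<epsilon> < v (\<theta> - z)"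
proof -
  have "\<phi>' \<noteq> 0" using limit_key by (auto simp: limit_key_polynomial_def)
  have "degree \<phi>' > 0" using deg by simp
  then obtain z where "poly (lift \<phi>') z = 0" by (rule ex_root)
  then obtain a where a: "poly (lift \<phi>') a = 0" "\<And>z. poly (lift \<phi>') z = 0 \<Longrightarrow> v (\<theta> - z) \<le> v (\<theta> - a)"
    using ex_closest_root[OF \<open>\<phi>' \<noteq> 0\<close>] by metis
  have "\<epsilon> < v (\<theta> - a)" if ij: "(i, j) \<in> R - Id" and \<epsilon>: "abstract_key \<theta> (\<chi> j) \<epsilon>" for i j \<epsilon>
  proof (rule ccontr)
    assume "\<not> ?thesis"
    then have eq: "trunc \<theta> \<epsilon> \<phi>' = v\<theta> \<phi>'"
      using a(2) by (intro trunc_eq_val_at) (meson linorder_not_le order_trans)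
    have "degree (\<chi> j) < degree \<phi>'" using aug(4)[OF ij] deg by simp
    then obtain l where l: "l \<in> I" "\<And>k. (l, k) \<in> R \<Longrightarrow> \<rho> k (\<chi> j) = v\<theta> (\<chi> j)"
      using eventually_val by blast
    then have "\<rho> l (\<chi> j) = v\<theta> (\<chi> j)"
      using linear by (auto simp: order_on_defs refl_on_def)
    interpret poly_valued "\<rho> l" by (rule poly_valued_family[OF l(1)])
    have "v\<theta> \<phi>' = expansion_val v\<theta> (\<chi> j) (v\<theta> (\<chi> j)) \<phi>'"
      unfolding eq[symmetric] by (simp add: trunc_eq_expansion_val[OF \<epsilon>])
    also have "expansion_val v\<theta> (\<chi> j) (v\<theta> (\<chi> j)) = expansion_val (\<rho> l) (\<chi> j) (v\<theta> (\<chi> j))"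
      using aug(4)[OF ij] degree_pos family_low[OF l(1)] by (intro expansion_val_cong) auto
    also have "v\<theta> (\<chi> j) = \<rho> l (\<chi> j)" using \<open>\<rho> l (\<chi> j) = v\<theta> (\<chi> j)\<close> by simp
    also have "expansion_val (\<rho> l) (\<chi> j) (\<rho> l (\<chi> j)) \<phi>' \<le> \<rho> l \<phi>'"
      using aug(4)[OF ij] degree_pos by (intro expansion_val_le) simp
    finally show False using less[OF l(1)] by simp
  qed
  then show thesis using that a(1) by blast
qed

end

lemma next_key_limit:
  "next_key \<theta> (degree \<phi>) \<phi>' \<and> \<not> has_max (distances \<iota> v \<theta> (degree \<phi>))"
proof -
  obtain \<chi> \<beta> where aug': "next_aug \<chi> \<beta>"
    using augmentations unfolding next_aug_def by metis
  obtain z where z: "poly (lift \<phi>') z = 0"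
    "\<And>i j \<epsilon>. (i, j) \<in> R - Id \<Longrightarrow> abstract_key \<theta> (\<chi> j) \<epsilon> \<Longrightarrow> \<epsilon> < v (\<theta> - z)"
    by (rule limit_key_root[OF aug']) blast
  have monic: "lead_coeff \<phi>' = 1" using limit_key by (simp add: limit_key_polynomial_def)
  have lt: "v (\<theta> - b) < v (\<theta> - z)" if "deg_over \<iota> b < degree \<phi>'" for b
    by (rule distance_bound[OF aug' that]) (use z(2) in force)
  have "\<phi>' \<noteq> 0" using monic by auto
  then obtain a where a: "poly (lift \<phi>') a = 0" "\<And>z. poly (lift \<phi>') z = 0 \<Longrightarrow> v (\<theta> - z) \<le> v (\<theta> - a)"
    using ex_closest_root[OF _ z(1)] by metis
  have "abstract_key \<theta> \<phi>' (v (\<theta> - a))"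
    unfolding abstract_key_def using monic a lt z(1) less_le_trans by blast
  moreover have "\<exists>b'. deg_over \<iota> b' = degree \<phi> \<and> v (\<theta> - b) \<le> v (\<theta> - b')"
    if b: "deg_over \<iota> b < degree \<phi>'" for b
  proof -
    obtain j \<epsilon> where j: "(first, j) \<in> R - Id" "abstract_key \<theta> (\<chi> j) \<epsilon>" "v (\<theta> - b) \<le> \<epsilon>"
      by (rule distance_bound[OF aug' b]) blast
    obtain b' where "v (\<theta> - b') = \<epsilon>" "deg_over \<iota> b' = degree (\<chi> j)"
      by (rule abstract_key_root[OF j(2)])
    then show ?thesis using j(3) aug(4)[OF aug' j(1)] by auto
  qed
  ultimately show ?thesis using no_max_distance[OF aug'] by (auto simp: next_key_def)
qed

end

context closure_valued
begin

text \<open>Every \<chi> is a key polynomial of the first member and so has at least the degree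
  \<open>d\<close> of that valuation; in smaller degrees the family is constant.\<close>

lemma augmentation_family_low:
  assumes fam: "augmentation_family \<iota> v \<mu> (I, R, \<rho>)"
    and deg: "\<And>i. i \<in> I \<Longrightarrow> val_degree (\<rho> i) = d" "degree f < d"
  shows "stable_val (I, R, \<rho>) f = \<mu> f"
proof -
  obtain i0 where i0: "i0 \<in> I" "\<And>i. i \<in> I \<Longrightarrow> (i0, i) \<in> R" "\<rho> i0 = \<mu>" using fam by auto
  obtain \<chi> \<beta> m where aug: "\<And>i j. (i, j) \<in> R - Id \<Longrightarrow>
    ordinary_augmentation (\<rho> i) (\<chi> j) (Fin (\<beta> j)) (\<rho> j) \<and> degree (\<chi> j) = m"
    using fam by (simp del: split_paired_All) blast
  have \<mu>: "\<mu> 0 = Infty" using fam i0 by (auto simp: extensions_def valuation_def)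
  have "\<rho> j f = \<mu> f" if "j \<in> I" for j
  proof (cases "j = i0")
    case False
    then have "(i0, j) \<in> R - Id" using i0(2) that by auto
    from aug[OF this] have *: "\<chi> j \<in> key_polynomials \<mu>" "\<rho> j = expansion_val \<mu> (\<chi> j) (Fin (\<beta> j))"
      by (simp_all add: ordinary_augmentation_def i0(3))
    have "val_degree \<mu> \<le> degree (\<chi> j)"
      unfolding val_degree_def using *(1) by (intro Least_le) auto
    moreover have "val_degree \<mu> = d" using deg(1)[OF i0(1)] i0(3) by simp
    ultimately show ?thesis using *(2) deg(2) \<mu> by (simp add: expansion_val_small)
  qed (simp add: i0(3))
  then have "eventual_value (I, R, \<rho>) f (\<mu> f)" using i0(1) by auto
  then show ?thesis using fam by (intro stable_val_eq) auto
qed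

text \<open>These are the two values that the evaluation of expansions requires of its coefficient
  function.\<close>

lemma augmentation_family_stable_01:
  assumes fam: "augmentation_family \<iota> v \<mu> (I, R, \<rho>)"
  shows "stable_val (I, R, \<rho>) 0 = Infty" "stable_val (I, R, \<rho>) 1 = 0"
proof -
  have "valuation (\<rho> i)" if "i \<in> I" for i using that fam by (simp add: extensions_def)
  moreover obtain i where "i \<in> I" using fam by auto
  ultimately have "eventual_value (I, R, \<rho>) 0 Infty" "eventual_value (I, R, \<rho>) 1 0"
    by (auto simp: valuation_def)
  moreover have "linear_order_on I R" using fam by simp
  ultimately show "stable_val (I, R, \<rho>) 0 = Infty" "stable_val (I, R, \<rho>) 1 = 0"
    by (blast intro: stable_val_eq)+
qed

end

section \<open>Mac Lane--Vaquie chains: values and key polynomials\<close>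

locale mlv = closure_valued \<iota> v
  for \<iota> :: "'k::field \<Rightarrow> 'l::alg_closed_field"
    and v :: "'l \<Rightarrow> 'g::linordered_ab_group_add with_infty" +
  fixes \<theta> :: 'l and N :: nat and \<phi> :: "nat \<Rightarrow> 'k poly" and \<gamma> :: "nat \<Rightarrow> 'g with_infty"
    and \<mu> :: "nat \<Rightarrow> 'k poly \<Rightarrow> 'g with_infty" and s :: "nat \<Rightarrow> ('i, 'k, 'g) family augmentation"
  assumes chain: "mlv_chain \<iota> v \<theta> N \<phi> \<gamma> \<mu> s"
begin

abbreviation "v\<theta> \<equiv> val_at \<iota> v \<theta>"

lemma start: "lead_coeff (\<phi> 0) = 1" "degree (\<phi> 0) = 1"
    "\<mu> 0 = expansion_val (\<lambda>a. v (\<iota> (coeff a 0))) (\<phi> 0) (\<gamma> 0)"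
  and final: "\<mu> N = v\<theta>" "\<gamma> N = Infty" "\<phi> N = min_poly \<iota> \<theta>"
  and degree_less: "n < N \<Longrightarrow> degree (\<phi> n) < degree (\<phi> (Suc n))"
  using chain by (auto simp: mlv_chain_def)

lemma Ordinary_step:
  assumes "n < N" "s n = Ordinary"
  shows "ordinary_augmentation (\<mu> n) (\<phi> (Suc n)) (\<gamma> (Suc n)) (\<mu> (Suc n))"
proof -
  have "case s n of Ordinary \<Rightarrow> ordinary_augmentation (\<mu> n) (\<phi> (Suc n)) (\<gamma> (Suc n)) (\<mu> (Suc n))
      | Limit A \<Rightarrow> limit_augmentation \<iota> v (\<mu> n) A (\<phi> (Suc n)) (\<gamma> (Suc n)) (\<mu> (Suc n)) \<and>
          val_at \<iota> v \<theta> (\<phi> n) = \<gamma> n \<and>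
          (case A of (I, R, \<rho>) \<Rightarrow> \<forall>i\<in>I. val_degree (\<rho> i) = degree (\<phi> n))"
    using chain assms(1) unfolding mlv_chain_def by blast
  then show ?thesis using assms(2) by simp
qed

lemma Limit_step:
  assumes "n < N" "s n = Limit (I, R, \<rho>)"
  shows "augmentation_family \<iota> v (\<mu> n) (I, R, \<rho>)" "limit_key_polynomial (I, R, \<rho>) (\<phi> (Suc n))"
    "\<And>i. i \<in> I \<Longrightarrow> \<rho> i (\<phi> (Suc n)) < \<gamma> (Suc n)"
    "\<mu> (Suc n) = expansion_val (stable_val (I, R, \<rho>)) (\<phi> (Suc n)) (\<gamma> (Suc n))"
    "v\<theta> (\<phi> n) = \<gamma> n" "\<And>i. i \<in> I \<Longrightarrow> val_degree (\<rho> i) = degree (\<phi> n)"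
proof -
  have "case s n of Ordinary \<Rightarrow> ordinary_augmentation (\<mu> n) (\<phi> (Suc n)) (\<gamma> (Suc n)) (\<mu> (Suc n))
      | Limit A \<Rightarrow> limit_augmentation \<iota> v (\<mu> n) A (\<phi> (Suc n)) (\<gamma> (Suc n)) (\<mu> (Suc n)) \<and>
          val_at \<iota> v \<theta> (\<phi> n) = \<gamma> n \<and>
          (case A of (I, R, \<rho>) \<Rightarrow> \<forall>i\<in>I. val_degree (\<rho> i) = degree (\<phi> n))"
    using chain assms(1) unfolding mlv_chain_def by blast
  then have *: "limit_augmentation \<iota> v (\<mu> n) (I, R, \<rho>) (\<phi> (Suc n)) (\<gamma> (Suc n)) (\<mu> (Suc n)) \<and>
      v\<theta> (\<phi> n) = \<gamma> n \<and> (\<forall>i\<in>I. val_degree (\<rho> i) = degree (\<phi> n))"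
    using assms(2) by simp
  then show "v\<theta> (\<phi> n) = \<gamma> n" "\<And>i. i \<in> I \<Longrightarrow> val_degree (\<rho> i) = degree (\<phi> n)" by blast+
  show "augmentation_family \<iota> v (\<mu> n) (I, R, \<rho>)" "limit_key_polynomial (I, R, \<rho>) (\<phi> (Suc n))"
    "\<And>i. i \<in> I \<Longrightarrow> \<rho> i (\<phi> (Suc n)) < \<gamma> (Suc n)"
    "\<mu> (Suc n) = expansion_val (stable_val (I, R, \<rho>)) (\<phi> (Suc n)) (\<gamma> (Suc n))"
    using * unfolding limit_augmentation.simps by blast+
qed

lemma step_cases:
  obtains "s n = Ordinary" | I R \<rho> where "s n = Limit (I, R, \<rho>)"
  by (cases "s n") (auto elim: prod_cases3)

text \<open>
  The function of which \<open>\<mu>\<^sub>n\<close> is an augmentation.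
\<close>

definition base :: "nat \<Rightarrow> 'k poly \<Rightarrow> 'g with_infty" where
  "base n = (case n of 0 \<Rightarrow> (\<lambda>a. v (\<iota> (coeff a 0)))
     | Suc k \<Rightarrow> (case s k of Ordinary \<Rightarrow> \<mu> k | Limit A \<Rightarrow> stable_val A))"

lemma base_Suc: "s n = Ordinary \<Longrightarrow> base (Suc n) = \<mu> n"
  "s n = Limit A \<Longrightarrow> base (Suc n) = stable_val A"
  by (simp_all add: base_def)

lemma chain_monic: "n \<le> N \<Longrightarrow> lead_coeff (\<phi> n) = 1"
proof (cases n)
  case (Suc k)
  assume "n \<le> N"
  then have k: "k < N" using Suc by simp
  show ?thesis
  proof (cases rule: step_cases[of k])
    case 1
    then show ?thesis
      using Ordinary_step[OF k] Suc by (simp add: ordinary_augmentation_def key_polynomials_def)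
  next
    case (2 I R \<rho>)
    then show ?thesis using Limit_step(2)[OF k 2] Suc by (simp add: limit_key_polynomial_def)
  qed
qed (use start in simp)

lemma chain_degree_pos: "n \<le> N \<Longrightarrow> degree (\<phi> n) > 0"
  using start(2) degree_less[of "n - 1"] by (cases n) auto

lemma chain_eq: "n \<le> N \<Longrightarrow> \<mu> n = expansion_val (base n) (\<phi> n) (\<gamma> n)"
proof (cases n)
  case 0
  then show ?thesis using start(3) by (simp add: base_def)
next
  case (Suc k)
  assume "n \<le> N"
  then have k: "k < N" using Suc by simp
  show ?thesis
  proof (cases rule: step_cases[of k])
    case 1
    then show ?thesis
      using Ordinary_step[OF k] Suc base_Suc(1) by (simp add: ordinary_augmentation_def)
  next
    case (2 I R \<rho>)
    then show ?thesis using Limit_step(4)[OF k 2] Suc base_Suc(2) by simp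
  qed
qed

lemma base_01: "n \<le> N \<Longrightarrow> base n 0 = Infty \<and> base n 1 = 0"
proof (induction n)
  case 0
  then show ?case by (simp add: base_def embed_1)
next
  case (Suc k)
  then have k: "k < N" "k \<le> N" by simp_all
  show ?case
  proof (cases rule: step_cases[of k])
    case 1
    have "\<mu> k 0 = Infty" "\<mu> k 1 = 0"
      unfolding chain_eq[OF k(2)] using Suc.IH[OF k(2)] chain_degree_pos[OF k(2)]
      by (simp_all add: expansion_val_small)
    then show ?thesis by (simp add: base_Suc(1)[OF 1])
  next
    case (2 I R \<rho>)
    then show ?thesis
      using augmentation_family_stable_01[OF Limit_step(1)[OF k(1) 2]] by (simp add: base_Suc(2))
  qed
qed

lemma chain_low: "n \<le> N \<Longrightarrow> degree f < degree (\<phi> n) \<Longrightarrow> \<mu> n f = base n f"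
  using chain_eq base_01 by (simp add: expansion_val_small)

text \<open>Downward induction: \<open>\<mu> N = v\<theta>\<close> gives the claim at the end. A
  step back is possible because the degrees grow and because in a limit step the stable values agree
  with \<open>\<mu> n\<close> below the degree of \<open>\<phi> n\<close>.\<close>

lemma base_low: "n \<le> N \<Longrightarrow> degree f < degree (\<phi> n) \<Longrightarrow> base n f = v\<theta> f"
proof (induction n rule: inc_induct)
  case base
  then show ?case using chain_low[of N f] final(1) by simp
next
  case (step n)
  have "base (Suc n) f = v\<theta> f" using step degree_less[of n] by simp
  moreover have "base (Suc n) f = \<mu> n f"
  proof (cases rule: step_cases[of n])
    case (2 I R \<rho>)
    then show ?thesis
      using augmentation_family_low[OF Limit_step(1,6)[OF step.hyps(2) 2] step.prems] by (simp add: base_Suc(2))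
  qed (simp add: base_Suc)
  ultimately show ?case using chain_low[of n f] step by simp
qed

text \<open>Before an ordinary step, \<open>\<phi> n\<close> has smaller degree than
  \<open>\<phi> (Suc n)\<close>, so \<open>\<mu> n\<close> and \<open>v\<theta>\<close> agree on it.
  Before a limit step the equality is part of the definition of a chain, and at the end both sides
  are infinite.\<close>

lemma chain_key_value: "n \<le> N \<Longrightarrow> \<gamma> n = v\<theta> (\<phi> n)"
proof (cases "n = N")
  case True
  then show ?thesis using final min_poly_root[of \<theta>] by (simp add: val_at_def)
next
  case False
  assume "n \<le> N"
  with False have n: "n < N" by simp
  show ?thesis
  proof (cases rule: step_cases[of n])
    case 1
    have "v\<theta> (\<phi> n) = \<mu> n (\<phi> n)"
      using base_low[of "Suc n" "\<phi> n"] degree_less n 1 by (simp add: base_Suc)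
    also have "\<dots> = \<gamma> n"
      using chain_eq[of n] base_01[of n] chain_degree_pos[of n] n by (simp add: expansion_val_key)
    finally show ?thesis by simp
  next
    case (2 I R \<rho>)
    then show ?thesis using Limit_step(5)[OF n 2] by simp
  qed
qed

lemma chain_eq_trunc:
  assumes "n \<le> N" "abstract_key \<theta> (\<phi> n) \<delta>" shows "\<mu> n = trunc \<theta> \<delta>"
  unfolding chain_eq[OF assms(1)] chain_key_value[OF assms(1)] trunc_eq_expansion_val[OF assms(2)]
  by (intro expansion_val_cong chain_degree_pos base_low assms)

lemma chain_step:
  assumes n: "n < N" and key: "abstract_key \<theta> (\<phi> n) \<delta>"
  shows "next_key \<theta> (degree (\<phi> n)) (\<phi> (Suc n)) \<and>
    (s n = Ordinary \<longleftrightarrow> has_max (distances \<iota> v \<theta> (degree (\<phi> n))))"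
proof (cases rule: step_cases[of n])
  case 1
  have \<mu>: "\<mu> n = trunc \<theta> \<delta>" using chain_eq_trunc key n by simp
  have "trunc \<theta> \<delta> (\<phi> (Suc n)) < v\<theta> (\<phi> (Suc n))"
    using Ordinary_step[OF n 1] chain_key_value[of "Suc n"] n
    by (simp add: ordinary_augmentation_def \<mu>)
  moreover have "trunc \<theta> \<delta> f = v\<theta> f" if "degree f < degree (\<phi> (Suc n))" for f
    using base_low[of "Suc n" f] n that 1 by (simp add: base_Suc \<mu>)
  ultimately show ?thesis
    using ordinary_step[OF key degree_less[OF n] chain_monic] n 1 by simp
next
  case (2 I R \<rho>)
  note L = Limit_step[OF n 2]
  have \<mu>: "\<mu> n = trunc \<theta> \<delta>" using chain_eq_trunc key n by simp
  have "limit_step \<iota> v \<theta> (\<phi> n) (\<phi> (Suc n)) \<delta> I R \<rho>"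
  proof (intro limit_step.intro limit_step_axioms.intro closure_valued_axioms)
    show "augmentation_family \<iota> v (trunc \<theta> \<delta>) (I, R, \<rho>)" using L(1) \<mu> by simp
    show "\<rho> i (\<phi> (Suc n)) < v\<theta> (\<phi> (Suc n))" if "i \<in> I" for i
      using L(3)[OF that] chain_key_value[of "Suc n"] n by simp
    show "stable_val (I, R, \<rho>) f = v\<theta> f" if "degree f < degree (\<phi> (Suc n))" for f
      using base_low[of "Suc n" f] n that 2 by (simp add: base_Suc)
  qed (use key degree_less[OF n] L in auto)
  from limit_step.next_key_limit[OF this] show ?thesis using 2 by simp
qed

lemma chain_abstract_key: "n \<le> N \<Longrightarrow> \<exists>\<delta>. abstract_key \<theta> (\<phi> n) \<delta>"
proof (induction n)
  case 0
  have "degree (\<phi> 0) > 0" using start(2) by simp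
  then obtain z where "poly (lift (\<phi> 0)) z = 0" by (rule ex_root)
  moreover have "\<phi> 0 \<noteq> 0" using start(1) by auto
  ultimately obtain a where a: "poly (lift (\<phi> 0)) a = 0"
    "\<And>z. poly (lift (\<phi> 0)) z = 0 \<Longrightarrow> v (\<theta> - z) \<le> v (\<theta> - a)"
    using ex_closest_root by metis
  \<comment> \<open>No element has degree 0, so the condition on elements of smaller degree is
    vacuous for a linear polynomial.\<close>
  have "\<not> deg_over \<iota> b < degree (\<phi> 0)" for b using deg_over_pos[of b] start(2) by simp
  then show ?case using a start(1) by (auto simp: abstract_key_def)
next
  case (Suc n)
  then show ?case using chain_step by (auto simp: next_key_def)
qed

end

section \<open>Construction of a chain from balls around \<theta>\<close>

context closure_valued
begin

text \<open>A conjugate of \<open>a\<close> may be closer to \<theta> than \<open>a\<close> itself,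
  which is why \<delta> is only bounded below.\<close>

lemma abstract_key_min_poly:
  assumes "\<And>b. deg_over \<iota> b < deg_over \<iota> a \<Longrightarrow> v (\<theta> - b) < v (\<theta> - a)"
  obtains \<delta> where "abstract_key \<theta> (min_poly \<iota> a) \<delta>" "v (\<theta> - a) \<le> \<delta>"
proof -
  obtain c where c: "poly (lift (min_poly \<iota> a)) c = 0"
    "\<And>z. poly (lift (min_poly \<iota> a)) z = 0 \<Longrightarrow> v (\<theta> - z) \<le> v (\<theta> - c)"
    using ex_closest_root[OF min_poly_nonzero min_poly_root] by metis
  have le: "v (\<theta> - a) \<le> v (\<theta> - c)" by (rule c(2)[OF min_poly_root])
  then have "abstract_key \<theta> (min_poly \<iota> a) (v (\<theta> - c))"
    unfolding abstract_key_def using c min_poly_monic assms less_le_trans by (metis degree_min_poly)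
  then show thesis using le by (rule that)
qed

text \<open>The family consists of ball valuations whose radii come from abstract keys of the degree
  of \<phi>, indexed by themselves in their pointwise order. By \<open>no_max\<close> there is no
  last radius. By \<open>cofinal\<close> a polynomial of degree below \<open>degree \<phi>'\<close>
  has no root closer than some radius, hence is stable; \<phi>' has a root inside all the balls,
  hence is not.\<close>

lemma limit_augmentation_exists:
  assumes key: "abstract_key \<theta> \<phi> \<delta>" and key': "abstract_key \<theta> \<phi>' \<delta>'" and deg: "degree \<phi> < degree \<phi>'"
    and no_max: "\<not> has_max (distances \<iota> v \<theta> (degree \<phi>))"
    and cofinal: "\<And>b. deg_over \<iota> b < degree \<phi>' \<Longrightarrow>
      \<exists>b'. deg_over \<iota> b' = degree \<phi> \<and> v (\<theta> - b) \<le> v (\<theta> - b')"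
  shows "\<exists>A :: ('k poly \<Rightarrow> 'g with_infty, 'k, 'g) family.
    limit_augmentation \<iota> v (trunc \<theta> \<delta>) A \<phi>' (val_at \<iota> v \<theta> \<phi>') (trunc \<theta> \<delta>') \<and>
    (case A of (I, R, \<rho>) \<Rightarrow> \<forall>i\<in>I. val_degree (\<rho> i) = degree \<phi>)"
proof -
  \<comment> \<open>The bound \<open>\<delta> \<le> \<epsilon>\<close> makes
    \<open>trunc \<theta> \<delta>\<close> the first member.\<close>
  define D where "D = {\<epsilon>. \<delta> \<le> \<epsilon> \<and> (\<exists>Q. abstract_key \<theta> Q \<epsilon> \<and> degree Q = degree \<phi>)}"
  define I where "I = trunc \<theta> ` D"
  define R where "R = {(x, y). x \<in> I \<and> y \<in> I \<and> x \<le> y}"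
  have \<delta>: "\<delta> \<in> D" using key by (auto simp: D_def)
  obtain a' where a': "poly (lift \<phi>') a' = 0" "v (\<theta> - a') = \<delta>'" by (rule abstract_key_root[OF key'])
  have \<phi>': "\<phi>' \<noteq> 0" by (rule abstract_key_nonzero[OF key'])
  have D_less: "\<epsilon> < \<delta>'" if \<epsilon>: "\<epsilon> \<in> D" for \<epsilon>
  proof -
    obtain Q where Q: "abstract_key \<theta> Q \<epsilon>" "degree Q = degree \<phi>" using \<epsilon> by (auto simp: D_def)
    obtain a where "v (\<theta> - a) = \<epsilon>" "deg_over \<iota> a = degree Q" by (rule abstract_key_root[OF Q(1)])
    then show ?thesis using abstract_key_less[OF key', of a] Q(2) deg by simp
  qed
  have D_finite: "\<epsilon> \<noteq> Infty" if "\<epsilon> \<in> D" for \<epsilon>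
    using D_less[OF that] by auto
  have lower: "v (\<theta> - b) < \<epsilon>" if "deg_over \<iota> b < degree \<phi>" "\<epsilon> \<in> D" for b \<epsilon>
    using abstract_key_less[OF key that(1)] that(2) by (auto simp: D_def)
  have min_poly_D: "\<exists>\<epsilon>\<in>D. v (\<theta> - b) \<le> \<epsilon>" if b: "deg_over \<iota> b = degree \<phi>" "\<delta> \<le> v (\<theta> - b)" for b
  proof -
    have "v (\<theta> - c) < v (\<theta> - b)" if "deg_over \<iota> c < deg_over \<iota> b" for c
      using abstract_key_less[OF key, of c] that b by simp
    then obtain \<epsilon> where \<epsilon>: "abstract_key \<theta> (min_poly \<iota> b) \<epsilon>" "v (\<theta> - b) \<le> \<epsilon>"
      using abstract_key_min_poly by metis
    then have "\<epsilon> \<in> D" using b by (auto simp: D_def degree_min_poly intro: order_trans)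
    then show ?thesis using \<epsilon>(2) by blast
  qed
  have D_unbounded: "\<exists>\<epsilon>'\<in>D. \<epsilon> < \<epsilon>'" if \<epsilon>: "\<epsilon> \<in> D" for \<epsilon>
  proof -
    obtain Q where Q: "abstract_key \<theta> Q \<epsilon>" "degree Q = degree \<phi>" "\<delta> \<le> \<epsilon>" using \<epsilon> by (auto simp: D_def)
    obtain a where a: "v (\<theta> - a) = \<epsilon>" "deg_over \<iota> a = degree Q" by (rule abstract_key_root[OF Q(1)])
    then have "\<epsilon> \<in> distances \<iota> v \<theta> (degree \<phi>)" using Q(2) by (auto simp: distances_def)
    then obtain b where b: "deg_over \<iota> b = degree \<phi>" "\<epsilon> < v (\<theta> - b)"
      using no_max unfolding has_max_def distances_def by (auto simp: not_le)
    from Q(3) b(2) have "\<delta> \<le> v (\<theta> - b)" by (meson less_imp_le order_trans)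
    then obtain \<epsilon>' where "\<epsilon>' \<in> D" "v (\<theta> - b) \<le> \<epsilon>'"
      using min_poly_D[OF b(1)] by blast
    then show ?thesis using b(2) less_le_trans by blast
  qed
  have D_cofinal: "\<exists>\<epsilon>\<in>D. v (\<theta> - b) \<le> \<epsilon>" if b: "deg_over \<iota> b < degree \<phi>'" for b
  proof -
    obtain b' where b': "deg_over \<iota> b' = degree \<phi>" "v (\<theta> - b) \<le> v (\<theta> - b')" using cofinal[OF b] by blast
    show ?thesis
    proof (cases "\<delta> \<le> v (\<theta> - b')")
      case True
      then show ?thesis using min_poly_D[OF b'(1)] b'(2) order_trans by blast
    next
      case False
      then show ?thesis using \<delta> b'(2) by (intro bexI[of _ \<delta>]) auto
    qed
  qed
  have mono: "trunc \<theta> \<epsilon> \<le> trunc \<theta> \<epsilon>'" if "\<epsilon> \<le> \<epsilon>'" for \<epsilon> \<epsilon>'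
    using trunc_mono[OF that] by (simp add: le_fun_def)
  \<comment> \<open>\<phi>' tells the balls apart, as its root \<open>a'\<close> is closer to
    \<theta> than every radius in \<open>D\<close>. Hence the pointwise order of the valuations
    reflects the order of the radii.\<close>
  have strict: "\<not> trunc \<theta> \<epsilon>' \<le> trunc \<theta> \<epsilon>" if "\<epsilon> \<in> D" "\<epsilon> < \<epsilon>'" for \<epsilon> \<epsilon>'
  proof
    assume *: "trunc \<theta> \<epsilon>' \<le> trunc \<theta> \<epsilon>"
    have "trunc \<theta> \<epsilon> \<phi>' < trunc \<theta> \<epsilon>' \<phi>'"
      using a' D_less[OF that(1)] \<phi>' that(2) by (intro trunc_less[of _ a']) auto
    then show False using * by (auto simp: le_fun_def dest: spec[of _ \<phi>'])
  qed
  have R_iff: "(trunc \<theta> \<epsilon>, trunc \<theta> \<epsilon>') \<in> R \<longleftrightarrow> \<epsilon> \<le> \<epsilon>'" if "\<epsilon> \<in> D" "\<epsilon>' \<in> D" for \<epsilon> \<epsilon>'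
    using that mono strict[of \<epsilon>' \<epsilon>] by (auto simp: R_def I_def not_less[symmetric])
  have R_Id: "\<epsilon> < \<epsilon>'" if "(trunc \<theta> \<epsilon>, trunc \<theta> \<epsilon>') \<in> R - Id" "\<epsilon> \<in> D" "\<epsilon>' \<in> D" for \<epsilon> \<epsilon>'
    using R_iff[OF that(2,3)] that(1) by (cases "\<epsilon> = \<epsilon>'") auto
  have lin: "linear_order_on I R"
    unfolding order_on_defs
  proof (intro conjI)
    show "total_on I R"
      unfolding total_on_def I_def
    proof (intro ballI impI)
      fix x y assume "x \<in> trunc \<theta> ` D" "y \<in> trunc \<theta> ` D"
      then obtain \<epsilon> \<epsilon>' where "x = trunc \<theta> \<epsilon>" "y = trunc \<theta> \<epsilon>'" "\<epsilon> \<in> D" "\<epsilon>' \<in> D" by blast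
      then show "(x, y) \<in> R \<or> (y, x) \<in> R" using R_iff by (simp add: linear)
    qed
  qed (auto simp: R_def refl_on_def trans_def antisym_def)
  \<comment> \<open>An index is a valuation; its radius \<open>e x\<close> and a polynomial
    \<open>\<chi> x\<close> belonging to it are recovered by choice.\<close>
  have "\<forall>x\<in>I. \<exists>\<epsilon> Q. \<epsilon> \<in> D \<and> x = trunc \<theta> \<epsilon> \<and> abstract_key \<theta> Q \<epsilon> \<and> degree Q = degree \<phi>"
    by (auto simp: I_def D_def)
  then obtain e \<chi> where \<chi>: "\<And>x. x \<in> I \<Longrightarrow> e x \<in> D \<and> x = trunc \<theta> (e x) \<and> abstract_key \<theta> (\<chi> x) (e x) \<and> degree (\<chi> x) = degree \<phi>"
    by metis
  have "\<exists>b. val_at \<iota> v \<theta> (\<chi> x) = Fin b" if "x \<in> I" for x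
    using trunc_finite[of "\<chi> x" "e x" \<theta>] trunc_abstract_key[of \<theta> "\<chi> x" "e x"] abstract_key_nonzero[of \<theta> "\<chi> x" "e x"]
      \<chi>[OF that] D_finite by (cases "val_at \<iota> v \<theta> (\<chi> x)") auto
  then obtain \<beta> where \<beta>: "\<And>x. x \<in> I \<Longrightarrow> val_at \<iota> v \<theta> (\<chi> x) = Fin (\<beta> x)" by metis
  have aug: "ordinary_augmentation x (\<chi> y) (Fin (\<beta> y)) y" if xy: "(x, y) \<in> R - Id" for x y
  proof -
    have in_I: "x \<in> I" "y \<in> I" using xy by (auto simp: R_def)
    note x = \<chi>[OF in_I(1)] and y = \<chi>[OF in_I(2)]
    have "e x < e y" using R_Id[of "e x" "e y"] xy x y by simp
    moreover have "v (\<theta> - b) \<le> e x" if "deg_over \<iota> b < degree (\<chi> y)" for b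
      using lower[of b "e x"] that x y by (simp add: less_imp_le)
    ultimately have "ordinary_augmentation (trunc \<theta> (e x)) (\<chi> y) (val_at \<iota> v \<theta> (\<chi> y)) (trunc \<theta> (e y))"
      using y by (intro abstract_key_trunc_key_polynomial) auto
    then show ?thesis using x y \<beta>[OF in_I(2)] by simp
  qed
  have above: "\<exists>y\<in>I. (x, y) \<in> R - Id" if x: "x \<in> I" for x
  proof -
    obtain \<epsilon>' where \<epsilon>': "\<epsilon>' \<in> D" "e x < \<epsilon>'" using D_unbounded \<chi>[OF x] by blast
    then have "(trunc \<theta> (e x), trunc \<theta> \<epsilon>') \<in> R - Id"
      using R_iff[of "e x" \<epsilon>'] strict[of "e x" \<epsilon>'] \<chi>[OF x] by auto
    then show ?thesis using \<chi>[OF x] \<epsilon>' by (auto simp: I_def)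
  qed
  have ext: "\<forall>x\<in>I. x \<in> extensions \<iota> v"
    by (auto simp: I_def extensions_def valuation_trunc trunc_const)
  have least: "\<exists>i\<^sub>0\<in>I. (\<forall>i\<in>I. (i\<^sub>0, i) \<in> R) \<and> i\<^sub>0 = trunc \<theta> \<delta>"
    using \<delta> R_iff by (intro bexI[of _ "trunc \<theta> \<delta>"]) (auto simp: I_def D_def)
  have fam: "augmentation_family \<iota> v (trunc \<theta> \<delta>) (I, R, \<lambda>x. x)"
    unfolding augmentation_family.simps
    using lin ext above least aug \<chi> 
    by (intro conjI exI[of _ \<chi>] exI[of _ \<beta>] exI[of _ "degree \<phi>"]) (auto simp: R_def)
  have stable_low: "eventual_value (I, R, \<lambda>x. x) f (val_at \<iota> v \<theta> f)" if f: "degree f < degree \<phi>'" for f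
  proof -
    have "\<exists>\<epsilon>\<in>D. \<forall>z. f \<noteq> 0 \<longrightarrow> poly (lift f) z = 0 \<longrightarrow> v (\<theta> - z) \<le> \<epsilon>"
    proof (cases "f \<noteq> 0 \<and> (\<exists>z. poly (lift f) z = 0)")
      case True
      then obtain b where b: "poly (lift f) b = 0" "\<And>z. poly (lift f) z = 0 \<Longrightarrow> v (\<theta> - z) \<le> v (\<theta> - b)"
        using ex_closest_root by metis
      then have "deg_over \<iota> b < degree \<phi>'" using deg_over_le[of f b] True f by simp
      then obtain \<epsilon> where "\<epsilon> \<in> D" "v (\<theta> - b) \<le> \<epsilon>" using D_cofinal by blast
      then show ?thesis using b(2) by (meson order_trans)
    qed (use \<delta> in blast)
    then obtain \<epsilon> where \<epsilon>: "\<epsilon> \<in> D" "\<And>z. f \<noteq> 0 \<Longrightarrow> poly (lift f) z = 0 \<Longrightarrow> v (\<theta> - z) \<le> \<epsilon>" by blast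
    have "x f = val_at \<iota> v \<theta> f" if x: "x \<in> I" "(trunc \<theta> \<epsilon>, x) \<in> R" for x
    proof -
      have "\<epsilon> \<le> e x" using x R_iff[OF \<epsilon>(1), of "e x"] \<chi>[OF x(1)] by auto
      then have "trunc \<theta> (e x) f = val_at \<iota> v \<theta> f"
        using \<epsilon>(2) by (intro trunc_eq_val_at) (blast intro: order_trans)
      then show ?thesis using \<chi>[OF x(1)] by simp
    qed
    then show ?thesis using \<epsilon>(1) by (auto simp: I_def)
  qed
  have "\<not> stable (I, R, \<lambda>x. x) \<phi>'"
  proof
    assume "stable (I, R, \<lambda>x. x) \<phi>'"
    then obtain c x where x: "x \<in> I" "\<And>y. y \<in> I \<Longrightarrow> (x, y) \<in> R \<Longrightarrow> y \<phi>' = c"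
      unfolding stable_def eventual_value.simps by blast
    obtain y where y: "y \<in> I" "(x, y) \<in> R - Id" using above[OF x(1)] by blast
    have "e x < e y" using R_Id[of "e x" "e y"] \<chi> x(1) y by simp
    then have "trunc \<theta> (e x) \<phi>' < trunc \<theta> (e y) \<phi>'"
      using a' D_less[of "e x"] \<chi>[OF x(1)] \<phi>' by (intro trunc_less[of _ a']) auto
    then have "x \<phi>' < y \<phi>'" using \<chi> x(1) y(1) by metis
    moreover have "(x, x) \<in> R" using x(1) by (simp add: R_def)
    ultimately show False using x(2)[of x] x(2)[of y] x(1) y by auto
  qed
  then have "limit_key_polynomial (I, R, \<lambda>x. x) \<phi>'"
    unfolding limit_key_polynomial_def stable_def
    using abstract_key_monic[OF key'] stable_low by (meson linorder_not_le)
  moreover have "x \<phi>' < val_at \<iota> v \<theta> \<phi>'" if "x \<in> I" for x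
  proof -
    have "trunc \<theta> (e x) \<phi>' < val_at \<iota> v \<theta> \<phi>'"
      using a' D_less[of "e x"] \<chi>[OF that] \<phi>' by (intro trunc_less_val_at[of _ a']) auto
    then show ?thesis using \<chi>[OF that] by simp
  qed
  moreover have "trunc \<theta> \<delta>' = expansion_val (stable_val (I, R, \<lambda>x. x)) \<phi>' (val_at \<iota> v \<theta> \<phi>')"
    unfolding trunc_eq_expansion_val[OF key']
    by (intro expansion_val_cong abstract_key_degree_pos[OF key'])
      (rule stable_val_eq[OF lin stable_low, symmetric])
  ultimately have "limit_augmentation \<iota> v (trunc \<theta> \<delta>) (I, R, \<lambda>x. x) \<phi>' (val_at \<iota> v \<theta> \<phi>') (trunc \<theta> \<delta>')"
    using fam by simp
  moreover have "val_degree x = degree \<phi>" if "x \<in> I" for x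
    unfolding val_degree_def
  proof (rule Least_equality)
    obtain y where y: "y \<in> I" "(x, y) \<in> R - Id" using above[OF \<open>x \<in> I\<close>] by blast
    then have "\<chi> y \<in> key_polynomials x" "degree (\<chi> y) = degree \<phi>"
      using aug \<chi> by (auto simp: ordinary_augmentation_def)
    then show "degree \<phi> \<in> degree ` key_polynomials x" by (metis imageI)
    fix d assume "d \<in> degree ` key_polynomials x"
    then show "degree \<phi> \<le> d"
      using trunc_key_polynomial_degree[of \<theta> "\<chi> x" "e x"] \<chi>[OF that] by auto
  qed
  ultimately show ?thesis by (intro exI[of _ "(I, R, \<lambda>x. x)"]) simp
qed

end

context closure_valued
begin

text \<open>The polynomial of degree \<open>m l\<close> is the minimal polynomial of an element
  closer to \<theta> than all elements of smaller degree, as \<open>jump\<close> provides. If the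
  distances of degree \<open>m l\<close> have a maximum, an element attaining it is taken and the
  next step is ordinary; otherwise the next step is a limit.\<close>

lemma mlv_chain_exists:
  assumes m_0: "m 0 = 1" and m_less: "\<And>l. l < r \<Longrightarrow> m l < m (Suc l)" and m_r: "m r = deg_over \<iota> \<theta>"
    and cofinal: "\<And>l b. l < r \<Longrightarrow> deg_over \<iota> b < m (Suc l) \<Longrightarrow>
      \<exists>b'. deg_over \<iota> b' = m l \<and> v (\<theta> - b) \<le> v (\<theta> - b')"
    and jump: "\<And>l. l \<le> r \<Longrightarrow> \<exists>a. deg_over \<iota> a = m l \<and> (\<forall>b. deg_over \<iota> b < m l \<longrightarrow> v (\<theta> - b) < v (\<theta> - a))"
  shows "\<exists>\<phi> \<gamma> \<mu> (s :: nat \<Rightarrow> ('k poly \<Rightarrow> 'g with_infty, 'k, 'g) family augmentation).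
    mlv_chain \<iota> v \<theta> r \<phi> \<gamma> \<mu> s"
proof -
  \<comment> \<open>Before an ordinary step no element below the next degree may be closer than the
    radius; before a limit step any starting radius will do. The last term has to be the minimal
    polynomial of \<theta> itself, with radius \<open>Infty\<close>.\<close>
  let ?good = "\<lambda>l \<phi> \<delta>. abstract_key \<theta> \<phi> \<delta> \<and> degree \<phi> = m l \<and>
    (l < r \<longrightarrow> has_max (distances \<iota> v \<theta> (m l)) \<longrightarrow> (\<forall>b. deg_over \<iota> b < m (Suc l) \<longrightarrow> v (\<theta> - b) \<le> \<delta>)) \<and>
    (l = r \<longrightarrow> \<phi> = min_poly \<iota> \<theta> \<and> \<delta> = Infty)"
  have "\<exists>\<phi> \<delta>. ?good l \<phi> \<delta>" if l: "l \<le> r" for l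
  proof (cases "l = r")
    case True
    have "abstract_key \<theta> (min_poly \<iota> \<theta>) Infty"
      unfolding abstract_key_def degree_min_poly
      using min_poly_monic[unfolded degree_min_poly] min_poly_root
      by (auto simp: valuation_field_eq_Infty[OF valuation])
    then show ?thesis using True m_r by (auto simp: degree_min_poly)
  next
    case False
    then have l: "l < r" using l by simp
    obtain a0 where a0: "deg_over \<iota> a0 = m l" "\<And>b. deg_over \<iota> b < m l \<Longrightarrow> v (\<theta> - b) < v (\<theta> - a0)"
      using jump[of l] l by auto
    obtain a where a: "deg_over \<iota> a = m l" "v (\<theta> - a0) \<le> v (\<theta> - a)"
      "has_max (distances \<iota> v \<theta> (m l)) \<Longrightarrow> deg_over \<iota> b = m l \<Longrightarrow> v (\<theta> - b) \<le> v (\<theta> - a)" for b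
    proof (cases "has_max (distances \<iota> v \<theta> (m l))")
      case True
      then obtain a where "deg_over \<iota> a = m l" "\<And>b. deg_over \<iota> b = m l \<Longrightarrow> v (\<theta> - b) \<le> v (\<theta> - a)"
        by (auto simp: has_max_def distances_def)
      then show thesis using that a0(1) by blast
    qed (use that a0(1) in blast)
    obtain \<delta> where \<delta>: "abstract_key \<theta> (min_poly \<iota> a) \<delta>" "v (\<theta> - a) \<le> \<delta>"
      using abstract_key_min_poly[of a \<theta>] a0(2) a(1,2) less_le_trans by metis
    have "v (\<theta> - b) \<le> \<delta>" if max: "has_max (distances \<iota> v \<theta> (m l))" and b: "deg_over \<iota> b < m (Suc l)" for b
      using cofinal[OF l b] a(3)[OF max] \<delta>(2) by (meson order_trans)
    then show ?thesis
      using \<delta>(1) a(1) l by (intro exI[of _ "min_poly \<iota> a"] exI[of _ \<delta>]) (auto simp: degree_min_poly)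
  qed
  then obtain \<phi> \<delta> where good: "\<And>l. l \<le> r \<Longrightarrow> ?good l (\<phi> l) (\<delta> l)"
    by metis
  note key = good[THEN conjunct1] and deg = good[THEN conjunct2, THEN conjunct1]
  define \<gamma> where "\<gamma> l = val_at \<iota> v \<theta> (\<phi> l)" for l
  define \<mu> where "\<mu> l = trunc \<theta> (\<delta> l)" for l
  define limit where "limit l A \<longleftrightarrow>
    limit_augmentation \<iota> v (\<mu> l) A (\<phi> (Suc l)) (\<gamma> (Suc l)) (\<mu> (Suc l)) \<and>
    (case A of (I, R, \<rho>) \<Rightarrow> \<forall>i\<in>I. val_degree (\<rho> i) = degree (\<phi> l))"
    for l and A :: "('k poly \<Rightarrow> 'g with_infty, 'k, 'g) family"
  have "\<exists>A. limit l A" if l: "l < r" and max: "\<not> has_max (distances \<iota> v \<theta> (m l))" for l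
    unfolding limit_def \<mu>_def \<gamma>_def using l max cofinal[OF l] m_less[OF l] deg[of l] deg[of "Suc l"]
    by (intro limit_augmentation_exists key) simp_all
  then obtain A where
    A: "\<And>l. l < r \<Longrightarrow> \<not> has_max (distances \<iota> v \<theta> (m l)) \<Longrightarrow> limit l (A l)"
    by metis
  define s where "s l = (if has_max (distances \<iota> v \<theta> (m l)) then Ordinary else Limit (A l))" for l
  have ord: "ordinary_augmentation (\<mu> l) (\<phi> (Suc l)) (\<gamma> (Suc l)) (\<mu> (Suc l))"
    if l: "l < r" and max: "has_max (distances \<iota> v \<theta> (m l))" for l
    unfolding \<mu>_def \<gamma>_def
  proof (rule abstract_key_trunc_key_polynomial)
    show key_Suc: "abstract_key \<theta> (\<phi> (Suc l)) (\<delta> (Suc l))" using l by (intro key) simp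
    show "v (\<theta> - b) \<le> \<delta> l" if "deg_over \<iota> b < degree (\<phi> (Suc l))" for b
      using good[of l] that l max deg[of "Suc l"] by auto
    have "abstract_key \<theta> (\<phi> l) (\<delta> l)" using l by (intro key) simp
    then obtain a where "v (\<theta> - a) = \<delta> l" "deg_over \<iota> a = degree (\<phi> l)" by (rule abstract_key_root)
    then show "\<delta> l < \<delta> (Suc l)"
      using abstract_key_less[OF key_Suc, of a] deg[of l] deg[of "Suc l"] l m_less[OF l] by simp
  qed
  have "mlv_chain \<iota> v \<theta> r \<phi> \<gamma> \<mu> s"
    unfolding mlv_chain_def
  proof (intro conjI allI impI)
    show "lead_coeff (\<phi> 0) = 1" by (rule abstract_key_monic[OF key]) simp
    show "degree (\<phi> 0) = 1" using deg[of 0] m_0 by simp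
    \<comment> \<open>Digits with respect to a linear polynomial are constants, on which
      \<open>v\<^sub>\<theta>\<close> is \<open>v\<close>; this is the form prescribed for
      \<open>\<mu>\<^sub>0\<close>.\<close>
    have "expansion_val (val_at \<iota> v \<theta>) (\<phi> 0) (\<gamma> 0) = expansion_val (\<lambda>a. v (\<iota> (coeff a 0))) (\<phi> 0) (\<gamma> 0)"
    proof (rule expansion_val_cong)
      fix f :: "'k poly" assume "degree f < degree (\<phi> 0)"
      then obtain c where "f = [:c:]" using deg[of 0] m_0 by (auto elim: degree_eq_zeroE)
      then show "val_at \<iota> v \<theta> f = v (\<iota> (coeff f 0))" by (simp add: val_at_def lift_const)
    qed (use deg[of 0] m_0 in simp)
    then show "\<mu> 0 = expansion_val (\<lambda>a. v (\<iota> (coeff a 0))) (\<phi> 0) (\<gamma> 0)"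
      using trunc_eq_expansion_val[OF key[of 0]] by (simp add: \<mu>_def \<gamma>_def)
    show "\<mu> r = val_at \<iota> v \<theta>" "\<gamma> r = Infty" "\<phi> r = min_poly \<iota> \<theta>"
      using good[of r] min_poly_root[of \<theta>] by (auto simp: \<mu>_def \<gamma>_def trunc_Infty val_at_def)
    fix l assume l: "l < r"
    show "degree (\<phi> l) < degree (\<phi> (Suc l))" using deg[of l] deg[of "Suc l"] l m_less[OF l] by simp
    show "\<gamma> l \<noteq> Infty"
    \<comment> \<open>The value \<open>Infty\<close> would make \<theta> a root of
      \<open>\<phi> l\<close>, whose degree is less than that of \<theta>.\<close>
    proof
      assume "\<gamma> l = Infty"
      then have "poly (lift (\<phi> l)) \<theta> = 0"
        by (simp add: \<gamma>_def val_at_def valuation_field_eq_Infty[OF valuation])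
      then have "deg_over \<iota> \<theta> \<le> m l"
        using deg_over_le[of "\<phi> l" \<theta>] abstract_key_nonzero[OF key[of l]] deg[of l] l by simp
      moreover have "m l < m r"
        using l
      proof (induction rule: strict_inc_induct)
        case (base i)
        then show ?case using m_less[of i] by simp
      next
        case (step i)
        then show ?case using m_less[of i] by simp
      qed
      ultimately show False using m_r by simp
    qed
    show "case s l of Ordinary \<Rightarrow> ordinary_augmentation (\<mu> l) (\<phi> (Suc l)) (\<gamma> (Suc l)) (\<mu> (Suc l))
      | Limit A \<Rightarrow> limit_augmentation \<iota> v (\<mu> l) A (\<phi> (Suc l)) (\<gamma> (Suc l)) (\<mu> (Suc l)) \<and>
          val_at \<iota> v \<theta> (\<phi> l) = \<gamma> l \<and>
          (case A of (I, R, \<rho>) \<Rightarrow> \<forall>i\<in>I. val_degree (\<rho> i) = degree (\<phi> l))"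
      using ord[OF l] A[OF l] by (simp add: s_def \<gamma>_def limit_def)
  qed
  then show ?thesis by blast
qed

end

section \<open>Comparison of a given chain with an Okutsu sequence\<close>

context mlv
begin

text \<open>Both degree sequences obey the same recursion. If \<open>\<phi> (Suc n)\<close> had
  degree below \<open>m (Suc n)\<close>, its closest root would be matched by an element of degree
  \<open>m n\<close> through \<open>cofinal\<close>; if above, the element from \<open>jump\<close>
  would be matched by one of degree \<open>m n\<close> through \<open>next_key\<close>. Each
  contradicts strictness. The claim reaches up to the smaller of \<open>N\<close> and
  \<open>r\<close>, since their equality is deduced from it.\<close>

lemma chain_degrees:
  assumes m_0: "m 0 = 1"
    and cofinal: "\<And>l b. l < r \<Longrightarrow> deg_over \<iota> b < m (Suc l) \<Longrightarrow>
      \<exists>b'. deg_over \<iota> b' = m l \<and> v (\<theta> - b) \<le> v (\<theta> - b')"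
    and jump: "\<And>l. l \<le> r \<Longrightarrow> \<exists>a. deg_over \<iota> a = m l \<and> (\<forall>b. deg_over \<iota> b < m l \<longrightarrow> v (\<theta> - b) < v (\<theta> - a))"
    and m_less: "\<And>l. l < r \<Longrightarrow> m l < m (Suc l)"
  shows "n \<le> N \<Longrightarrow> n \<le> r \<Longrightarrow> degree (\<phi> n) = m n"
proof (induction n)
  case 0
  then show ?case using start(2) m_0 by simp
next
  case (Suc n)
  then have n: "n < N" "n < r" and IH: "degree (\<phi> n) = m n" by simp_all
  obtain \<delta> where "abstract_key \<theta> (\<phi> n) \<delta>" using chain_abstract_key n by (meson less_imp_le)
  from chain_step[OF n(1) this] have next_n: "next_key \<theta> (m n) (\<phi> (Suc n))" using IH by simp
  then obtain \<delta>' where key: "abstract_key \<theta> (\<phi> (Suc n)) \<delta>'" by (auto simp: next_key_def)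
  have "\<not> degree (\<phi> (Suc n)) < m (Suc n)"
  proof
    assume less: "degree (\<phi> (Suc n)) < m (Suc n)"
    obtain a where a: "v (\<theta> - a) = \<delta>'" "deg_over \<iota> a = degree (\<phi> (Suc n))"
      by (rule abstract_key_root[OF key])
    then obtain b where "deg_over \<iota> b = m n" "\<delta>' \<le> v (\<theta> - b)"
      using cofinal[OF n(2), of a] less by auto
    then show False using abstract_key_less[OF key, of b] degree_less[OF n(1)] IH by auto
  qed
  moreover have "\<not> m (Suc n) < degree (\<phi> (Suc n))"
  proof
    assume less: "m (Suc n) < degree (\<phi> (Suc n))"
    obtain a where a: "deg_over \<iota> a = m (Suc n)" "\<And>b. deg_over \<iota> b < m (Suc n) \<Longrightarrow> v (\<theta> - b) < v (\<theta> - a)"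
      using jump[of "Suc n"] n by auto
    then obtain b where "deg_over \<iota> b = m n" "v (\<theta> - a) \<le> v (\<theta> - b)"
      using next_n less unfolding next_key_def by metis
    then show False using a(2)[of b] m_less[OF n(2)] by auto
  qed
  ultimately show ?case by simp
qed

end

lemma mono_upto:
  fixes m :: "nat \<Rightarrow> nat"
  assumes "\<And>l. l < r \<Longrightarrow> m l < m (Suc l)" "l < r"
  shows "m l < m r"
  using assms(2)
proof (induction rule: strict_inc_induct)
  case (base i)
  then show ?case using assms(1)[of i] by simp
next
  case (step i)
  then show ?case using assms(1)[of i] by simp
qed

theorem theorem1p4:
  fixes \<iota> :: "'k::field \<Rightarrow> 'l::alg_closed_field"
    and v :: "'l \<Rightarrow> 'g::linordered_ab_group_add with_infty"
    and \<theta> :: 'l and n r :: nat and A :: "nat \<Rightarrow> 'l set" and m :: "nat \<Rightarrow> nat"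
  assumes "algebraic_closure \<iota>"
    and "valuation v" and "range v = UNIV"
    and "deg_over \<iota> \<theta> = n" and "n \<ge> 1"
    and "okutsu_sequence \<iota> v \<theta> r A m"
  shows "r = depth \<iota> v \<theta> \<and>
    (\<forall>\<phi> \<gamma> \<mu> (s :: nat \<Rightarrow> ('i, 'k, 'g) family augmentation). mlv_chain \<iota> v \<theta> r \<phi> \<gamma> \<mu> s \<longrightarrow>
       (\<forall>l<r. s l = Ordinary \<longleftrightarrow> has_max (distances \<iota> v \<theta> (m l))))"
proof -
  interpret closure_valued \<iota> v
    by standard (use assms in auto)
  have m: "m 0 = 1" "\<And>l. l < r \<Longrightarrow> m l < m (Suc l)" "m r = deg_over \<iota> \<theta>"
    and A: "\<And>l. l \<le> r \<Longrightarrow> A l \<noteq> {}" "\<And>l a. l \<le> r \<Longrightarrow> a \<in> A l \<Longrightarrow> deg_over \<iota> a = m l"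
    and OS0: "\<And>l b. l < r \<Longrightarrow> deg_over \<iota> b < m (Suc l) \<Longrightarrow> \<exists>a\<in>A l. v (\<theta> - b) \<le> v (\<theta> - a)"
    and OS3: "\<And>l a b. l < r \<Longrightarrow> a \<in> A l \<Longrightarrow> b \<in> A (Suc l) \<Longrightarrow> v (\<theta> - a) < v (\<theta> - b)"
    using assms(6) unfolding okutsu_sequence_def common_degree_def by blast+
  have cofinal: "\<exists>b'. deg_over \<iota> b' = m l \<and> v (\<theta> - b) \<le> v (\<theta> - b')"
    if "l < r" "deg_over \<iota> b < m (Suc l)" for l b
    using OS0[OF that] A(2)[of l] that(1) by (meson less_imp_le)
  \<comment> \<open>For \<open>l = Suc k\<close>, (OS0) bounds the distance of \<open>b\<close> by
    that of a member of \<open>A k\<close>, and (OS3) places every member of \<open>A l\<close>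
    strictly closer.\<close>
  have jump: "\<exists>a. deg_over \<iota> a = m l \<and> (\<forall>b. deg_over \<iota> b < m l \<longrightarrow> v (\<theta> - b) < v (\<theta> - a))"
    if l: "l \<le> r" for l
  proof -
    obtain a where a: "a \<in> A l" using A(1)[OF l] by blast
    have "v (\<theta> - b) < v (\<theta> - a)" if b: "deg_over \<iota> b < m l" for b
    proof (cases l)
      case 0
      then show ?thesis using b m(1) deg_over_pos[of b] by simp
    next
      case (Suc k)
      then show ?thesis using OS0[of k b] OS3[of k _ a] a b l le_less_trans by fastforce
    qed
    then show ?thesis using A(2)[OF l a] by blast
  qed
  \<comment> \<open>The degrees of the chain and the \<open>m l\<close> increase strictly, coincide
    as far as both are defined and end with the degree of \<theta>, so neither can stop earlier. The
    index type is left open because \<open>depth\<close> uses the type of valuations.\<close>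
  have length: "N = r"
    if "mlv_chain \<iota> v \<theta> N \<phi> \<gamma> \<mu> (s :: nat \<Rightarrow> ('j, 'k, 'g) family augmentation)" for N \<phi> \<gamma> \<mu> s
  proof -
    interpret mlv \<iota> v \<theta> N \<phi> \<gamma> \<mu> s by standard (rule that)
    note degrees = chain_degrees[where m = m and r = r, OF m(1) cofinal jump m(2)]
    have "degree (\<phi> N) = m r" using final(3) m(3) by (simp add: degree_min_poly)
    then show ?thesis
      using degrees[of N] degrees[of r] mono_upto[of r m N, OF m(2)]
        mono_upto[of N "\<lambda>n. degree (\<phi> n)" r, OF degree_less] by (cases N r rule: linorder_cases) auto
  qed
  \<comment> \<open>\<open>depth\<close> is a definite description: existence comes from the
    constructed chain, uniqueness from \<open>length\<close>.\<close>
  have "r = depth \<iota> v \<theta>"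
    unfolding depth_def
    using mlv_chain_exists[OF m cofinal jump] length by (intro the_equality[symmetric]) blast+
  moreover have "s l = Ordinary \<longleftrightarrow> has_max (distances \<iota> v \<theta> (m l))"
    if chain: "mlv_chain \<iota> v \<theta> r \<phi> \<gamma> \<mu> (s :: nat \<Rightarrow> ('i, 'k, 'g) family augmentation)" and l: "l < r"
    for \<phi> \<gamma> \<mu> s l
  proof -
    interpret mlv \<iota> v \<theta> r \<phi> \<gamma> \<mu> s by standard (rule chain)
    have "degree (\<phi> l) = m l"
      using chain_degrees[where m = m and r = r, OF m(1) cofinal jump m(2)] l by simp
    moreover obtain \<delta> where "abstract_key \<theta> (\<phi> l) \<delta>" using chain_abstract_key l by (meson less_imp_le)
    from chain_step[OF l this] have "s l = Ordinary \<longleftrightarrow> has_max (distances \<iota> v \<theta> (degree (\<phi> l)))" ..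
    ultimately show ?thesis by simp
  qed
  ultimately show ?thesis by blast
qed

end
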